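(* Let $f_i$ ($i=1,\dots,m$), $H$, $P$, $G$, $A_i$, $B$, $b$ be the data of the linearly constrained composite problem described in the context, with objective $F$, augmented Lagrangian $\mathcal{L}_\rho$ and $\mathbf{A}=[A_1|\cdots|A_m]$. Suppose that: - $\nabla H$ is $\ell_H$-Lipschitz continuous, $\nabla P$ is $\ell_P$-Lipschitz continuous, and $G$ is $\beta$-weakly convex; - $\operatorname{Im}(\mathbf{A})\cup\{b\}\subseteq\operatorname{Im}(B)$; - $\lambda:=\lambda_{\min}(B^\top B)>0$; - $\mathbf{x}\mapsto\sum_{i=1}^m f_i(x_i)+P(\mathbf{x})-G(\mathbf{x})$ is coercive; - $H$ is bounded below; - $G$ is differentiable with $\ell_G$-Lipschitz continuous gradient; - for all $i\in\{1,\dots,m\}$, $\nabla\phi_i$ is $\ell_\phi$-Lipschitz continuous. Let $(\mathbf{x}_n,y_n,z_n)_{n\in\mathbb{N}}$ be a sequence generated by the BPL-ADMM algorithm described in the context (with parameters $\alpha,\mu,\nu,\rho,\ell_\psi,\mu_n,\nu_n$ and functions $\phi_i,\psi$ as there), with $z_0\in\operatorname{Im}(B)$ and $\limsup_{n\to+\infty}\mu_n=\overline{\mu}<+\infty$. Define $$\mathcal{F}(\mathbf{x},y,z,t):=\mathcal{L}_\rho(\mathbf{x},y,z)+c\|y-t\|^2,\qquad c=\frac{(\ell_H+2\nu\ell_\psi)\nu\ell_\psi}{\lambda\rho}.$$ (i) Suppose that $\mathcal{F}$ is a KL function. Then $(\mathbf{x}_n,y_n,z_n)_{n\in\mathbb{N}}$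 converges to a stationary point $(\mathbf{x}^*,y^*,z^* )$ of $\mathcal{L}_\rho$ and $$\sum_{n=0}^{+\infty}\|(\mathbf{x}_{n+1},y_{n+1},z_{n+1})-(\mathbf{x}_n,y_n,z_n)\|<+\infty.$$ (ii) Suppose that $\mathcal{F}$ is a KL function with exponent $\kappa\in[0,1)$, and let $(\mathbf{x}^*,y^*,z^* )$ be the limit of the sequence given by (i). Then the following hold. (a) If $\kappa=0$, then $(\mathbf{x}_n,y_n,z_n)_{n\in\mathbb{N}}$ converges to $(\mathbf{x}^*,y^*,z^* )$ in a finite number of steps. (b) If $\kappa\in(0,\frac12]$, then there exist $\overline{\gamma}\in(0,+\infty)$ and $\zeta\in(0,1)$ such that, for all $n\in\mathbb{N}$, $$\|(\mathbf{x}_n,y_n,z_n)-(\mathbf{x}^*,y^*,z^* )\|\le\overline{\gamma}\zeta^{\frac n2},\qquad \|\mathbf{A}\mathbf{x}_n+By_n-b\|\le\overline{\gamma}\zeta^{\frac n2},$$ $$|\mathcal{L}_\rho(\mathbf{x}_n,y_n,z_n)-\mathcal{L}_\rho(\mathbf{x}^*,y^*,z^* )|\le\overline{\gamma}\zeta^{n},\qquad |F(\mathbf{x}_n,y_n)-F(\mathbf{x}^*,y^* )|\le\overline{\gamma}\zeta^{\frac n2}.$$ (c) If $\kappa\in(\frac12,1)$, then there exists $\overline{\gamma}\in(0,+\infty)$ such that, for all integers $n\ge1$, $$\|(\mathbf{x}_n,y_n,z_n)-(\mathbf{x}^*,y^*,z^* )\|\le\overline{\gamma}n^{-\frac{1-\kappa}{2\kappa-1}},\qquad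 \|\mathbf{A}\mathbf{x}_n+By_n-b\|\le\overline{\gamma}n^{-\frac{1-\kappa}{2\kappa-1}},$$ $$|\mathcal{L}_\rho(\mathbf{x}_n,y_n,z_n)-\mathcal{L}_\rho(\mathbf{x}^*,y^*,z^* )|\le\overline{\gamma}n^{-\frac{2-2\kappa}{2\kappa-1}},\qquad |F(\mathbf{x}_n,y_n)-F(\mathbf{x}^*,y^* )|\le\overline{\gamma}n^{-\frac{1-\kappa}{2\kappa-1}}.$$
   Context: **Notation.** $\mathbb{N}$ is the set of nonnegative integers; $\|\cdot\|$ is the Euclidean norm; $\operatorname{Im}(M)$ is the image (range) of a matrix $M$; $\lambda_{\min}(M)$ is its smallest eigenvalue. A function $f:\mathbb{R}^d\to(-\infty,+\infty]$ is $\alpha$-strongly convex ($\alpha\ge0$) if $f-\frac{\alpha}{2}\|\cdot\|^2$ is convex, $\beta$-weakly convex ($\beta\ge0$) if $f+\frac{\beta}{2}\|\cdot\|^2$ is convex, and coercive if $f(x)\to+\infty$ as $\|x\|\to+\infty$. **Subdifferentials.** For $x$ with $|f(x)|<+\infty$, the regular subdifferential $\widehat{\partial}f(x)$ is the set of $x^*$ with $\liminf_{y\to x}\frac{f(y)-f(x)-\langle x^*,y-x\rangle}{\|y-x\|}\ge0$, and the limiting subdifferential $\partial_Lf(x)$ is the set of $x^*$ for which there are $x_n\to x$ with $f(x_n)\to f(x)$ and $x_n^*\in\widehat{\partial}f(x_n)$ with $x_n^*\to x^*$; both are empty if $|f(x)|=+\infty$. $\operatorname{dom}\partial_Lf=\{x:\partial_Lf(x)\ne\varnothing\}$.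 **KL property.** A proper lower semicontinuous function $\mathcal{F}$ satisfies the Kurdyka–Łojasiewicz (KL) property at $\overline{x}\in\operatorname{dom}\partial_L\mathcal{F}$ if there are $\eta\in(0,+\infty]$, a neighborhood $V$ of $\overline{x}$, and a continuous concave function $\varphi:[0,\eta)\to[0,+\infty)$ such that $\varphi$ is continuously differentiable with $\varphi'>0$ on $(0,\eta)$, $\varphi(0)=0$, and, for all $x\in V$ with $\mathcal{F}(\overline{x})<\mathcal{F}(x)<\mathcal{F}(\overline{x})+\eta$, $\varphi'(\mathcal{F}(x)-\mathcal{F}(\overline{x}))\operatorname{dist}(0,\partial_L\mathcal{F}(x))\ge1$ (with $\operatorname{dist}(0,\varnothing)=+\infty$). $\mathcal{F}$ is a KL function if it satisfies the KL property at every point of $\operatorname{dom}\partial_L\mathcal{F}$. It is a KL function with exponent $\kappa\in[0,1)$ if it is a KL function and, at every point of $\operatorname{dom}\partial_L\mathcal{F}$, the function $\varphi$ can be chosen of the form $\varphi(t)=\theta t^{1-\kappa}$ for some $\theta>0$ (with the same $\kappa$ at all points). **Problem.** $$\min_{x_i\in\mathbb{R}^{d_i},\,y\in\mathbb{R}^q} F(\mathbf{x},y):=\sum_{i=1}^m f_i(x_i)+H(y)+P(\mathbf{x})-G(\mathbf{x})\quad\text{s.t. }\sum_{i=1}^m A_ix_i+By=b,$$ where $\mathbf{x}=(x_1,\dots,x_m)\in\mathbb{R}^{d_1}\times\cdots\times\mathbb{R}^{d_m}$; each $f_i:\mathbb{R}^{d_i}\to(-\infty,+\infty]$ is proper and lower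 semicontinuous; $H:\mathbb{R}^q\to\mathbb{R}$ and $P:\mathbb{R}^{d_1}\times\cdots\times\mathbb{R}^{d_m}\to\mathbb{R}$ are differentiable (possibly nonconvex) with Lipschitz continuous gradients; $G:\mathbb{R}^{d_1}\times\cdots\times\mathbb{R}^{d_m}\to\mathbb{R}$ is continuous and weakly convex; $A_i\in\mathbb{R}^{p\times d_i}$, $B\in\mathbb{R}^{p\times q}$, $b\in\mathbb{R}^p$. Write $\mathbf{A}=[A_1|\cdots|A_m]$, so $\mathbf{A}\mathbf{x}=\sum_iA_ix_i$. **Augmented Lagrangian.** For $z\in\mathbb{R}^p$ and $\rho>0$, $$\mathcal{L}_\rho(\mathbf{x},y,z)=\sum_{i=1}^m f_i(x_i)+H(y)+P(\mathbf{x})-G(\mathbf{x})+\langle z,\mathbf{A}\mathbf{x}+By-b\rangle+\frac{\rho}{2}\|\mathbf{A}\mathbf{x}+By-b\|^2.$$ A point $(\overline{\mathbf{x}},\overline{y},\overline{z})$ is a stationary point of $\mathcal{L}_\rho$ if $0\in\partial_L\mathcal{L}_\rho(\overline{\mathbf{x}},\overline{y},\overline{z})$, equivalently: $0\in\partial_L\big(\sum_{i=1}^m f_i-G\big)(\overline{\mathbf{x}})+\nabla P(\overline{\mathbf{x}})+\mathbf{A}^\top\overline{z}$, $0=\nabla H(\overline{y})+B^\top\overline{z}$, and $0=\mathbf{A}\overline{\mathbf{x}}+B\overline{y}-b$. **Bregman distance.** For a differentiable convex $\phi$, $D_\phi(u,v)=\phi(u)-\phi(v)-\langle\nabla\phi(v),u-v\rangle$.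 **BPL-ADMM algorithm** (Bregman proximal linearized ADMM). Choose $\mathbf{x}_0=(x_{1,0},\dots,x_{m,0})$, $y_0\in\mathbb{R}^q$, $z_0\in\mathbb{R}^p$. Let $\phi_i:\mathbb{R}^{d_i}\to\mathbb{R}$, $i=1,\dots,m$, be differentiable $\alpha$-strongly convex functions with $\alpha\in(0,+\infty)$, and let $\psi:\mathbb{R}^q\to\mathbb{R}$ be a differentiable convex function with $\ell_\psi$-Lipschitz continuous gradient. With $\lambda=\lambda_{\min}(B^\top B)$ and $\ell_H,\ell_P,\beta$ the Lipschitz/weak convexity constants of $\nabla H,\nabla P,G$, let $$\mu\in\Big(\tfrac{\ell_P+\beta}{\alpha},+\infty\Big),\quad \nu\in[0,+\infty),\quad \rho\in\Big(\tfrac{\ell_H+\sqrt{\ell_H^2+8(\ell_H+2\nu\ell_\psi)^2}}{2\lambda},+\infty\Big).$$ For each $n\in\mathbb{N}$: let $\nabla P(\mathbf{x}_n)=(\nabla_1P(\mathbf{x}_n),\dots,\nabla_mP(\mathbf{x}_n))$ (block components), pick $g_n=(g_{1,n},\dots,g_{m,n})\in\partial_LG(\mathbf{x}_n)$, $\mu_n\in[\mu,+\infty)$, $\nu_n\in[0,\nu]$. For $i=1,\dots,m$ in order, put $\mathbf{u}_{i,n+1}(x_i)=(x_{1,n+1},\dots,x_{i-1,n+1},x_i,x_{i+1,n},\dots,x_{m,n})$ and find $$x_{i,n+1}\in\operatorname*{argmin}_{x_i\in\mathbb{R}^{d_i}}\Big(f_i(x_i)+\langle\nabla_iP(\mathbf{x}_n)-g_{i,n},x_i\rangle+\langle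 z_n,A_ix_i\rangle+\tfrac{\rho}{2}\|\mathbf{A}\mathbf{u}_{i,n+1}(x_i)+By_n-b\|^2+\mu_nD_{\phi_i}(x_i,x_{i,n})\Big);$$ then, with $\mathbf{x}_{n+1}=(x_{1,n+1},\dots,x_{m,n+1})$, $$y_{n+1}\in\operatorname*{argmin}_{y\in\mathbb{R}^q}\Big(H(y)+\langle z_n,By\rangle+\tfrac{\rho}{2}\|\mathbf{A}\mathbf{x}_{n+1}+By-b\|^2+\nu_nD_\psi(y,y_n)\Big),$$ $$z_{n+1}=z_n+\rho(\mathbf{A}\mathbf{x}_{n+1}+By_{n+1}-b).$$ A sequence generated by the algorithm is an infinite sequence satisfying these relations for all $n\in\mathbb{N}$.
   Formalization: In (ii)(b), the bounds on |L_ρ(x_n,y_n,z_n) − L_ρ(x*,y*,z* )| and |F(x_n,y_n) − F(x*,y* )| at n = 0 are claimed only when F(x_0,y_0) < +∞, since x_0 is arbitrary and they fail if some f_i(x_{i,0}) = +∞; for n ≥ 1 they hold unconditionally. *)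

theory Defs
  imports "HOL-Analysis.Analysis"
begin

section \<open>Blocks of a product space\<close>

text \<open>
  The product $R^{d_1} \times \dots \times R^{d_m}$ is rendered as \<^typ>\<open>real^'d\<close> together with
  a map \<open>blk\<close> from the coordinates onto \<open>{1..m}\<close>: coordinate \<open>j\<close> belongs to block \<open>blk j\<close>, so
  that $d_i$ is the number of \<open>j\<close> with \<open>blk j = i\<close>. The factor $R^{d_i}$ is the coordinate
  subspace \<open>block_space blk i\<close>, and functions on $R^{d_i}$ are only ever looked at on that subspace.
\<close>

definition block_space :: "('d::finite \<Rightarrow> nat) \<Rightarrow> nat \<Rightarrow> (real^'d) set" where
  "block_space blk i = {x. \<forall>j. blk j \<noteq> i \<longrightarrow> x $ j = 0}"

definition block :: "('d::finite \<Rightarrow> nat) \<Rightarrow> nat \<Rightarrow> real^'d \<Rightarrow> real^'d" where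
  "block blk i x = (\<chi> j. if blk j = i then x $ j else 0)"

text \<open>
  \<open>block_columns blk i A\<close> is the submatrix $A_i$ of $A = [A_1 | \dots | A_m]$, padded by zero columns.
\<close>

definition block_columns :: "('d::finite \<Rightarrow> nat) \<Rightarrow> nat \<Rightarrow> real^'d^'p \<Rightarrow> real^'d^'p" where
  "block_columns blk i A = (\<chi> r j. if blk j = i then A $ r $ j else 0)"

text \<open>
  \<open>gs_point blk i x' v x\<close> is $(x'_1, \dots, x'_{i-1}, v, x_{i+1}, \dots, x_m)$.
\<close>

definition gs_point :: "('d::finite \<Rightarrow> nat) \<Rightarrow> nat \<Rightarrow> real^'d \<Rightarrow> real^'d \<Rightarrow> real^'d \<Rightarrow> real^'d" where
  "gs_point blk i x' v x =
     (\<chi> j. if blk j < i then x' $ j else if blk j = i then v $ j else x $ j)"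


section \<open>Gradients, Bregman distances, convexity notions\<close>

text \<open>
  The gradient relative to a linear subspace \<open>S\<close>. Requiring \<open>v \<in> S\<close> makes it unique at points of \<open>S\<close>.
\<close>

definition grad_within :: "'a::real_inner set \<Rightarrow> ('a \<Rightarrow> real) \<Rightarrow> 'a \<Rightarrow> 'a" where
  "grad_within S f x = (THE v. v \<in> S \<and> (f has_derivative (\<lambda>h. v \<bullet> h)) (at x within S))"

abbreviation grad :: "('a::real_inner \<Rightarrow> real) \<Rightarrow> 'a \<Rightarrow> 'a" where
  "grad \<equiv> grad_within UNIV"

definition bregman :: "'a::real_inner set \<Rightarrow> ('a \<Rightarrow> real) \<Rightarrow> 'a \<Rightarrow> 'a \<Rightarrow> real" where
  "bregman S \<phi> u v = \<phi> u - \<phi> v - grad_within S \<phi> v \<bullet> (u - v)"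

definition strongly_convex_on :: "real \<Rightarrow> 'a::real_inner set \<Rightarrow> ('a \<Rightarrow> real) \<Rightarrow> bool" where
  "strongly_convex_on \<alpha> S f \<longleftrightarrow> convex_on S (\<lambda>x. f x - \<alpha> / 2 * (norm x)\<^sup>2)"

definition weakly_convex_on :: "real \<Rightarrow> 'a::real_inner set \<Rightarrow> ('a \<Rightarrow> real) \<Rightarrow> bool" where
  "weakly_convex_on \<beta> S f \<longleftrightarrow> convex_on S (\<lambda>x. f x + \<beta> / 2 * (norm x)\<^sup>2)"

definition proper_on :: "'a set \<Rightarrow> ('a \<Rightarrow> ereal) \<Rightarrow> bool" where
  "proper_on S f \<longleftrightarrow> (\<forall>x\<in>S. f x \<noteq> -\<infinity>) \<and> (\<exists>x\<in>S. f x \<noteq> \<infinity>)"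

definition lsc_on :: "'a::topological_space set \<Rightarrow> ('a \<Rightarrow> ereal) \<Rightarrow> bool" where
  "lsc_on S f \<longleftrightarrow> (\<forall>x\<in>S. f x \<le> Liminf (at x within S) f)"

definition coercive :: "('a::real_normed_vector \<Rightarrow> ereal) \<Rightarrow> bool" where
  "coercive f \<longleftrightarrow> (f \<longlongrightarrow> \<infinity>) at_infinity"

definition real_eigenvalue :: "real^'n^'n \<Rightarrow> real \<Rightarrow> bool" where
  "real_eigenvalue M l \<longleftrightarrow> (\<exists>v. v \<noteq> 0 \<and> M *v v = l *\<^sub>R v)"

definition lambda_min :: "real^'n^'n \<Rightarrow> real" where
  "lambda_min M = (LEAST l. real_eigenvalue M l)"


section \<open>Subdifferentials and the Kurdyka--Lojasiewicz property\<close>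

definition regular_subdiff :: "('a::real_inner \<Rightarrow> ereal) \<Rightarrow> 'a \<Rightarrow> 'a set" where
  "regular_subdiff f x =
     {v. \<bar>f x\<bar> \<noteq> \<infinity> \<and>
         0 \<le> Liminf (at x) (\<lambda>y. (f y - f x - ereal (v \<bullet> (y - x))) / ereal (norm (y - x)))}"

definition limiting_subdiff :: "('a::real_inner \<Rightarrow> ereal) \<Rightarrow> 'a \<Rightarrow> 'a set" where
  "limiting_subdiff f x =
     {v. \<bar>f x\<bar> \<noteq> \<infinity> \<and>
         (\<exists>X W. X \<longlonglongrightarrow> x \<and> (\<lambda>n. f (X n)) \<longlonglongrightarrow> f x \<and>
                (\<forall>n. W n \<in> regular_subdiff f (X n)) \<and> W \<longlonglongrightarrow> v)}"

definition dom_limiting_subdiff :: "('a::real_inner \<Rightarrow> ereal) \<Rightarrow> 'a set" where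
  "dom_limiting_subdiff f = {x. limiting_subdiff f x \<noteq> {}}"

text \<open>The value is \<open>\<infinity>\<close> if the subdifferential is empty.\<close>

definition dist0_subdiff :: "('a::real_inner \<Rightarrow> ereal) \<Rightarrow> 'a \<Rightarrow> ereal" where
  "dist0_subdiff f x = (INF v\<in>limiting_subdiff f x. ereal (norm v))"

definition desingularizing :: "ereal \<Rightarrow> (real \<Rightarrow> real) \<Rightarrow> bool" where
  "desingularizing \<eta> \<phi> \<longleftrightarrow>
     continuous_on {t. 0 \<le> t \<and> ereal t < \<eta>} \<phi> \<and>
     concave_on {t. 0 \<le> t \<and> ereal t < \<eta>} \<phi> \<and>
     (\<forall>t. 0 \<le> t \<and> ereal t < \<eta> \<longrightarrow> 0 \<le> \<phi> t) \<and>
     (\<forall>t. 0 < t \<and> ereal t < \<eta> \<longrightarrow> \<phi> differentiable (at t) \<and> 0 < deriv \<phi> t) \<and>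
     continuous_on {t. 0 < t \<and> ereal t < \<eta>} (deriv \<phi>) \<and>
     \<phi> 0 = 0"

definition KL_witness ::
  "('a::real_inner \<Rightarrow> ereal) \<Rightarrow> 'a \<Rightarrow> ereal \<Rightarrow> 'a set \<Rightarrow> (real \<Rightarrow> real) \<Rightarrow> bool" where
  "KL_witness F xb \<eta> V \<phi> \<longleftrightarrow>
     0 < \<eta> \<and> xb \<in> interior V \<and> desingularizing \<eta> \<phi> \<and>
     (\<forall>x\<in>V. F xb < F x \<and> F x < F xb + \<eta> \<longrightarrow>
        1 \<le> ereal (deriv \<phi> (real_of_ereal (F x - F xb))) * dist0_subdiff F x)"

definition KL_function :: "('a::real_inner \<Rightarrow> ereal) \<Rightarrow> bool" where
  "KL_function F \<longleftrightarrow> proper_on UNIV F \<and> lsc_on UNIV F \<and>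
     (\<forall>xb\<in>dom_limiting_subdiff F. \<exists>\<eta> V \<phi>. KL_witness F xb \<eta> V \<phi>)"

definition KL_function_exponent :: "real \<Rightarrow> ('a::real_inner \<Rightarrow> ereal) \<Rightarrow> bool" where
  "KL_function_exponent \<kappa> F \<longleftrightarrow> KL_function F \<and>
     (\<forall>xb\<in>dom_limiting_subdiff F.
        \<exists>\<eta> V \<theta>. 0 < \<theta> \<and> KL_witness F xb \<eta> V (\<lambda>t. \<theta> * t powr (1 - \<kappa>)))"


section \<open>The problem and the algorithm\<close>

definition objective ::
  "nat \<Rightarrow> ('d::finite \<Rightarrow> nat) \<Rightarrow> (nat \<Rightarrow> real^'d \<Rightarrow> ereal) \<Rightarrow> (real^'q \<Rightarrow> real) \<Rightarrow>
   (real^'d \<Rightarrow> real) \<Rightarrow> (real^'d \<Rightarrow> real) \<Rightarrow> real^'d \<Rightarrow> real^'q \<Rightarrow> ereal" where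
  "objective m blk f H P G x y =
     (\<Sum>i=1..m. f i (block blk i x)) + ereal (H y + P x - G x)"

definition aug_lagrangian ::
  "nat \<Rightarrow> ('d::finite \<Rightarrow> nat) \<Rightarrow> (nat \<Rightarrow> real^'d \<Rightarrow> ereal) \<Rightarrow> (real^'q \<Rightarrow> real) \<Rightarrow>
   (real^'d \<Rightarrow> real) \<Rightarrow> (real^'d \<Rightarrow> real) \<Rightarrow> real^'d^'p \<Rightarrow> real^'q^'p \<Rightarrow> real^'p \<Rightarrow> real \<Rightarrow>
   (real^'d) \<times> (real^'q) \<times> (real^'p) \<Rightarrow> ereal" where
  "aug_lagrangian m blk f H P G A B b \<rho> = (\<lambda>(x, y, z).
     objective m blk f H P G x y +
     ereal (z \<bullet> (A *v x + B *v y - b) + \<rho> / 2 * (norm (A *v x + B *v y - b))\<^sup>2))"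

definition aug_lagrangian_reg ::
  "nat \<Rightarrow> ('d::finite \<Rightarrow> nat) \<Rightarrow> (nat \<Rightarrow> real^'d \<Rightarrow> ereal) \<Rightarrow> (real^'q \<Rightarrow> real) \<Rightarrow>
   (real^'d \<Rightarrow> real) \<Rightarrow> (real^'d \<Rightarrow> real) \<Rightarrow> real^'d^'p \<Rightarrow> real^'q^'p \<Rightarrow> real^'p \<Rightarrow> real \<Rightarrow> real \<Rightarrow>
   (real^'d) \<times> (real^'q) \<times> (real^'p) \<times> (real^'q) \<Rightarrow> ereal" where
  "aug_lagrangian_reg m blk f H P G A B b \<rho> c = (\<lambda>(x, y, z, t).
     aug_lagrangian m blk f H P G A B b \<rho> (x, y, z) + ereal (c * (norm (y - t))\<^sup>2))"

definition BPL_ADMM ::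
  "nat \<Rightarrow> ('d::finite \<Rightarrow> nat) \<Rightarrow> (nat \<Rightarrow> real^'d \<Rightarrow> ereal) \<Rightarrow> (real^'q \<Rightarrow> real) \<Rightarrow>
   (real^'d \<Rightarrow> real) \<Rightarrow> (real^'d \<Rightarrow> real) \<Rightarrow> real^'d^'p \<Rightarrow> real^'q^'p \<Rightarrow> real^'p \<Rightarrow>
   (nat \<Rightarrow> real^'d \<Rightarrow> real) \<Rightarrow> (real^'q \<Rightarrow> real) \<Rightarrow> real \<Rightarrow> (nat \<Rightarrow> real) \<Rightarrow> (nat \<Rightarrow> real) \<Rightarrow>
   (nat \<Rightarrow> real^'d) \<Rightarrow> (nat \<Rightarrow> real^'d) \<Rightarrow> (nat \<Rightarrow> real^'q) \<Rightarrow> (nat \<Rightarrow> real^'p) \<Rightarrow> bool" where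
  "BPL_ADMM m blk f H P G A B b \<phi> \<psi> \<rho> \<mu>s \<nu>s g x y z \<longleftrightarrow>
     (\<forall>n.
        g n \<in> limiting_subdiff (\<lambda>u. ereal (G u)) (x n) \<and>
        (\<forall>i\<in>{1..m}.
           is_arg_min
             (\<lambda>v. f i v + ereal
                (block blk i (grad P (x n) - g n) \<bullet> v + z n \<bullet> (block_columns blk i A *v v) +
                 \<rho> / 2 * (norm (A *v gs_point blk i (x (Suc n)) v (x n) + B *v y n - b))\<^sup>2 +
                 \<mu>s n * bregman (block_space blk i) (\<phi> i) v (block blk i (x n))))
             (\<lambda>v. v \<in> block_space blk i)
             (block blk i (x (Suc n)))) \<and>
        is_arg_min
          (\<lambda>w. H w + z n \<bullet> (B *v w) +
               \<rho> / 2 * (norm (A *v x (Suc n) + B *v w - b))\<^sup>2 + \<nu>s n * bregman UNIV \<psi> w (y n))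
          (\<lambda>w. True)
          (y (Suc n)) \<and>
        z (Suc n) = z n + \<rho> *\<^sub>R (A *v x (Suc n) + B *v y (Suc n) - b))"

end

theory Submission
  imports Defs
begin

text \<open>
  Along the iterates the energy
  \<open>\<F> (x (n+1), y (n+1), z (n+1), y n) = \<L> (x (n+1), y (n+1), z (n+1)) + c * (norm (y (n+1) - y n))\<^sup>2\<close>
  decreases by a multiple of the squared primal step: the proximal terms control the \<open>x\<close>-step,
  strong convexity of the penalty (\<open>B\<close> is injective) controls the \<open>y\<close>-step, and the multiplier
  increment, which raises the Lagrangian, is absorbed because \<open>z n\<close> stays in the range of \<open>B\<close> and
  \<open>transpose B *v z n\<close> is determined by gradients of \<open>H\<close> and \<open>\<psi>\<close>. Coercivity makes the
  iterates bounded. The optimality conditions of the subproblems yield subgradients of \<open>\<F>\<close> bounded by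
  the last two steps. The Kurdyka--Lojasiewicz inequality at a cluster point then gives
  \<open>d (k+2) \<le> (d (k+1) + d k) / 4 + (p k - p (k+1))\<close> for the step lengths, hence finite
  length; with exponent \<open>\<kappa>\<close> the energy gap satisfies
  \<open>C * E (k+2) powr (2 * \<kappa>) \<le> E k - E (k+2)\<close>, from which all rates follow.
\<close>

section \<open>Gradients relative to a subspace\<close>

text \<open>The starting point is arbitrary: \<open>f\<close> may be infinite at \<open>x 0\<close>,
  and the identity for \<open>transpose B *v z n\<close> holds only after an update. So
  \<open>en n\<close> belongs to iterate \<open>Suc n\<close>, and multiplier increments, which
  involve two consecutive \<open>y\<close>-steps, are bounded one index later. The constant
  \<open>c\<close> is the coefficient with which a weighted Cauchy-Schwarz inequality charges the
  squared multiplier increment to the preceding \<open>y\<close>-step, so the extra term of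
  \<open>\<F>\<close> telescopes. The current \<open>y\<close>-step then pays
  \<open>K\<^sup>2 / (lam * \<rho>)\<close>, and the bound on \<open>\<rho>\<close> says that the
  penalty's gain exceeds this cost. Since the \<open>f i\<close> are merely lower semicontinuous,
  function values need not be continuous at cluster points. Instead, each \<open>x\<close>-update
  gives a quadratic minorant of the separable part with modulus independent of \<open>n\<close>. At
  a cluster point it supplies the missing upper bound for the limit of the values; added to the
  smooth part it yields regular subgradients without a sum rule. Smoothness of \<open>G\<close>
  turns \<open>g n\<close> into a gradient, which makes these subgradients small.\<close>

lemma has_real_derivative_along_line:
  fixes f :: "'a::real_inner \<Rightarrow> real"
  assumes S: "subspace S" "x \<in> S" "d \<in> S"
    and f: "(f has_derivative (\<lambda>h. v \<bullet> h)) (at (x + t *\<^sub>R d) within S)"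
  shows "((\<lambda>t. f (x + t *\<^sub>R d)) has_real_derivative (v \<bullet> d)) (at t)"
proof -
  have 1: "((\<lambda>t. x + t *\<^sub>R d) has_derivative (\<lambda>s. s *\<^sub>R d)) (at t)"
    by (auto intro!: derivative_eq_intros)
  have "range (\<lambda>t. x + t *\<^sub>R d) \<subseteq> S"
    using S by (auto intro: subspace_add subspace_scale)
  then have "(f has_derivative (\<lambda>h. v \<bullet> h)) (at (x + t *\<^sub>R d) within range (\<lambda>t. x + t *\<^sub>R d))"
    using f has_derivative_subset by blast
  from has_derivative_in_compose[OF 1 this]
  show ?thesis
    by (simp add: has_field_derivative_def mult_commute_abs)
qed

text \<open>Increments between points of a subspace stay in it, so a derivative relative to
  \<open>S\<close> sees the linear map on \<open>S\<close> only.\<close>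

lemma has_derivative_within_cong_on:
  fixes f :: "'a::real_normed_vector \<Rightarrow> 'b::real_normed_vector"
  assumes "subspace S" "x \<in> S" "(f has_derivative f') (at x within S)"
    and "bounded_linear g" "\<And>h. h \<in> S \<Longrightarrow> g h = f' h"
  shows "(f has_derivative g) (at x within S)"
proof -
  have "((\<lambda>y. (f y - f x - f' (y - x)) /\<^sub>R norm (y - x)) \<longlongrightarrow> 0) (at x within S)"
    using assms(3) by (simp add: has_derivative_at_within)
  moreover have "\<forall>\<^sub>F y in at x within S. (f y - f x - f' (y - x)) /\<^sub>R norm (y - x)
      = (f y - f x - g (y - x)) /\<^sub>R norm (y - x)"
    unfolding eventually_at_filter
    by (rule always_eventually) (use assms in \<open>auto simp: subspace_diff\<close>)
  ultimately have "((\<lambda>y. (f y - f x - g (y - x)) /\<^sub>R norm (y - x)) \<longlongrightarrow> 0) (at x within S)"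
    by (rule Lim_transform_eventually)
  then show ?thesis
    using assms(4) by (simp add: has_derivative_at_within)
qed

text \<open>The Riesz vector of any derivative is projected orthogonally onto \<open>S\<close>.
  Differentiating along the difference of two candidates shows uniqueness, which makes the
  description in \<open>grad_within\<close> legitimate.\<close>

lemma grad_within_works:
  fixes f :: "'a::euclidean_space \<Rightarrow> real"
  assumes S: "subspace S" "x \<in> S" and f: "f differentiable (at x within S)"
  shows grad_within_in: "grad_within S f x \<in> S"
    and grad_within_derivative: "(f has_derivative (\<lambda>h. grad_within S f x \<bullet> h)) (at x within S)"
proof -
  obtain f' where f': "(f has_derivative f') (at x within S)"
    using f by (auto simp: differentiable_def)
  then have lin: "linear f'" by (rule has_derivative_linear)
  define w where "w = (\<Sum>b\<in>Basis. f' b *\<^sub>R b)"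
  have w: "w \<bullet> h = f' h" for h
  proof -
    have "f' h = f' (\<Sum>b\<in>Basis. (h \<bullet> b) *\<^sub>R b)" by (simp add: euclidean_representation)
    also have "\<dots> = (\<Sum>b\<in>Basis. (h \<bullet> b) * f' b)"
      using lin by (simp add: linear_sum linear_scale)
    also have "\<dots> = w \<bullet> h"
      by (simp add: w_def inner_sum_left inner_commute[of h] mult.commute)
    finally show ?thesis by simp
  qed
  obtain v u where v: "v \<in> span S" and u: "\<And>h. h \<in> span S \<Longrightarrow> orthogonal u h" and "w = v + u"
    using orthogonal_subspace_decomp_exists[of S w] by metis
  have span: "span S = S" using S span_eq_iff by blast
  have 1: "v \<in> S" using v span by simp
  have "v \<bullet> h = f' h" if "h \<in> S" for h
    using u[of h] that w[of h] \<open>w = v + u\<close> span by (simp add: orthogonal_def inner_add_left)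
  then have 2: "(f has_derivative (\<lambda>h. v \<bullet> h)) (at x within S)"
    by (intro has_derivative_within_cong_on[OF S f']) (auto simp: bounded_linear_inner_right)
  have "v' = v" if v': "v' \<in> S \<and> (f has_derivative (\<lambda>h. v' \<bullet> h)) (at x within S)" for v'
  proof -
    define d where "d = v' - v"
    have d: "d \<in> S" using v' 1 S by (simp add: d_def subspace_diff)
    have "((\<lambda>t. f (x + t *\<^sub>R d)) has_real_derivative (v \<bullet> d)) (at 0)"
      using has_real_derivative_along_line[OF S d, of f v 0] 2 by simp
    moreover have "((\<lambda>t. f (x + t *\<^sub>R d)) has_real_derivative (v' \<bullet> d)) (at 0)"
      using has_real_derivative_along_line[OF S d, of f v' 0] v' by simp
    ultimately have "v \<bullet> d = v' \<bullet> d" by (rule DERIV_unique)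
    then have "d \<bullet> d = 0" by (simp add: d_def inner_diff_left)
    then show ?thesis by (simp add: d_def)
  qed
  then have "\<exists>!v. v \<in> S \<and> (f has_derivative (\<lambda>h. v \<bullet> h)) (at x within S)"
    using 1 2 by blast
  from theI'[OF this]
  show "grad_within S f x \<in> S" "(f has_derivative (\<lambda>h. grad_within S f x \<bullet> h)) (at x within S)"
    unfolding grad_within_def by auto
qed

lemma grad_UNIV:
  fixes h :: "'a::euclidean_space \<Rightarrow> real"
  assumes "h differentiable_on UNIV"
  shows "(h has_derivative (\<lambda>k. grad h u \<bullet> k)) (at u)"
  using grad_within_derivative[OF subspace_UNIV, of u h] assms by (simp add: differentiable_on_def)

text \<open>The descent lemma on a subspace: along the segment, \<open>f\<close> minus the claimed
  quadratic model is nonincreasing, by Cauchy-Schwarz and the Lipschitz bound.\<close>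

lemma lipschitz_gradient_upper_bound:
  fixes f :: "'a::real_inner \<Rightarrow> real"
  assumes S: "subspace S" "x \<in> S" "y \<in> S"
    and f: "\<And>u. u \<in> S \<Longrightarrow> (f has_derivative (\<lambda>h. g u \<bullet> h)) (at u within S)"
    and L: "L-lipschitz_on S g"
  shows "f y \<le> f x + g x \<bullet> (y - x) + L / 2 * (norm (y - x))\<^sup>2"
proof -
  define d where "d = y - x"
  have d: "d \<in> S" using S by (simp add: d_def subspace_diff)
  have line: "x + t *\<^sub>R d \<in> S" for t using S d by (simp add: subspace_add subspace_scale)
  define k where "k t = f (x + t *\<^sub>R d) - t * (g x \<bullet> d) - L / 2 * t\<^sup>2 * (norm d)\<^sup>2" for t
  have k: "(k has_real_derivative (g (x + t *\<^sub>R d) \<bullet> d - g x \<bullet> d - L * t * (norm d)\<^sup>2)) (at t)" for t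
    unfolding k_def
    by (rule derivative_eq_intros refl has_real_derivative_along_line[OF S(1,2) d f[OF line]])+ simp
  have neg: "g (x + t *\<^sub>R d) \<bullet> d - g x \<bullet> d - L * t * (norm d)\<^sup>2 \<le> 0" if "0 \<le> t" for t
  proof -
    have "(g (x + t *\<^sub>R d) - g x) \<bullet> d \<le> norm (g (x + t *\<^sub>R d) - g x) * norm d"
      by (rule norm_cauchy_schwarz)
    also have "\<dots> \<le> (L * norm (t *\<^sub>R d)) * norm d"
      using lipschitz_on_normD[OF L line[of t] S(2)] by (intro mult_right_mono) auto
    also have "\<dots> = L * t * (norm d)\<^sup>2" using that by (simp add: power2_eq_square)
    finally show ?thesis by (simp add: inner_diff_left)
  qed
  have "k 1 \<le> k 0"
    by (rule DERIV_nonpos_imp_nonincreasing) (use k neg in \<open>auto intro!: exI\<close>)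
  then show ?thesis by (simp add: k_def d_def)
qed

lemma lipschitz_gradient_lower_bound:
  fixes f :: "'a::real_inner \<Rightarrow> real"
  assumes S: "subspace S" "x \<in> S" "y \<in> S"
    and f: "\<And>u. u \<in> S \<Longrightarrow> (f has_derivative (\<lambda>h. g u \<bullet> h)) (at u within S)"
    and L: "L-lipschitz_on S g"
  shows "f x + g x \<bullet> (y - x) - L / 2 * (norm (y - x))\<^sup>2 \<le> f y"
proof -
  have "((\<lambda>u. - f u) has_derivative (\<lambda>h. (- g u) \<bullet> h)) (at u within S)" if "u \<in> S" for u
    using has_derivative_minus[OF f[OF that]] by simp
  from lipschitz_gradient_upper_bound[OF S this, where L = L] L
  show ?thesis by simp
qed

text \<open>The tangent inequality for the convex sum, restricted to a line; the quadratics
  recombine into the square of \<open>norm (y - x)\<close>. It serves strong convexity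
  (\<open>a = - \<alpha> / 2\<close>), weak convexity (\<open>a = \<beta> / 2\<close>) and plain
  convexity (\<open>a = 0\<close>).\<close>

lemma convex_quadratic_perturbation_above_tangent:
  fixes f :: "'a::real_inner \<Rightarrow> real"
  assumes S: "subspace S" "x \<in> S" "y \<in> S"
    and conv: "convex_on S (\<lambda>u. f u + a * (norm u)\<^sup>2)"
    and f: "(f has_derivative (\<lambda>h. v \<bullet> h)) (at x within S)"
  shows "f x + v \<bullet> (y - x) - a * (norm (y - x))\<^sup>2 \<le> f y"
proof -
  define d where "d = y - x"
  have d: "d \<in> S" using S by (simp add: d_def subspace_diff)
  have line: "x + t *\<^sub>R d \<in> S" for t using S d by (simp add: subspace_add subspace_scale)
  define k where "k t = f (x + t *\<^sub>R d) + a * (norm (x + t *\<^sub>R d))\<^sup>2" for t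
  have k: "k t = f (x + t *\<^sub>R d) + a * (x \<bullet> x + 2 * t * (x \<bullet> d) + t\<^sup>2 * (d \<bullet> d))" for t
    unfolding k_def by (simp only: power2_norm_eq_inner) (simp add: inner_add_left inner_add_right inner_commute algebra_simps power2_eq_square)
  have "(k has_real_derivative (v \<bullet> d + a * (2 * (x \<bullet> d)))) (at 0)"
    unfolding k
    by (rule DERIV_add[OF has_real_derivative_along_line[OF S(1,2) d]])
      (use f in \<open>auto intro!: derivative_eq_intros\<close>)
  moreover have "convex_on UNIV k"
  proof (rule convex_onI)
    fix t s r :: real assume t: "0 < t" "t < 1"
    have "x + ((1 - t) *\<^sub>R s + t *\<^sub>R r) *\<^sub>R d = (1 - t) *\<^sub>R (x + s *\<^sub>R d) + t *\<^sub>R (x + r *\<^sub>R d)"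
      by (simp add: algebra_simps)
    then show "k ((1 - t) *\<^sub>R s + t *\<^sub>R r) \<le> (1 - t) * k s + t * k r"
      using convex_onD[OF conv, of t "x + s *\<^sub>R d" "x + r *\<^sub>R d"] t line unfolding k_def by simp
  qed simp
  ultimately have "k 1 - k 0 \<ge> (v \<bullet> d + a * (2 * (x \<bullet> d))) * (1 - 0)"
    by (intro convex_on_imp_above_tangent[of UNIV]) auto
  then show ?thesis
    by (simp add: k d_def power2_norm_eq_inner algebra_simps)
qed

lemma gradient_eq_0_at_minimum:
  fixes f :: "'a::real_inner \<Rightarrow> real"
  assumes f: "(f has_derivative (\<lambda>h. v \<bullet> h)) (at x)" and min: "\<And>y. f x \<le> f y"
  shows "v = 0"
proof -
  have "((\<lambda>t. f (x + t *\<^sub>R v)) has_real_derivative (v \<bullet> v)) (at 0)"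
    by (rule has_real_derivative_along_line[of UNIV]) (use f in auto)
  then have "v \<bullet> v = 0"
    by (rule DERIV_local_min[of _ _ _ 1]) (use min in auto)
  then show ?thesis by simp
qed

section \<open>Subdifferentials\<close>

lemma regular_subdiff_subset_limiting: "regular_subdiff f x \<subseteq> limiting_subdiff f x"
proof
  fix v assume v: "v \<in> regular_subdiff f x"
  then have "\<bar>f x\<bar> \<noteq> \<infinity>" by (simp add: regular_subdiff_def)
  then show "v \<in> limiting_subdiff f x"
    unfolding limiting_subdiff_def using v
    by (intro CollectI conjI exI[where x = "\<lambda>_. x"] exI[where x = "\<lambda>_. v"]) auto
qed

text \<open>The difference quotient of \<open>f\<close> dominates that of a touching minorant, which
  tends to 0. Every subgradient of the Lagrangian and of \<open>\<F>\<close> below is produced this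
  way.\<close>

lemma regular_subdiffI_smooth_minorant:
  fixes f :: "'a::real_inner \<Rightarrow> ereal"
  assumes s: "(s has_derivative (\<lambda>h. v \<bullet> h)) (at x)"
    and le: "\<And>y. ereal (s y) \<le> f y" and eq: "f x = ereal (s x)"
  shows "v \<in> regular_subdiff f x"
proof -
  define q where "q y = (s y - s x - v \<bullet> (y - x)) / norm (y - x)" for y
  have q: "(q \<longlongrightarrow> 0) (at x)"
    using s unfolding has_derivative_at_within q_def by (simp add: divide_inverse mult.commute)
  show ?thesis
  proof (cases "at x = (bot :: 'a filter)")
    \<comment> \<open>In a trivial space \<open>at x\<close> is \<open>bot\<close>, and the
      \<open>Liminf\<close> is then the top element.\<close>
    case True
    then show ?thesis by (simp add: regular_subdiff_def eq Liminf_bot)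
  next
    case False
    have "0 = Liminf (at x) (\<lambda>y. ereal (q y))"
      using lim_imp_Liminf[OF False, of "\<lambda>y. ereal (q y)" 0] q by (simp add: zero_ereal_def)
    also have "\<dots> \<le> Liminf (at x) (\<lambda>y. (f y - f x - ereal (v \<bullet> (y - x))) / ereal (norm (y - x)))"
    proof (rule Liminf_mono)
      show "\<forall>\<^sub>F y in at x. ereal (q y) \<le> (f y - f x - ereal (v \<bullet> (y - x))) / ereal (norm (y - x))"
        unfolding eventually_at_filter
      proof (rule always_eventually, intro allI impI)
        fix y assume "y \<noteq> x"
        then have n: "0 < norm (y - x)" by simp
        show "ereal (q y) \<le> (f y - f x - ereal (v \<bullet> (y - x))) / ereal (norm (y - x))"
          using le[of y] n by (cases "f y") (auto simp: q_def eq divide_right_mono)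
      qed
    qed
    finally show ?thesis by (simp add: regular_subdiff_def eq)
  qed
qed

text \<open>Moving from \<open>x\<close> in the direction \<open>d = v - w\<close> makes the
  quotient for \<open>v\<close> smaller than that for \<open>w\<close> by exactly
  \<open>norm d\<close>, which the nonnegative lower limit forbids.\<close>

lemma regular_subdiff_differentiable:
  fixes f :: "'a::real_inner \<Rightarrow> real"
  assumes f: "(f has_derivative (\<lambda>h. w \<bullet> h)) (at x)"
    and v: "v \<in> regular_subdiff (\<lambda>u. ereal (f u)) x"
  shows "v = w"
proof (rule ccontr)
  assume "v \<noteq> w"
  define d where "d = v - w"
  have d: "0 < norm d" using \<open>v \<noteq> w\<close> by (simp add: d_def)
  define q where "q y = (f y - f x - v \<bullet> (y - x)) / norm (y - x)" for y
  have lim: "((\<lambda>y. (f y - f x - w \<bullet> (y - x)) / norm (y - x)) \<longlongrightarrow> 0) (at x)"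
    using f unfolding has_derivative_at_within by (simp add: divide_inverse mult.commute)
  have "\<forall>\<^sub>F y in at x. (f y - f x - w \<bullet> (y - x)) / norm (y - x) < norm d / 2"
    using order_tendstoD(2)[OF lim, of "norm d / 2"] d by simp
  moreover have "\<forall>\<^sub>F y in at x. - (norm d / 2) < q y"
  proof -
    have "0 \<le> Liminf (at x) (\<lambda>y. (ereal (f y) - ereal (f x) - ereal (v \<bullet> (y - x))) / ereal (norm (y - x)))"
      using v by (simp add: regular_subdiff_def)
    then have "ereal (- (norm d / 2)) < Liminf (at x)
        (\<lambda>y. (ereal (f y) - ereal (f x) - ereal (v \<bullet> (y - x))) / ereal (norm (y - x)))"
      by (rule less_le_trans[rotated]) (use d in simp)
    then have "\<forall>\<^sub>F y in at x. ereal (- (norm d / 2)) <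
        (ereal (f y) - ereal (f x) - ereal (v \<bullet> (y - x))) / ereal (norm (y - x))"
      by (rule less_LiminfD)
    then show ?thesis
      unfolding eventually_at_filter
      by (rule eventually_mono) (auto simp: q_def split: if_splits)
  qed
  ultimately have "\<forall>\<^sub>F y in at x. (f y - f x - w \<bullet> (y - x)) / norm (y - x) < norm d / 2 \<and> - (norm d / 2) < q y"
    by (rule eventually_conj)
  then obtain e where e: "e > 0" and
    E: "\<And>y. y \<noteq> x \<Longrightarrow> dist y x < e \<Longrightarrow>
      (f y - f x - w \<bullet> (y - x)) / norm (y - x) < norm d / 2 \<and> - (norm d / 2) < q y"
    unfolding eventually_at by auto
  define t where "t = e / (2 * norm d)"
  have t: "0 < t" using e d by (simp add: t_def)
  define y where "y = x + t *\<^sub>R d"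
  have "y \<noteq> x" "dist y x < e" using t d e by (auto simp: y_def dist_norm t_def)
  from E[OF this] have E': "(f y - f x - w \<bullet> (y - x)) / norm (y - x) < norm d / 2" "- (norm d / 2) < q y"
    by auto
  have "q y = (f y - f x - w \<bullet> (y - x)) / norm (y - x) - d \<bullet> (y - x) / norm (y - x)"
    by (simp add: q_def d_def inner_diff_left diff_divide_distrib[symmetric])
  also have "d \<bullet> (y - x) / norm (y - x) = norm d"
    using t d by (simp add: y_def dot_square_norm power2_eq_square)
  finally show False using E' by simp
qed

text \<open>Used to force the algorithm's choice \<open>g n\<close> to be the gradient of
  \<open>G\<close> at \<open>x n\<close>.\<close>

lemma limiting_subdiff_C1:
  fixes f :: "'a::real_inner \<Rightarrow> real"
  assumes f: "\<And>u. (f has_derivative (\<lambda>h. g u \<bullet> h)) (at u)"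
    and g: "continuous_on UNIV g"
    and v: "v \<in> limiting_subdiff (\<lambda>u. ereal (f u)) x"
  shows "v = g x"
proof -
  obtain X W where X: "X \<longlonglongrightarrow> x" and W: "W \<longlonglongrightarrow> v"
    and XW: "\<And>n. W n \<in> regular_subdiff (\<lambda>u. ereal (f u)) (X n)"
    using v unfolding limiting_subdiff_def by auto
  have "W = (\<lambda>n. g (X n))"
    using regular_subdiff_differentiable[OF f XW] by auto
  moreover have "(\<lambda>n. g (X n)) \<longlonglongrightarrow> g x"
    using g X by (auto simp: continuous_on_eq_continuous_at isCont_tendsto_compose)
  ultimately show ?thesis using W LIMSEQ_unique by blast
qed

section \<open>Lower semicontinuity\<close>

lemma lsc_on_sequentially:
  assumes lsc: "lsc_on S f" and X: "X \<longlonglongrightarrow> x" "\<And>n. X n \<in> S" "x \<in> S"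
  shows "f x \<le> liminf (\<lambda>n. f (X n))"
proof (rule le_Liminf_iff[THEN iffD2], intro allI impI)
  fix a assume a: "a < f x"
  have "a < Liminf (at x within S) f"
    using a lsc X(3) by (auto simp: lsc_on_def intro: less_le_trans)
  then have "\<forall>\<^sub>F y in at x within S. a < f y" by (rule less_LiminfD)
  \<comment> \<open>The filter \<open>at x within S\<close> omits \<open>x\<close> itself; there the
    bound is the assumption \<open>a < f x\<close>, so terms with \<open>X n = x\<close> are
    covered.\<close>
  then have "\<forall>\<^sub>F y in nhds x. y \<in> S \<longrightarrow> a < f y"
    using a unfolding eventually_at_filter by (auto elim: eventually_mono)
  then have "\<forall>\<^sub>F n in sequentially. X n \<in> S \<longrightarrow> a < f (X n)"
    using X(1) unfolding filterlim_iff by blast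
  then show "\<forall>\<^sub>F n in sequentially. a < f (X n)" using X(2) by simp
qed

lemma sum_ereal_not_MInfty:
  fixes a :: "'i \<Rightarrow> ereal"
  assumes "\<And>i. i \<in> I \<Longrightarrow> a i \<noteq> -\<infinity>"
  shows "(\<Sum>i\<in>I. a i) \<noteq> -\<infinity>"
  using assms by (induction I rule: infinite_finite_induct) auto

lemma liminf_sum_ge:
  fixes a :: "'i \<Rightarrow> nat \<Rightarrow> ereal"
  assumes "finite I" "\<And>i. i \<in> I \<Longrightarrow> l i \<le> liminf (a i)" "\<And>i. i \<in> I \<Longrightarrow> l i \<noteq> -\<infinity>"
  shows "(\<Sum>i\<in>I. l i) \<le> liminf (\<lambda>n. \<Sum>i\<in>I. a i n)"
  using assms
proof (induction I rule: finite_induct)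
  case empty
  then show ?case by (simp add: Liminf_const)
next
  case (insert j I)
  have IH: "(\<Sum>i\<in>I. l i) \<le> liminf (\<lambda>n. \<Sum>i\<in>I. a i n)" using insert by auto
  have fin: "(\<Sum>i\<in>I. l i) \<noteq> -\<infinity>" by (rule sum_ereal_not_MInfty) (use insert in auto)
  have "(\<Sum>i\<in>insert j I. l i) = l j + (\<Sum>i\<in>I. l i)" using insert by simp
  also have "\<dots> \<le> liminf (a j) + liminf (\<lambda>n. \<Sum>i\<in>I. a i n)"
    using IH insert by (intro add_mono) auto
  also have "\<dots> \<le> liminf (\<lambda>n. a j n + (\<Sum>i\<in>I. a i n))"
    using IH fin insert.prems(1)[of j] insert.prems(2)[of j]
    by (intro ereal_liminf_add_mono) auto
  also have "\<dots> = liminf (\<lambda>n. \<Sum>i\<in>insert j I. a i n)" using insert by simp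
  finally show ?case .
qed

section \<open>Scalar recursions\<close>

text \<open>In the summed recursion every step is charged 1/4 twice, so half of the sum survives on
  the left. The boundary terms at \<open>M\<close> are kept because they make the induction
  exact.\<close>

lemma halving_partial_sum_bound:
  fixes d p :: "nat \<Rightarrow> real"
  assumes "N \<le> M" and "\<And>k. N \<le> k \<Longrightarrow> k < M \<Longrightarrow> d (k + 2) \<le> (d (k + 1) + d k) / 4 + (p k - p (Suc k))"
  shows "(\<Sum>k=N..<M. d (k + 2)) / 2 + d (M + 1) / 2 + d M / 4
    \<le> d (N + 1) / 2 + d N / 4 + p N - p M"
  using assms
proof (induction M rule: dec_induct)
  case base
  then show ?case by simp
next
  case (step M)
  have "d (M + 2) \<le> (d (M + 1) + d M) / 4 + (p M - p (Suc M))"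
    using step by simp
  moreover have "(\<Sum>k=N..<M. d (k + 2)) / 2 + d (M + 1) / 2 + d M / 4
      \<le> d (N + 1) / 2 + d N / 4 + p N - p M"
    using step by simp
  ultimately show ?case using step(1) by (simp add: add_divide_distrib)
qed

lemma two_step_geometric_decay:
  fixes E :: "nat \<Rightarrow> real"
  assumes dec: "decseq E" and nonneg: "\<And>k. 0 \<le> E k" and \<zeta>: "0 < \<zeta>" "\<zeta> < 1"
    and rec: "\<And>k. N \<le> k \<Longrightarrow> E (k + 2) \<le> \<zeta>\<^sup>2 * E k"
  shows "\<exists>M>0. \<forall>k. E k \<le> M * \<zeta> ^ k"
proof (intro exI conjI allI)
  \<comment> \<open>Chosen so that \<open>M * \<zeta> ^ (N + 2) = E 0 + 1\<close>, which covers all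
    indices before the recursion applies; the 1 keeps \<open>M\<close> positive when
    \<open>E 0 = 0\<close>.\<close>
  define M where "M = (E 0 + 1) / \<zeta> ^ (N + 2)"
  show "0 < M" using nonneg[of 0] \<zeta> by (simp add: M_def)
  fix k
  show "E k \<le> M * \<zeta> ^ k"
  proof (induction k rule: less_induct)
    case (less k)
    show ?case
    proof (cases "k < N + 2")
      case True
      have "\<zeta> ^ (N + 2) \<le> \<zeta> ^ k" using True \<zeta> by (intro power_decreasing) auto
      then have "M * \<zeta> ^ (N + 2) \<le> M * \<zeta> ^ k" using \<open>0 < M\<close> by simp
      moreover have "M * \<zeta> ^ (N + 2) = E 0 + 1" using \<zeta> by (simp add: M_def)
      moreover have "E k \<le> E 0" using dec by (simp add: decseq_def)
      ultimately show ?thesis by linarith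
    next
      case False
      then obtain j where j: "k = j + 2" "N \<le> j" using that[of "k - 2"] by simp
      have "E k \<le> \<zeta>\<^sup>2 * E j" using rec j by simp
      also have "\<dots> \<le> \<zeta>\<^sup>2 * (M * \<zeta> ^ j)" using less[of j] j \<zeta> by (intro mult_left_mono) auto
      also have "\<dots> = M * \<zeta> ^ k" by (simp add: j power2_eq_square)
      finally show ?thesis .
    qed
  qed
qed

lemma powr_difference_bound:
  fixes a r :: real
  assumes "0 < a" "0 < r"
  shows "a powr (- r) - (a + 2) powr (- r) \<le> 2 * r * a powr (- r - 1)"
proof -
  have "\<exists>\<xi>. a < \<xi> \<and> \<xi> < a + 2 \<and>
      (a + 2) powr (- r) - a powr (- r) = ((a + 2) - a) * (- r * \<xi> powr (- r - 1))"
    by (rule MVT2) (use assms in \<open>auto intro!: derivative_eq_intros\<close>)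
  then obtain \<xi> where \<xi>: "a < \<xi>"
    and eq: "(a + 2) powr (- r) - a powr (- r) = ((a + 2) - a) * (- r * \<xi> powr (- r - 1))"
    by blast
  have "\<xi> powr (- r - 1) \<le> a powr (- r - 1)"
    using \<xi> assms by (intro powr_mono2') auto
  then have "2 * r * \<xi> powr (- r - 1) \<le> 2 * r * a powr (- r - 1)" using assms by simp
  then show ?thesis using eq by simp
qed

text \<open>
  If \<open>E k\<close> exceeded \<open>M * k powr - (1/p)\<close> while \<open>E (k - 2)\<close> does not, the recursion would force
  \<open>(k - 2) powr - (1/p) - k powr - (1/p)\<close> to be larger than the mean value theorem allows.
\<close>

lemma two_step_power_decay:
  fixes E :: "nat \<Rightarrow> real"
  assumes dec: "decseq E" and nonneg: "\<And>k. 0 \<le> E k" and p: "0 < p" and c: "0 < c"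
    and rec: "\<And>k. N \<le> k \<Longrightarrow> 0 < E (k + 2) \<Longrightarrow> c * E (k + 2) powr (1 + p) \<le> E k - E (k + 2)"
  shows "\<exists>M>0. \<forall>k\<ge>1. E k \<le> M * real k powr (- (1 / p))"
proof -
  define r where "r = 1 / p"
  have r: "0 < r" using p by (simp add: r_def)
  \<comment> \<open>The first entry covers \<open>k < N + 3\<close>; the second gives
    \<open>Mp\<close>, which closes the contradiction. The 3 comes from
    \<open>k = j + 2 \<le> 3 * j\<close> for \<open>j \<ge> 1\<close>.\<close>
  define M where "M = max ((E 0 + 1) * real (N + 3) powr r) ((2 * r * 3 powr (r + 1) / c) powr r)"
  have M: "0 < M" using nonneg[of 0] by (auto simp: M_def less_max_iff_disj)
  have Mp: "2 * r * 3 powr (r + 1) \<le> c * M powr p"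
  proof -
    have "2 * r * 3 powr (r + 1) / c = ((2 * r * 3 powr (r + 1) / c) powr r) powr p"
      using r c p by (simp add: powr_powr r_def)
    also have "\<dots> \<le> M powr p" using p by (intro powr_mono2) (auto simp: M_def)
    finally show ?thesis using c by (simp add: field_simps)
  qed
  have "E k \<le> M * real k powr (- r)" if "1 \<le> k" for k
    using that
  proof (induction k rule: less_induct)
    case (less k)
    show ?case
    proof (cases "k < N + 3")
      case True
      have "E k \<le> E 0 + 1" using dec unfolding decseq_def by (smt (verit) le0)
      also have "\<dots> = (E 0 + 1) * real (N + 3) powr r * real (N + 3) powr (- r)"
        by (simp add: powr_minus)
      also have "\<dots> \<le> M * real (N + 3) powr (- r)"
        by (intro mult_right_mono) (auto simp: M_def)
      also have "\<dots> \<le> M * real k powr (- r)"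
        using True less.prems r M by (intro mult_left_mono powr_mono2') auto
      finally show ?thesis .
    next
      case False
      then obtain j where j: "k = j + 2" "N \<le> j" "1 \<le> j" using that[of "k - 2"] by simp
      show ?thesis
      proof (rule ccontr)
        assume "\<not> ?thesis"
        then have big: "M * real k powr (- r) < E k" by simp
        moreover have "0 < M * real k powr (- r)" using M less.prems by simp
        ultimately have "0 < E k" by linarith
        have j0: "0 < real j" "0 < real k" using j by auto
        have "c * M powr p * (M * real k powr (- r - 1)) = c * (M * real k powr (- r)) powr (1 + p)"
        proof -
          have "(real k powr (- r)) powr (1 + p) = real k powr (- r - 1)"
            using p by (simp add: powr_powr r_def distrib_left)
          moreover have "M powr (1 + p) = M * M powr p" using M by (simp add: powr_add)
          ultimately show ?thesis using M by (simp add: powr_mult)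
        qed
        also have "\<dots> < c * E k powr (1 + p)"
          using big M c p \<open>0 < M * real k powr (- r)\<close> by (intro mult_strict_left_mono powr_less_mono2) auto
        also have "\<dots> \<le> E j - E k" using rec[of j] j \<open>0 < E k\<close> by simp
        also have "\<dots> \<le> M * real j powr (- r) - M * real k powr (- r)"
          using less.IH[of j] j big by simp
        also have "\<dots> = M * (real j powr (- r) - (real j + 2) powr (- r))"
          by (simp add: j algebra_simps)
        also have "\<dots> \<le> M * (2 * r * real j powr (- r - 1))"
          using powr_difference_bound[OF j0(1) r] M by simp
        also have "\<dots> \<le> M * (2 * r * (3 powr (r + 1) * real k powr (- r - 1)))"
        proof -
          have "real j powr (- r - 1) \<le> (real k / 3) powr (- r - 1)"
            using j r by (intro powr_mono2') auto
          also have "\<dots> = real k powr (- r - 1) / 3 powr (- r - 1)"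
            using j by (simp add: powr_divide)
          also have "\<dots> = 3 powr (r + 1) * real k powr (- r - 1)"
            using powr_minus_divide[of "3::real" "r + 1"] by (simp add: minus_diff_commute)
          finally show ?thesis using M r by simp
        qed
        also have "\<dots> = (2 * r * 3 powr (r + 1)) * (M * real k powr (- r - 1))" by simp
        also have "\<dots> \<le> c * M powr p * (M * real k powr (- r - 1))"
          using Mp M by (intro mult_right_mono) auto
        finally show False by simp
      qed
    qed
  qed
  then show ?thesis using M unfolding r_def by blast
qed

text \<open>Positivity of \<open>t\<close> lets a finite maximum absorb the initial indices. The
  threshold \<open>n0\<close> is there because power rates vanish at 0:
  \<open>0 powr a = 0\<close>.\<close>

lemma bound_from_eventual_bound:
  fixes a t :: "nat \<Rightarrow> real"
  assumes "\<And>n. N \<le> n \<Longrightarrow> a n \<le> C * t n" "\<And>n. n0 \<le> n \<Longrightarrow> 0 < t n"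
  shows "\<exists>\<gamma>>0. \<forall>n\<ge>n0. a n \<le> \<gamma> * t n"
proof -
  define \<gamma> where "\<gamma> = Max (insert 1 (insert C ((\<lambda>n. a n / t n) ` {..<N})))"
  have \<gamma>: "1 \<le> \<gamma>" "C \<le> \<gamma>" unfolding \<gamma>_def by (rule Max_ge; simp)+
  have "a n \<le> \<gamma> * t n" if n: "n0 \<le> n" for n
  proof (cases "n < N")
    case True
    then have "a n / t n \<le> \<gamma>" unfolding \<gamma>_def by (intro Max_ge) auto
    then show ?thesis using assms(2)[OF n] by (simp add: field_simps)
  next
    case False
    then have "a n \<le> C * t n" using assms(1) by simp
    also have "\<dots> \<le> \<gamma> * t n" using \<gamma>(2) assms(2)[OF n] by (intro mult_right_mono) auto
    finally show ?thesis .
  qed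
  then show ?thesis using \<gamma>(1) by (intro exI[of _ \<gamma>]) auto
qed

lemma common_bound_from_eventual_bounds:
  fixes a1 a2 a3 a4 t1 t3 :: "nat \<Rightarrow> real"
  assumes "\<And>n. N \<le> n \<Longrightarrow> a1 n \<le> C * t1 n" "\<And>n. N \<le> n \<Longrightarrow> a2 n \<le> C * t1 n"
    "\<And>n. N \<le> n \<Longrightarrow> a3 n \<le> C * t3 n" "\<And>n. N \<le> n \<Longrightarrow> a4 n \<le> C * t1 n"
    and t: "\<And>n. n0 \<le> n \<Longrightarrow> 0 < t1 n" "\<And>n. n0 \<le> n \<Longrightarrow> 0 < t3 n"
  shows "\<exists>\<gamma>>0. \<forall>n\<ge>n0. a1 n \<le> \<gamma> * t1 n \<and> a2 n \<le> \<gamma> * t1 n \<and> a3 n \<le> \<gamma> * t3 n \<and> a4 n \<le> \<gamma> * t1 n"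
proof -
  obtain g1 where g1: "0 < g1" "\<And>n. n0 \<le> n \<Longrightarrow> a1 n \<le> g1 * t1 n"
    using bound_from_eventual_bound[of N a1 C t1 n0, OF assms(1) t(1)] by blast
  obtain g2 where g2: "0 < g2" "\<And>n. n0 \<le> n \<Longrightarrow> a2 n \<le> g2 * t1 n"
    using bound_from_eventual_bound[of N a2 C t1 n0, OF assms(2) t(1)] by blast
  obtain g3 where g3: "0 < g3" "\<And>n. n0 \<le> n \<Longrightarrow> a3 n \<le> g3 * t3 n"
    using bound_from_eventual_bound[of N a3 C t3 n0, OF assms(3) t(2)] by blast
  obtain g4 where g4: "0 < g4" "\<And>n. n0 \<le> n \<Longrightarrow> a4 n \<le> g4 * t1 n"
    using bound_from_eventual_bound[of N a4 C t1 n0, OF assms(4) t(1)] by blast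
  define \<gamma> where "\<gamma> = g1 + g2 + g3 + g4"
  have "g1 * t1 n \<le> \<gamma> * t1 n" "g2 * t1 n \<le> \<gamma> * t1 n" "g3 * t3 n \<le> \<gamma> * t3 n" "g4 * t1 n \<le> \<gamma> * t1 n"
    if "n0 \<le> n" for n
    using t[OF that] g1(1) g2(1) g3(1) g4(1) by (auto simp: \<gamma>_def)
  then have "a1 n \<le> \<gamma> * t1 n \<and> a2 n \<le> \<gamma> * t1 n \<and> a3 n \<le> \<gamma> * t3 n \<and> a4 n \<le> \<gamma> * t1 n" if "n0 \<le> n" for n
    using g1(2) g2(2) g3(2) g4(2) that by (meson order_trans)
  moreover have "0 < \<gamma>" using g1(1) g2(1) g3(1) g4(1) by (simp add: \<gamma>_def)
  ultimately show ?thesis by blast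
qed

section \<open>Descent sequences under the Kurdyka--Lojasiewicz property\<close>

lemma desingularizing_tangent:
  assumes "desingularizing \<eta> \<phi>" "0 < t" "ereal t < \<eta>" "0 \<le> s" "s \<le> t"
  shows "deriv \<phi> t * (t - s) \<le> \<phi> t - \<phi> s"
proof -
  \<comment> \<open>A real \<open>t'\<close> beyond \<open>t\<close> keeps \<open>t\<close> in the
    interior of \<open>{0..t'}\<close>, as the tangent inequality requires; \<open>\<eta>\<close>
    itself may be infinite.\<close>
  obtain t' where t': "t < t'" "ereal t' < \<eta>"
    using ereal_dense2[OF assms(3)] by auto
  define A where "A = {0..t'}"
  have sub: "A \<subseteq> {t. 0 \<le> t \<and> ereal t < \<eta>}"
    using t' le_less_trans[of "ereal _" "ereal t'" \<eta>] by (auto simp: A_def)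
  have "concave_on {t. 0 \<le> t \<and> ereal t < \<eta>} \<phi>"
    using assms(1) by (simp add: desingularizing_def)
  then have "convex_on A (\<lambda>x. - \<phi> x)"
    unfolding concave_on_def by (rule convex_on_subset) (use sub in \<open>auto simp: A_def\<close>)
  moreover have "(\<phi> has_real_derivative deriv \<phi> t) (at t)"
    using assms by (simp add: desingularizing_def DERIV_deriv_iff_real_differentiable)
  then have "((\<lambda>x. - \<phi> x) has_real_derivative - deriv \<phi> t) (at t within A)"
    by (rule has_field_derivative_at_within[OF DERIV_minus])
  ultimately have "- \<phi> s - - \<phi> t \<ge> - deriv \<phi> t * (s - t)"
    by (intro convex_on_imp_above_tangent[of A]) (use assms t' in \<open>auto simp: A_def\<close>)
  then show ?thesis by (simp add: algebra_simps)
qed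

text \<open>Sufficient decrease, relative error and convergence of values, detached from the
  algorithm. Passing from \<open>U k\<close> to \<open>U (Suc k)\<close> costs the step
  \<open>d (k + 2)\<close>, while the slope at \<open>U k\<close> is controlled by the two steps
  before it. No convergence of \<open>U\<close> is presupposed, only that of \<open>e\<close> to the
  value at \<open>us\<close>.\<close>

locale KL_descent_sequence =
  fixes F :: "'a::real_inner \<Rightarrow> ereal" and U :: "nat \<Rightarrow> 'a" and e d :: "nat \<Rightarrow> real"
    and \<delta> C :: real and us :: 'a and es :: real
  assumes \<delta>: "0 < \<delta>" and C: "0 < C" and d: "\<And>k. 0 \<le> d k"
    and F_U: "\<And>k. F (U k) = ereal (e k)"
    and descent: "\<And>k. e (Suc k) + \<delta> * (d (k + 2))\<^sup>2 \<le> e k"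
    and slope: "\<And>k. \<exists>w\<in>limiting_subdiff F (U k). norm w \<le> C * (d (k + 1) + d k)"
    and step: "\<And>k. norm (U (Suc k) - U k) \<le> C * (d (k + 2) + d (k + 1))"
    and F_us: "F us = ereal es" and e_lim: "e \<longlonglongrightarrow> es"
begin

definition E :: "nat \<Rightarrow> real" where "E k = e k - es"

lemma decseq_e: "decseq e"
proof (rule decseq_SucI)
  fix k show "e (Suc k) \<le> e k" using descent[of k] \<delta> by (smt (verit) zero_le_mult_iff zero_le_power2)
qed

lemma E_nonneg: "0 \<le> E k"
  using decseq_ge[OF decseq_e e_lim, of k] by (simp add: E_def)

lemma decseq_E: "decseq E"
  using decseq_e by (simp add: decseq_def E_def)

lemma E_lim: "E \<longlonglongrightarrow> 0"
  unfolding E_def using tendsto_diff[OF e_lim tendsto_const[of es]] by simp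

lemma descent_E: "\<delta> * (d (k + 2))\<^sup>2 \<le> E k - E (Suc k)"
  using descent[of k] by (simp add: E_def)

lemma d_le_sqrt: "d (k + 2) \<le> sqrt (E k / \<delta>)"
proof (rule real_le_rsqrt)
  show "(d (k + 2))\<^sup>2 \<le> E k / \<delta>"
    using descent_E[of k] E_nonneg[of "Suc k"] \<delta> by (simp add: field_simps)
qed

lemma d_lim: "d \<longlonglongrightarrow> 0"
proof -
  have "(\<lambda>k. sqrt (E k / \<delta>)) \<longlonglongrightarrow> sqrt (0 / \<delta>)"
    using \<delta> by (intro tendsto_intros E_lim) auto
  then have "(\<lambda>k. sqrt (E k / \<delta>)) \<longlonglongrightarrow> 0" by simp
  then have "(\<lambda>k. d (k + 2)) \<longlonglongrightarrow> 0"
    using tendsto_sandwich[of "\<lambda>_. 0" "\<lambda>k. d (k + 2)" sequentially "\<lambda>k. sqrt (E k / \<delta>)" 0]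
      d d_le_sqrt by (simp add: always_eventually)
  then show ?thesis by (rule LIMSEQ_offset)
qed

lemma slope_KL:
  assumes KL: "KL_witness F us \<eta> V \<phi>" and k: "U k \<in> V" "ereal (E k) < \<eta>" "0 < E k"
  shows "1 \<le> deriv \<phi> (E k) * (C * (d (k + 1) + d k))"
proof -
  have "F us < F (U k)" "F (U k) < F us + \<eta>"
    using k by (cases \<eta>; auto simp: F_us F_U E_def)+
  then have "1 \<le> ereal (deriv \<phi> (real_of_ereal (F (U k) - F us))) * dist0_subdiff F (U k)"
    using KL k unfolding KL_witness_def by blast
  then have 1: "1 \<le> ereal (deriv \<phi> (E k)) * dist0_subdiff F (U k)"
    by (simp add: F_us F_U E_def)
  obtain w where w: "w \<in> limiting_subdiff F (U k)" "norm w \<le> C * (d (k + 1) + d k)"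
    using slope by blast
  have "dist0_subdiff F (U k) \<le> ereal (norm w)"
    unfolding dist0_subdiff_def using w by (intro INF_lower)
  also have "\<dots> \<le> ereal (C * (d (k + 1) + d k))" using w by simp
  finally have "dist0_subdiff F (U k) \<le> ereal (C * (d (k + 1) + d k))" .
  moreover have "0 < deriv \<phi> (E k)" using KL k by (auto simp: KL_witness_def desingularizing_def)
  ultimately have "ereal (deriv \<phi> (E k)) * dist0_subdiff F (U k)
      \<le> ereal (deriv \<phi> (E k)) * ereal (C * (d (k + 1) + d k))"
    by (intro ereal_mult_left_mono) auto
  with 1 have "1 \<le> ereal (deriv \<phi> (E k)) * ereal (C * (d (k + 1) + d k))" by (rule order_trans)
  then show ?thesis by (simp add: one_ereal_def)
qed

text \<open>Concavity of \<open>\<phi>\<close> converts the decrease of \<open>E\<close> into a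
  decrease of \<open>\<phi> (E k)\<close>, up to the factor \<open>deriv \<phi> (E k)\<close>, which
  the KL inequality bounds below by the reciprocal of the slope. The product is
  \<open>(d (k + 2))\<^sup>2 \<le> a * q\<close>, and AM-GM finishes.\<close>

lemma d_recursion:
  assumes KL: "KL_witness F us \<eta> V \<phi>" and k: "U k \<in> V" "ereal (E k) < \<eta>"
  shows "d (k + 2) \<le> (d (k + 1) + d k) / 4 + (C / \<delta> * \<phi> (E k) - C / \<delta> * \<phi> (E (Suc k)))"
proof (cases "0 < E k")
  case False
  \<comment> \<open>A zero gap stays zero, so the squared step vanishes; the KL inequality says
    nothing at this level.\<close>
  then have "E k = 0" using E_nonneg[of k] by simp
  moreover have "E (Suc k) = 0"
    using E_nonneg[of "Suc k"] decseq_E \<open>E k = 0\<close> unfolding decseq_def by (metis le_SucI order_antisym order_refl)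
  ultimately have "d (k + 2) = 0"
    using descent_E[of k] \<delta> d by (simp add: mult_le_0_iff)
  then show ?thesis using \<open>E k = 0\<close> \<open>E (Suc k) = 0\<close> d[of k] d[of "k + 1"] by simp
next
  case True
  define a where "a = d (k + 1) + d k"
  define q where "q = C / \<delta> * (\<phi> (E k) - \<phi> (E (Suc k)))"
  have des: "desingularizing \<eta> \<phi>" using KL by (simp add: KL_witness_def)
  have pos: "0 < deriv \<phi> (E k)" using des True k by (simp add: desingularizing_def)
  have S: "1 \<le> deriv \<phi> (E k) * (C * a)" using slope_KL[OF KL k True] by (simp add: a_def)
  have a: "0 \<le> a" using d by (simp add: a_def)
  have "deriv \<phi> (E k) * (\<delta> * (d (k + 2))\<^sup>2) \<le> deriv \<phi> (E k) * (E k - E (Suc k))"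
    using descent_E pos by (intro mult_left_mono) auto
  also have "\<dots> \<le> \<phi> (E k) - \<phi> (E (Suc k))"
    using desingularizing_tangent[OF des True k(2) E_nonneg] decseq_E by (simp add: decseq_def)
  finally have T: "deriv \<phi> (E k) * (\<delta> * (d (k + 2))\<^sup>2) \<le> \<phi> (E k) - \<phi> (E (Suc k))" .
  have "1 * (\<delta> * (d (k + 2))\<^sup>2) \<le> (deriv \<phi> (E k) * (C * a)) * (\<delta> * (d (k + 2))\<^sup>2)"
    using S \<delta> by (intro mult_right_mono) auto
  also have "\<dots> = (C * a) * (deriv \<phi> (E k) * (\<delta> * (d (k + 2))\<^sup>2))" by simp
  also have "\<dots> \<le> (C * a) * (\<phi> (E k) - \<phi> (E (Suc k)))"
    using T C a by (intro mult_left_mono) auto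
  also have "\<dots> = \<delta> * (a * q)" using \<delta> by (simp add: q_def)
  finally have "(d (k + 2))\<^sup>2 \<le> a * q" using \<delta> by simp
  \<comment> \<open>The weight 1/4 is what allows the two earlier steps to be absorbed when the
    recursion is summed.\<close>
  also have "\<dots> \<le> (a / 4 + q)\<^sup>2"
    using zero_le_power2[of "a / 4 - q"] by (simp add: power2_eq_square algebra_simps)
  finally have sq: "(d (k + 2))\<^sup>2 \<le> (a / 4 + q)\<^sup>2" .
  have "0 \<le> q"
  proof -
    have "0 \<le> \<phi> (E k) - \<phi> (E (Suc k))"
      using T pos \<delta> by (smt (verit) mult_nonneg_nonneg zero_le_power2)
    then show ?thesis using C \<delta> by (simp add: q_def)
  qed
  with sq a have "d (k + 2) \<le> a / 4 + q" by (auto intro: power2_le_imp_le)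
  then show ?thesis by (simp add: a_def q_def algebra_simps)
qed

text \<open>The recursion is demanded only for \<open>k < M\<close>, so the bound is available
  before \<open>U M\<close> is known to lie in the KL neighbourhood.\<close>

lemma displacement_bound:
  assumes le: "N \<le> M" and p: "0 \<le> p M"
    and rec: "\<And>k. N \<le> k \<Longrightarrow> k < M \<Longrightarrow> d (k + 2) \<le> (d (k + 1) + d k) / 4 + (p k - p (Suc k))"
  shows "norm (U M - U N) \<le> C * (3 * d (N + 1) + d N + 4 * p N)"
proof -
  define S where "S = (\<Sum>k=N..<M. d (k + 2))"
  have "S / 2 + d (M + 1) / 2 + d M / 4 \<le> d (N + 1) / 2 + d N / 4 + p N - p M"
    unfolding S_def by (rule halving_partial_sum_bound[OF le rec])
  then have S: "2 * S \<le> 2 * d (N + 1) + d N + 4 * p N"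
    using d[of M] d[of "M + 1"] p by simp
  have S': "(\<Sum>k=N..<M. d (k + 1)) \<le> d (N + 1) + S"
  proof -
    have "(\<Sum>k=N..<M. d (k + 1)) + d (M + 1) = d (N + 1) + S"
      using le unfolding S_def by (induction M rule: dec_induct) auto
    then show ?thesis using d[of "M + 1"] by simp
  qed
  have "norm (U M - U N) = norm (\<Sum>k=N..<M. U (Suc k) - U k)"
    using le by (simp add: sum_Suc_diff')
  also have "\<dots> \<le> (\<Sum>k=N..<M. C * (d (k + 2) + d (k + 1)))"
    by (rule sum_norm_le) (rule step)
  also have "\<dots> = C * (S + (\<Sum>k=N..<M. d (k + 1)))"
    by (simp add: S_def sum_distrib_left[symmetric] sum.distrib)
  also have "\<dots> \<le> C * (3 * d (N + 1) + d N + 4 * p N)"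
    using S S' C by (intro mult_left_mono) auto
  finally show ?thesis .
qed

lemma E_less:
  assumes "0 < \<eta>" shows "\<forall>\<^sub>F k in sequentially. ereal (E k) < \<eta>"
proof -
  have "(\<lambda>k. ereal (E k)) \<longlonglongrightarrow> ereal 0" using E_lim by simp
  then show ?thesis using assms by (intro order_tendstoD) (auto simp: zero_ereal_def)
qed

lemma desingularizing_E_lim:
  assumes "0 < \<eta>" "desingularizing \<eta> \<phi>" shows "(\<lambda>k. \<phi> (E k)) \<longlonglongrightarrow> 0"
proof -
  have "(\<lambda>k. \<phi> (E k)) \<longlonglongrightarrow> \<phi> 0"
  proof (rule continuous_on_tendsto_compose[OF _ E_lim])
    show "continuous_on {t. 0 \<le> t \<and> ereal t < \<eta>} \<phi>" using assms by (simp add: desingularizing_def)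
    show "0 \<in> {t. 0 \<le> t \<and> ereal t < \<eta>}" using assms by (simp add: zero_ereal_def)
    show "\<forall>\<^sub>F k in sequentially. E k \<in> {t. 0 \<le> t \<and> ereal t < \<eta>}"
      using E_less[OF assms(1)] by (auto simp: E_nonneg elim: eventually_mono)
  qed
  then show ?thesis using assms by (simp add: desingularizing_def)
qed

text \<open>A trapping argument: the subsequence supplies an index \<open>N\<close> with
  \<open>U N\<close> near \<open>us\<close> and \<open>g N\<close> small. By strong induction all
  earlier points from \<open>N\<close> on lie in the ball, hence in \<open>V\<close>, so the
  recursion holds up to \<open>k\<close> and \<open>displacement_bound\<close> keeps
  \<open>U k\<close> in the ball. As the radius is arbitrary, this is convergence itself.\<close>

lemma convergent_of_cluster:
  assumes KL: "KL_witness F us \<eta> V \<phi>" and r: "strict_mono r" "(U \<circ> r) \<longlonglongrightarrow> us"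
  shows "U \<longlonglongrightarrow> us"
proof -
  have \<eta>: "0 < \<eta>" and des: "desingularizing \<eta> \<phi>" using KL by (auto simp: KL_witness_def)
  obtain R0 where R0: "0 < R0" "ball us R0 \<subseteq> V"
    using KL by (auto simp: KL_witness_def mem_interior)
  define p where "p k = C / \<delta> * \<phi> (E k)" for k
  have p_lim: "p \<longlonglongrightarrow> 0"
    unfolding p_def by (rule tendsto_mult_right_zero[OF desingularizing_E_lim[OF \<eta> des]])
  have "\<exists>N. \<forall>k\<ge>N. dist (U k) us < R" if R: "0 < R" "R \<le> R0" for R
  proof -
    define g where "g k = C * (3 * d (k + 1) + d k + 4 * p k)" for k
    have "g \<longlonglongrightarrow> C * (3 * 0 + 0 + 4 * 0)"
      unfolding g_def using LIMSEQ_ignore_initial_segment[OF d_lim, of 1]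
      by (intro tendsto_intros d_lim p_lim) auto
    then have "g \<longlonglongrightarrow> 0" by simp
    then have "(\<lambda>j. g (r j)) \<longlonglongrightarrow> 0" using LIMSEQ_subseq_LIMSEQ[OF _ r(1)] by (auto simp: o_def)
    then have "\<forall>\<^sub>F j in sequentially. g (r j) < R / 2" using R by (intro order_tendstoD) auto
    moreover have "\<forall>\<^sub>F j in sequentially. ereal (E (r j)) < \<eta>"
      using eventually_subseq[OF r(1) E_less[OF \<eta>]] .
    moreover have "\<forall>\<^sub>F j in sequentially. dist (U (r j)) us < R / 2"
      using tendstoD[OF r(2), of "R / 2"] R by (simp add: o_def)
    ultimately have ev: "\<forall>\<^sub>F j in sequentially.
        g (r j) < R / 2 \<and> ereal (E (r j)) < \<eta> \<and> dist (U (r j)) us < R / 2"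
      by eventually_elim simp
    have "\<exists>j. g (r j) < R / 2 \<and> ereal (E (r j)) < \<eta> \<and> dist (U (r j)) us < R / 2"
      by (rule eventually_happens'[OF sequentially_bot ev])
    then obtain N where N: "g N < R / 2" "ereal (E N) < \<eta>" "dist (U N) us < R / 2" by blast
    have EN: "ereal (E k) < \<eta>" if "N \<le> k" for k
      using decseq_E that N(2) unfolding decseq_def by (meson ereal_less_eq(3) le_less_trans)
    have "dist (U k) us < R" if "N \<le> k" for k
      using that
    proof (induction k rule: less_induct)
      case (less k)
      have "norm (U k - U N) \<le> C * (3 * d (N + 1) + d N + 4 * p N)"
      proof (rule displacement_bound[OF less.prems])
        show "0 \<le> p k" using des C \<delta> EN[OF less.prems] E_nonneg by (simp add: p_def desingularizing_def)
        fix j assume j: "N \<le> j" "j < k"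
        then have "U j \<in> V" using less.IH[of j] R R0 by (auto simp: subset_iff dist_commute)
        then show "d (j + 2) \<le> (d (j + 1) + d j) / 4 + (p j - p (Suc j))"
          unfolding p_def using d_recursion[OF KL _ EN[OF j(1)]] by blast
      qed
      then have "dist (U k) (U N) < R / 2" using N(1) by (simp add: g_def dist_norm)
      then show ?case using N(3) dist_triangle[of "U k" us "U N"] by simp
    qed
    then show ?thesis by blast
  qed
  note stay = this
  show ?thesis
  proof (rule metric_LIMSEQ_I)
    fix R :: real assume "0 < R"
    then show "\<exists>N. \<forall>k\<ge>N. dist (U k) us < R"
      using stay[of "min R R0"] R0 by (fastforce simp: min_less_iff_conj)
  qed
qed

lemma eventually_KL:
  assumes KL: "KL_witness F us \<eta> V \<phi>" and U: "U \<longlonglongrightarrow> us"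
  obtains N where "\<And>k. N \<le> k \<Longrightarrow> U k \<in> V" "\<And>k. N \<le> k \<Longrightarrow> ereal (E k) < \<eta>"
proof -
  have "\<forall>\<^sub>F k in sequentially. U k \<in> interior V"
    using U KL by (intro topological_tendstoD) (auto simp: KL_witness_def)
  moreover have "\<forall>\<^sub>F k in sequentially. ereal (E k) < \<eta>"
    using E_less KL by (simp add: KL_witness_def)
  ultimately have "\<forall>\<^sub>F k in sequentially. U k \<in> V \<and> ereal (E k) < \<eta>"
    by eventually_elim (use interior_subset in auto)
  then show thesis using that by (auto simp: eventually_sequentially)
qed

lemma summable_d:
  assumes KL: "KL_witness F us \<eta> V \<phi>" and U: "U \<longlonglongrightarrow> us"
  shows "summable d"
proof -
  have des: "desingularizing \<eta> \<phi>" using KL by (auto simp: KL_witness_def)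
  obtain N where N: "\<And>k. N \<le> k \<Longrightarrow> U k \<in> V" "\<And>k. N \<le> k \<Longrightarrow> ereal (E k) < \<eta>"
    by (rule eventually_KL[OF KL U]) blast
  define p where "p k = C / \<delta> * \<phi> (E k)" for k
  define K where "K = d (N + 1) + d N + 2 * p N"
  have "(\<Sum>k<n. d (k + (N + 2))) \<le> K" for n
  proof -
    have "(\<Sum>k=N..<N+n. d (k + 2)) / 2 + d (N + n + 1) / 2 + d (N + n) / 4
        \<le> d (N + 1) / 2 + d N / 4 + p N - p (N + n)"
      by (rule halving_partial_sum_bound) (use d_recursion[OF KL] N in \<open>auto simp: p_def\<close>)
    moreover have "0 \<le> p (N + n)" using des C \<delta> N E_nonneg by (simp add: p_def desingularizing_def)
    moreover have "(\<Sum>k=N..<N+n. d (k + 2)) = (\<Sum>k<n. d (k + (N + 2)))"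
      using sum.shift_bounds_nat_ivl[of "\<lambda>k. d (k + 2)" 0 N n]
      by (simp add: lessThan_atLeast0 add.commute add.left_commute)
    ultimately show ?thesis using d[of N] d[of "N+n"] d[of "N+n+1"] unfolding K_def by linarith
  qed
  then have "summable (\<lambda>k. d (k + (N + 2)))"
    by (intro summableI_nonneg_bounded[where x = K]) (auto simp: d)
  then show ?thesis by (subst (asm) summable_iff_shift)
qed

section \<open>Decay of the energy gap for a power-type desingularizing function\<close>

context
  fixes \<eta> V \<theta> \<kappa>
  assumes KL: "KL_witness F us \<eta> V (\<lambda>t. \<theta> * t powr (1 - \<kappa>))"
    and \<theta>: "0 < \<theta>" and \<kappa>: "0 \<le> \<kappa>" "\<kappa> < 1" and U_lim: "U \<longlonglongrightarrow> us"
begin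

text \<open>Let \<open>M\<close> tend to infinity in \<open>displacement_bound\<close> started at
  \<open>k + 2\<close>; the offset by two makes both steps occurring there at most
  \<open>sqrt (E k / \<delta>)\<close>.\<close>

lemma distance_rate:
  "\<exists>N K. 0 < K \<and> (\<forall>k\<ge>N. norm (U (k + 2) - us) \<le> K * (sqrt (E k) + E k powr (1 - \<kappa>)))"
proof -
  obtain N where N: "\<And>k. N \<le> k \<Longrightarrow> U k \<in> V" "\<And>k. N \<le> k \<Longrightarrow> ereal (E k) < \<eta>"
    by (rule eventually_KL[OF KL U_lim]) blast
  define p where "p k = C / \<delta> * (\<theta> * E k powr (1 - \<kappa>))" for k
  define K where "K = C * (4 / sqrt \<delta> + 4 * (C / \<delta> * \<theta>))"
  have "0 < K" using C \<delta> \<theta> by (simp add: K_def add_pos_pos)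
  moreover have "norm (U (k + 2) - us) \<le> K * (sqrt (E k) + E k powr (1 - \<kappa>))" if k: "N \<le> k" for k
  proof -
    have "norm (U M - U (k + 2)) \<le> C * (3 * d (k + 2 + 1) + d (k + 2) + 4 * p (k + 2))" if "k + 2 \<le> M" for M
      by (rule displacement_bound[OF that])
        (use d_recursion[OF KL] N k C \<delta> \<theta> in \<open>auto simp: p_def\<close>)
    then have "\<forall>\<^sub>F M in sequentially. norm (U M - U (k + 2)) \<le> C * (3 * d (k + 3) + d (k + 2) + 4 * p (k + 2))"
      by (auto simp: eventually_sequentially numeral_3_eq_3)
    moreover have "(\<lambda>M. norm (U M - U (k + 2))) \<longlonglongrightarrow> norm (us - U (k + 2))"
      by (intro tendsto_intros U_lim)
    ultimately have 1: "norm (us - U (k + 2)) \<le> C * (3 * d (k + 3) + d (k + 2) + 4 * p (k + 2))"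
      by (intro tendsto_upperbound[OF _ _ sequentially_bot])
    have mono: "E (k + j) \<le> E k" for j using decseq_E by (simp add: decseq_def)
    have "d (k + 3) \<le> sqrt (E (k + 1) / \<delta>)" using d_le_sqrt[of "k + 1"] by (simp add: numeral_3_eq_3)
    also have "\<dots> \<le> sqrt (E k / \<delta>)" using mono[of 1] \<delta> by (simp add: divide_right_mono)
    finally have 2: "3 * d (k + 3) + d (k + 2) \<le> 4 / sqrt \<delta> * sqrt (E k)"
      using d_le_sqrt[of k] by (simp add: real_sqrt_divide)
    have 3: "p (k + 2) \<le> (C / \<delta> * \<theta>) * E k powr (1 - \<kappa>)"
    proof -
      have "E (k + 2) powr (1 - \<kappa>) \<le> E k powr (1 - \<kappa>)"
        using mono[of 2] E_nonneg \<kappa> by (intro powr_mono2) auto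
      then have "(C / \<delta> * \<theta>) * E (k + 2) powr (1 - \<kappa>) \<le> (C / \<delta> * \<theta>) * E k powr (1 - \<kappa>)"
        using C \<delta> \<theta> by (intro mult_left_mono) auto
      then show ?thesis by (simp add: p_def mult.assoc)
    qed
    have "3 * d (k + 3) + d (k + 2) + 4 * p (k + 2)
        \<le> 4 / sqrt \<delta> * sqrt (E k) + 4 * (C / \<delta> * \<theta>) * E k powr (1 - \<kappa>)"
      using 2 3 by simp
    also have "\<dots> \<le> (4 / sqrt \<delta> + 4 * (C / \<delta> * \<theta>)) * (sqrt (E k) + E k powr (1 - \<kappa>))"
    proof -
      have "0 \<le> 4 / sqrt \<delta> * E k powr (1 - \<kappa>)" "0 \<le> 4 * (C / \<delta> * \<theta>) * sqrt (E k)"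
        using C \<delta> \<theta> E_nonneg by auto
      then show ?thesis by (simp add: distrib_left distrib_right)
    qed
    finally have "C * (3 * d (k + 3) + d (k + 2) + 4 * p (k + 2))
        \<le> C * ((4 / sqrt \<delta> + 4 * (C / \<delta> * \<theta>)) * (sqrt (E k) + E k powr (1 - \<kappa>)))"
      using C by (intro mult_left_mono) auto
    with 1 show ?thesis by (simp add: K_def norm_minus_commute mult.assoc)
  qed
  ultimately show ?thesis by blast
qed

text \<open>The KL inequality at \<open>U (k + 2)\<close> reads
  \<open>t powr \<kappa> \<le> K * D\<close> with \<open>D\<close> the sum of two consecutive steps.
  Squaring, two applications of the descent inequality bound \<open>D\<^sup>2\<close> by a multiple
  of \<open>E k - E (k + 2)\<close>; hence the recursion skips two indices.\<close>

lemma E_recursion: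
  "\<exists>N c. 0 < c \<and> (\<forall>k\<ge>N. 0 < E (k + 2) \<longrightarrow> c * E (k + 2) powr (2 * \<kappa>) \<le> E k - E (k + 2))"
proof -
  obtain N where N: "\<And>k. N \<le> k \<Longrightarrow> U k \<in> V" "\<And>k. N \<le> k \<Longrightarrow> ereal (E k) < \<eta>"
    by (rule eventually_KL[OF KL U_lim]) blast
  define K where "K = \<theta> * (1 - \<kappa>) * C"
  have K: "0 < K" using \<theta> \<kappa> C by (simp add: K_def)
  define c where "c = \<delta> / (2 * K\<^sup>2)"
  have "0 < c" using \<delta> K by (simp add: c_def)
  moreover have "c * E (k + 2) powr (2 * \<kappa>) \<le> E k - E (k + 2)" if k: "N \<le> k" "0 < E (k + 2)" for k
  proof -
    define t where "t = E (k + 2)"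
    define D where "D = d (k + 3) + d (k + 2)"
    have t: "0 < t" using k by (simp add: t_def)
    have "((\<lambda>t. \<theta> * t powr (1 - \<kappa>)) has_real_derivative \<theta> * ((1 - \<kappa>) * t powr (- \<kappa>))) (at t)"
      using t by (auto intro!: derivative_eq_intros)
    then have der: "deriv (\<lambda>t. \<theta> * t powr (1 - \<kappa>)) t = \<theta> * ((1 - \<kappa>) * t powr (- \<kappa>))"
      by (rule DERIV_imp_deriv)
    have "1 \<le> deriv (\<lambda>t. \<theta> * t powr (1 - \<kappa>)) t * (C * D)"
      using slope_KL[OF KL, of "k + 2"] N[of "k + 2"] k by (simp add: t_def D_def numeral_3_eq_3)
    then have "1 \<le> t powr (- \<kappa>) * (K * D)" by (simp add: der K_def algebra_simps)
    then have "t powr \<kappa> * 1 \<le> t powr \<kappa> * (t powr (- \<kappa>) * (K * D))" by (intro mult_left_mono) auto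
    also have "\<dots> = K * D" using t by (simp add: powr_minus field_simps)
    finally have "(t powr \<kappa>)\<^sup>2 \<le> (K * D)\<^sup>2" by (intro power_mono) auto
    then have 1: "t powr (2 * \<kappa>) \<le> K\<^sup>2 * D\<^sup>2"
      using t by (simp add: power_mult_distrib powr_power mult.commute)
    have "D\<^sup>2 \<le> 2 * ((d (k + 3))\<^sup>2 + (d (k + 2))\<^sup>2)"
      using zero_le_power2[of "d (k + 3) - d (k + 2)"] by (simp add: D_def power2_eq_square algebra_simps)
    then have "\<delta> * D\<^sup>2 \<le> 2 * (\<delta> * (d (k + 3))\<^sup>2 + \<delta> * (d (k + 2))\<^sup>2)"
      using mult_left_mono[of "D\<^sup>2" "2 * ((d (k + 3))\<^sup>2 + (d (k + 2))\<^sup>2)" \<delta>] \<delta>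
      by (simp add: distrib_left mult.left_commute)
    also have "\<dots> \<le> 2 * (E k - t)"
      using descent_E[of "k + 1"] descent_E[of k] by (simp add: t_def numeral_3_eq_3)
    finally have 2: "\<delta> * D\<^sup>2 \<le> 2 * (E k - t)" .
    have "c * t powr (2 * \<kappa>) \<le> c * (K\<^sup>2 * D\<^sup>2)" using 1 \<open>0 < c\<close> by (intro mult_left_mono) auto
    also have "\<dots> = \<delta> * D\<^sup>2 / 2" using K by (simp add: c_def)
    also have "\<dots> \<le> E k - t" using 2 by simp
    finally show ?thesis by (simp add: t_def)
  qed
  ultimately show ?thesis by blast
qed

text \<open>With \<open>\<kappa> = 0\<close> a positive gap would force a drop of at least
  \<open>c\<close> over two steps, which is impossible once the gap is below
  \<open>c\<close>.\<close>

lemma finite_E: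
  assumes "\<kappa> = 0" shows "\<exists>N. \<forall>k\<ge>N. E k = 0"
proof -
  obtain N c where c: "0 < c" "\<And>k. N \<le> k \<Longrightarrow> 0 < E (k + 2) \<Longrightarrow> c * E (k + 2) powr (2 * \<kappa>) \<le> E k - E (k + 2)"
    using E_recursion by blast
  have "\<forall>\<^sub>F k in sequentially. E k < c" using E_lim c by (intro order_tendstoD) auto
  then obtain N' where N': "\<And>k. N' \<le> k \<Longrightarrow> E k < c" by (auto simp: eventually_sequentially)
  have "E (k + 2) = 0" if "N \<le> k" "N' \<le> k" for k
  proof (rule ccontr)
    assume "E (k + 2) \<noteq> 0"
    then have "0 < E (k + 2)" using E_nonneg[of "k + 2"] by simp
    then have "c \<le> E k - E (k + 2)" using c(2)[OF that(1)] assms by simp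
    then show False using N'[OF that(2)] \<open>0 < E (k + 2)\<close> by simp
  qed
  note * = this
  have "E k = 0" if "max N N' + 2 \<le> k" for k
    using *[of "k - 2"] that by (simp add: Suc_diff_Suc numeral_2_eq_2)
  then show ?thesis by blast
qed

lemma geometric_E:
  assumes "\<kappa> \<le> 1 / 2"
  shows "\<exists>M \<zeta>. 0 < M \<and> 0 < \<zeta> \<and> \<zeta> < 1 \<and> (\<forall>k. E k \<le> M * \<zeta> ^ k)"
proof -
  obtain N c where c: "0 < c" "\<And>k. N \<le> k \<Longrightarrow> 0 < E (k + 2) \<Longrightarrow> c * E (k + 2) powr (2 * \<kappa>) \<le> E k - E (k + 2)"
    using E_recursion by blast
  have "\<forall>\<^sub>F k in sequentially. E k < 1" using E_lim by (intro order_tendstoD) auto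
  then obtain N' where N': "\<And>k. N' \<le> k \<Longrightarrow> E k < 1" by (auto simp: eventually_sequentially)
  \<comment> \<open>For gaps below 1 and \<open>2 * \<kappa> \<le> 1\<close> the power dominates the
    gap, so two steps gain the factor \<open>1 / (1 + c)\<close> and one step its root.\<close>
  define \<zeta> where "\<zeta> = sqrt (1 / (1 + c))"
  have \<zeta>: "0 < \<zeta>" "\<zeta> < 1" "\<zeta>\<^sup>2 = 1 / (1 + c)" using c by (auto simp: \<zeta>_def)
  have "E (k + 2) \<le> \<zeta>\<^sup>2 * E k" if "max N N' \<le> k" for k
  proof (cases "0 < E (k + 2)")
    case True
    have "E (k + 2) = E (k + 2) powr 1" using True by simp
    also have "\<dots> \<le> E (k + 2) powr (2 * \<kappa>)"
      using True N'[of "k + 2"] that assms by (intro powr_mono') auto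
    finally have "c * E (k + 2) \<le> c * E (k + 2) powr (2 * \<kappa>)" using c by simp
    also have "\<dots> \<le> E k - E (k + 2)" using c(2) True that by simp
    finally show ?thesis using c(1) by (simp add: \<zeta>(3) field_simps)
  next
    case False
    then show ?thesis using E_nonneg[of k] \<zeta> by (smt (verit) mult_nonneg_nonneg zero_le_power2)
  qed
  from two_step_geometric_decay[of E \<zeta> "max N N'", OF decseq_E E_nonneg \<zeta>(1,2) this]
  show ?thesis using \<zeta>(1,2) by blast
qed

lemma sublinear_E:
  assumes "1 / 2 < \<kappa>"
  shows "\<exists>M>0. \<forall>k\<ge>1. E k \<le> M * real k powr (- (1 / (2 * \<kappa> - 1)))"
proof -
  obtain N c where c: "0 < c" "\<And>k. N \<le> k \<Longrightarrow> 0 < E (k + 2) \<Longrightarrow> c * E (k + 2) powr (2 * \<kappa>) \<le> E k - E (k + 2)"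
    using E_recursion by blast
  show ?thesis
  proof (rule two_step_power_decay[OF decseq_E E_nonneg _ c(1), where N = N])
    show "0 < 2 * \<kappa> - 1" using assms by simp
    show "c * E (k + 2) powr (1 + (2 * \<kappa> - 1)) \<le> E k - E (k + 2)" if "N \<le> k" "0 < E (k + 2)" for k
      using c(2)[OF that] by simp
  qed
qed

end

end

section \<open>Blocks and matrices\<close>

text \<open>Keeps adjoints in the form \<open>transpose B *v q\<close>, in which the identities
  below are stated.\<close>

declare transpose_matrix_vector [simp del]

lemma inner_matrix_transpose:
  fixes A :: "real^'n^'m"
  shows "v \<bullet> (A *v u) = (transpose A *v v) \<bullet> u"
  by (simp add: dot_lmul_matrix transpose_matrix_vector)

lemma matrix_norm_bound:
  fixes A :: "real^'n^'m"
  obtains K where "0 < K" "\<And>v. norm (A *v v) \<le> K * norm v"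
  using bounded_linear.pos_bounded[OF matrix_vector_mul_bounded_linear[of A]]
  by (metis mult.commute)

lemma power2_norm_add:
  fixes u v :: "'a::real_inner"
  shows "(norm (u + v))\<^sup>2 = (norm u)\<^sup>2 + 2 * (u \<bullet> v) + (norm v)\<^sup>2"
  by (simp add: power2_norm_eq_inner inner_add_left inner_add_right inner_commute)

text \<open>The minimum of the Rayleigh quotient is attained on the unit sphere, and it is the least eigenvalue.\<close>

lemma lambda_min_gram_le:
  fixes B :: "real^'n^'m"
  shows "lambda_min (transpose B ** B) * (norm v)\<^sup>2 \<le> (norm (B *v v))\<^sup>2"
proof -
  let ?q = "\<lambda>v. (norm (B *v v))\<^sup>2"
  have "sphere (0::real^'n) 1 \<noteq> {}" by simp
  moreover have "continuous_on (sphere 0 1) ?q"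
    by (intro continuous_intros linear_continuous_on matrix_vector_mul_bounded_linear)
  ultimately obtain v0 where v0: "norm v0 = 1" and min: "\<And>v. norm v = 1 \<Longrightarrow> ?q v0 \<le> ?q v"
    using continuous_attains_inf[of "sphere (0::real^'n) 1" ?q] by auto
  define l where "l = ?q v0"
  have l: "l * (norm v)\<^sup>2 \<le> ?q v" for v
  proof (cases "v = 0")
    case False
    have "l \<le> ?q ((1 / norm v) *\<^sub>R v)" using min[of "(1 / norm v) *\<^sub>R v"] False by (simp add: l_def)
    also have "\<dots> = ?q v / (norm v)\<^sup>2"
      by (simp add: matrix_vector_mult_scaleR power_divide)
    finally show ?thesis using False by (simp add: field_simps)
  qed simp
  \<comment> \<open>Half the gradient at \<open>v0\<close> of the difference between the squared
    norm of \<open>B *v v\<close> and \<open>l\<close> times that of \<open>v\<close>; this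
    difference is minimal at \<open>v0\<close>, so \<open>w = 0\<close> is the eigenvalue
    equation.\<close>
  define w where "w = transpose B *v (B *v v0) - l *\<^sub>R v0"
  have q: "?q v - l * (norm v)\<^sup>2 = (B *v v) \<bullet> (B *v v) - l * (v \<bullet> v)" for v
    by (simp add: power2_norm_eq_inner)
  have "((\<lambda>v. (B *v v) \<bullet> (B *v v) - l * (v \<bullet> v)) has_derivative (\<lambda>h. (2 *\<^sub>R w) \<bullet> h)) (at v0)"
  proof -
    have B: "((\<lambda>v. B *v v) has_derivative (\<lambda>h. B *v h)) (at v0)"
      by (rule bounded_linear_imp_has_derivative[OF matrix_vector_mul_bounded_linear])
    have "((\<lambda>v. (B *v v) \<bullet> (B *v v) - l * (v \<bullet> v)) has_derivative
        (\<lambda>h. ((B *v v0) \<bullet> (B *v h) + (B *v h) \<bullet> (B *v v0)) - l * (v0 \<bullet> h + h \<bullet> v0))) (at v0)"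
      by (intro has_derivative_diff has_derivative_inner has_derivative_mult_right B has_derivative_ident)
    moreover have "((B *v v0) \<bullet> (B *v h) + (B *v h) \<bullet> (B *v v0)) - l * (v0 \<bullet> h + h \<bullet> v0) = (2 *\<^sub>R w) \<bullet> h" for h
      by (simp add: w_def inner_diff_left inner_matrix_transpose[symmetric] inner_commute[of h]
          inner_commute[of "B *v h"])
    ultimately show ?thesis by simp
  qed
  then have "2 *\<^sub>R w = 0"
    by (rule gradient_eq_0_at_minimum) (use l q v0 in \<open>simp add: l_def power2_norm_eq_inner[symmetric]\<close>)
  then have ev: "real_eigenvalue (transpose B ** B) l"
    unfolding real_eigenvalue_def using v0
    by (intro exI[of _ v0]) (auto simp: w_def matrix_vector_mul_assoc[symmetric])
  have "l \<le> l'" if "real_eigenvalue (transpose B ** B) l'" for l'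
  proof -
    obtain u where u: "u \<noteq> 0" "transpose B *v (B *v u) = l' *\<^sub>R u"
      using \<open>real_eigenvalue _ l'\<close> by (auto simp: real_eigenvalue_def matrix_vector_mul_assoc)
    have "?q u = l' * (norm u)\<^sup>2"
      using u(2) by (simp add: power2_norm_eq_inner inner_matrix_transpose)
    then show ?thesis using l[of u] u(1) by simp
  qed
  then have "lambda_min (transpose B ** B) = l"
    unfolding lambda_min_def using ev by (intro Least_equality) auto
  then show ?thesis using l by simp
qed

lemma subspace_block_space: "subspace (block_space blk i)"
  by (auto simp: subspace_def block_space_def)

lemma block_in_block_space: "block blk i v \<in> block_space blk i"
  by (simp add: block_def block_space_def)

lemma block_of_block_space: "v \<in> block_space blk i \<Longrightarrow> block blk i v = v"
  by (auto simp: block_def block_space_def vec_eq_iff)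

lemma bounded_linear_block: "bounded_linear (block blk i)"
  unfolding linear_conv_bounded_linear[symmetric]
  by (rule linearI) (auto simp: block_def vec_eq_iff)

lemma block_diff: "block blk i (u - v) = block blk i u - block blk i v"
  by (auto simp: block_def vec_eq_iff)

lemma block_inner: "block blk i u \<bullet> v = u \<bullet> block blk i v"
  by (auto simp: block_def inner_vec_def intro: sum.cong)

lemma inner_block_space: "v \<in> block_space blk i \<Longrightarrow> v \<bullet> block blk i u = v \<bullet> u"
  by (metis block_inner block_of_block_space)

lemma norm_block_le: "norm (block blk i v) \<le> norm v"
  by (rule norm_le_componentwise_cart) (simp add: block_def)

lemma block_columns_mult: "block_columns blk i A *v v = A *v block blk i v"
  by (auto simp: block_columns_def block_def matrix_vector_mult_def vec_eq_iff intro!: sum.cong)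

lemma gs_point_block: "gs_point blk i x' (block blk i v) x = gs_point blk i x' v x"
  by (auto simp: gs_point_def block_def vec_eq_iff)

lemma gs_point_diff: "gs_point blk i x' v x = gs_point blk i x' u x + block blk i (v - u)"
  by (auto simp: gs_point_def block_def vec_eq_iff)

lemma gs_point_Suc: "gs_point blk (Suc i) x' x x = gs_point blk i x' x' x"
  by (auto simp: gs_point_def vec_eq_iff less_Suc_eq)

lemma norm_gs_point_diff_le: "norm (x' - gs_point blk i x' x' x) \<le> norm (x' - x)"
  by (rule norm_le_componentwise_cart) (simp add: gs_point_def)

context
  fixes blk :: "'d::finite \<Rightarrow> nat" and m :: nat
  assumes blocks: "blk ` UNIV = {1..m}"
begin

lemma blk_bounds: "1 \<le> blk j" "blk j \<le> m"
  using blocks by (metis atLeastAtMost_iff rangeI)+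

lemma sum_block: "(\<Sum>i=1..m. block blk i v) = v"
proof -
  have "(\<Sum>i=1..m. if blk j = i then v $ j else 0) = v $ j" for j
    using blk_bounds[of j] by (simp add: sum.delta')
  then show ?thesis by (simp add: vec_eq_iff block_def)
qed

lemma sum_norm_block: "(\<Sum>i=1..m. (norm (block blk i v))\<^sup>2) = (norm v)\<^sup>2"
proof -
  have "(\<Sum>i=1..m. (norm (block blk i v))\<^sup>2) = (\<Sum>i=1..m. block blk i v \<bullet> v)"
    by (simp add: power2_norm_eq_inner inner_block_space block_in_block_space)
  also have "\<dots> = v \<bullet> v" by (simp only: inner_sum_left[symmetric] sum_block)
  finally show ?thesis by (simp add: power2_norm_eq_inner)
qed

lemma gs_point_first: "gs_point blk 1 x' x x = x"
proof -
  have "gs_point blk 1 x' x x $ j = x $ j" for j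
    using blk_bounds(1)[of j] by (simp add: gs_point_def)
  then show ?thesis by (simp add: vec_eq_iff)
qed

lemma gs_point_last: "gs_point blk (Suc m) x' x x = x'"
  using blk_bounds by (simp add: gs_point_def vec_eq_iff less_Suc_eq_le)

text \<open>The point with block \<open>i\<close> just updated is the starting point for block
  \<open>i + 1\<close>, so the increments run from \<open>x\<close> to \<open>x'\<close> without
  remainder.\<close>

lemma sum_gs_point_telescope:
  fixes q :: "real^'d \<Rightarrow> real"
  shows "(\<Sum>i=1..m. q (gs_point blk i x' x' x) - q (gs_point blk i x' x x)) = q x' - q x"
proof -
  have "(\<Sum>i=1..m. q (gs_point blk i x' x' x) - q (gs_point blk i x' x x))
      = (\<Sum>i=1..m. q (gs_point blk (Suc i) x' x x) - q (gs_point blk i x' x x))"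
    by (simp add: gs_point_Suc)
  also have "\<dots> = q (gs_point blk (Suc m) x' x x) - q (gs_point blk 1 x' x x)"
    by (rule sum_Suc_diff) simp
  finally show ?thesis by (simp only: gs_point_first gs_point_last)
qed

lemma block_sum_block_space:
  assumes "\<And>i. i \<in> {1..m} \<Longrightarrow> w i \<in> block_space blk i" "i \<in> {1..m}"
  shows "block blk i (\<Sum>k=1..m. w k) = w i"
proof -
  have "block blk i (\<Sum>k=1..m. w k) = (\<Sum>k=1..m. block blk i (w k))"
    by (rule linear_sum[OF bounded_linear.linear[OF bounded_linear_block]])
  also have "\<dots> = (\<Sum>k=1..m. if k = i then w i else 0)"
  proof (rule sum.cong[OF refl])
    fix k assume "k \<in> {1..m}"
    then show "block blk i (w k) = (if k = i then w i else 0)"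
      using assms(1)[of k] by (auto simp: block_def block_space_def vec_eq_iff)
  qed
  also have "\<dots> = w i" using assms(2) by simp
  finally show ?thesis .
qed

end

section \<open>One step of the algorithm\<close>

locale bpl_admm =
  fixes m :: nat and blk :: "'d::finite \<Rightarrow> nat"
    and f :: "nat \<Rightarrow> real^'d \<Rightarrow> ereal"
    and H :: "real^'q \<Rightarrow> real" and P G :: "real^'d \<Rightarrow> real"
    and A :: "real^'d^'p" and B :: "real^'q^'p" and b :: "real^'p"
    and \<phi> :: "nat \<Rightarrow> real^'d \<Rightarrow> real" and \<psi> :: "real^'q \<Rightarrow> real"
    and x g :: "nat \<Rightarrow> real^'d" and y :: "nat \<Rightarrow> real^'q" and z :: "nat \<Rightarrow> real^'p"
    and lH lP lG l\<phi> l\<psi> \<alpha> \<beta> lam \<mu> \<mu>bar \<nu> \<rho> c :: real and \<mu>s \<nu>s :: "nat \<Rightarrow> real"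
  assumes blocks: "blk ` UNIV = {1..m}"
    and f: "\<And>i. i \<in> {1..m} \<Longrightarrow> proper_on (block_space blk i) (f i) \<and> lsc_on (block_space blk i) (f i)"
    and H: "H differentiable_on UNIV" "lH-lipschitz_on UNIV (grad H)" "bdd_below (range H)"
    and P: "P differentiable_on UNIV" "lP-lipschitz_on UNIV (grad P)"
    and G: "0 \<le> \<beta>" "weakly_convex_on \<beta> UNIV G"
      "G differentiable_on UNIV" "lG-lipschitz_on UNIV (grad G)"
    and image: "range (\<lambda>u. A *v u) \<union> {b} \<subseteq> range (\<lambda>w. B *v w)"
    and lam: "lam = lambda_min (transpose B ** B)" "0 < lam"
    and coercive: "coercive (\<lambda>u. (\<Sum>i=1..m. f i (block blk i u)) + ereal (P u - G u))"
    and \<alpha>: "0 < \<alpha>"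
    and \<phi>: "\<And>i. i \<in> {1..m} \<Longrightarrow> \<phi> i differentiable_on block_space blk i \<and>
        strongly_convex_on \<alpha> (block_space blk i) (\<phi> i) \<and>
        l\<phi>-lipschitz_on (block_space blk i) (grad_within (block_space blk i) (\<phi> i))"
    and \<psi>: "\<psi> differentiable_on UNIV" "convex_on UNIV \<psi>" "l\<psi>-lipschitz_on UNIV (grad \<psi>)"
    and \<mu>: "(lP + \<beta>) / \<alpha> < \<mu>" "\<And>n. \<mu> \<le> \<mu>s n" "limsup (\<lambda>n. ereal (\<mu>s n)) = ereal \<mu>bar"
    and \<nu>: "0 \<le> \<nu>" "\<And>n. 0 \<le> \<nu>s n \<and> \<nu>s n \<le> \<nu>"
    and \<rho>: "(lH + sqrt (lH\<^sup>2 + 8 * (lH + 2 * \<nu> * l\<psi>)\<^sup>2)) / (2 * lam) < \<rho>"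
    and z0: "z 0 \<in> range (\<lambda>w. B *v w)"
    and alg: "BPL_ADMM m blk f H P G A B b \<phi> \<psi> \<rho> \<mu>s \<nu>s g x y z"
    and c: "c = (lH + 2 * \<nu> * l\<psi>) * \<nu> * l\<psi> / (lam * \<rho>)"
begin

lemmas grad_H = grad_UNIV[OF H(1)] and grad_P = grad_UNIV[OF P(1)]
  and grad_G = grad_UNIV[OF G(3)] and grad_\<psi> = grad_UNIV[OF \<psi>(1)]

abbreviation gr\<phi> :: "nat \<Rightarrow> real^'d \<Rightarrow> real^'d" where
  "gr\<phi> i v \<equiv> grad_within (block_space blk i) (\<phi> i) (block blk i v)"

lemma
  assumes "i \<in> {1..m}"
  shows gr\<phi>_in: "gr\<phi> i v \<in> block_space blk i"
    and gr\<phi>_derivative: "u \<in> block_space blk i \<Longrightarrow> (\<phi> i has_derivative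
      (\<lambda>h. grad_within (block_space blk i) (\<phi> i) u \<bullet> h)) (at u within block_space blk i)"
  using grad_within_works[OF subspace_block_space, of _ blk i "\<phi> i"] \<phi>[OF assms]
  by (auto simp: differentiable_on_def block_in_block_space)

section \<open>Signs and sizes of the constants\<close>

lemma constants_nonneg: "0 \<le> lH" "0 \<le> lP" "0 \<le> lG" "0 \<le> l\<psi>"
  using H(2) P(2) G(4) \<psi>(3) by (auto intro: lipschitz_on_nonneg)

lemma l\<phi>_nonneg: "0 \<le> l\<phi>"
  using \<phi>[of "blk undefined"] blk_bounds[OF blocks] by (auto intro: lipschitz_on_nonneg)

text \<open>The sum of the coefficients \<open>lH + \<nu> * l\<psi>\<close> and
  \<open>\<nu> * l\<psi>\<close> of the current and the preceding \<open>y\<close>-step in the bound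
  for the multiplier increment.\<close>

definition K :: real where "K = lH + 2 * \<nu> * l\<psi>"

lemma K_ge: "lH \<le> K" "2 * (\<nu> * l\<psi>) \<le> K" "0 \<le> K"
  using constants_nonneg \<nu>(1) by (auto simp: K_def)

lemma \<rho>_pos: "0 < \<rho>"
proof -
  have "0 \<le> (lH + sqrt (lH\<^sup>2 + 8 * (lH + 2 * \<nu> * l\<psi>)\<^sup>2)) / (2 * lam)"
    using constants_nonneg lam by simp
  then show ?thesis using \<rho> by simp
qed

lemma \<rho>lam: "lH + sqrt (lH\<^sup>2 + 8 * K\<^sup>2) < 2 * (\<rho> * lam)"
  using \<rho> lam by (simp add: K_def field_simps)

text \<open>Because \<open>K \<ge> lH\<close>, the square root is at least \<open>3 * lH\<close>.
  The factor 2 is what the lower bound of the energy needs.\<close>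

lemma \<rho>lam_gt: "2 * lH < \<rho> * lam"
proof -
  have "(3 * lH)\<^sup>2 \<le> lH\<^sup>2 + 8 * K\<^sup>2"
    using power_mono[OF K_ge(1) constants_nonneg(1), of 2] by simp
  then have "3 * lH \<le> sqrt (lH\<^sup>2 + 8 * K\<^sup>2)" by (rule real_le_rsqrt)
  then show ?thesis using \<rho>lam by simp
qed

text \<open>Coefficients of the squared steps in the energy decrease. \<open>\<delta>x\<close> is
  the proximal gain less the linearization errors of \<open>P\<close> and \<open>G\<close>;
  \<open>\<delta>y\<close> is the penalty's gain less the curvature of \<open>H\<close> and the full
  multiplier cost.\<close>

definition \<delta>x :: real where "\<delta>x = (\<mu> * \<alpha> - lP - \<beta>) / 2"
definition \<delta>y :: real where "\<delta>y = (\<rho> * lam - lH) / 2 - K\<^sup>2 / (lam * \<rho>)"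

lemma \<delta>x_pos: "0 < \<delta>x"
  using \<mu>(1) \<alpha> by (simp add: \<delta>x_def field_simps)

text \<open>The lower bound on \<open>\<rho>\<close> puts \<open>s = \<rho> * lam\<close> beyond the
  larger root of \<open>s * (s - lH) = 2 * K\<^sup>2\<close>.\<close>

lemma \<delta>y_pos: "0 < \<delta>y"
proof -
  define s where "s = \<rho> * lam"
  have s: "0 < s" using \<rho>_pos lam by (simp add: s_def)
  have "sqrt (lH\<^sup>2 + 8 * K\<^sup>2) < 2 * s - lH" using \<rho>lam by (simp add: s_def)
  then have "(sqrt (lH\<^sup>2 + 8 * K\<^sup>2))\<^sup>2 < (2 * s - lH)\<^sup>2"
    by (rule power_strict_mono) auto
  then have "lH\<^sup>2 + 8 * K\<^sup>2 < (2 * s - lH)\<^sup>2" by simp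
  then have "2 * K\<^sup>2 < s * (s - lH)" by (simp add: power2_eq_square algebra_simps)
  then have "K\<^sup>2 / s < (s - lH) / 2" using s by (simp add: field_simps)
  then show ?thesis by (simp add: \<delta>y_def s_def mult.commute)
qed

lemma c_nonneg: "0 \<le> c"
  using constants_nonneg \<nu>(1) \<rho>_pos lam by (simp add: c)

section \<open>Splitting the Lagrangian into an extended-valued and a smooth part\<close>

abbreviation \<L> :: "(real^'d) \<times> (real^'q) \<times> (real^'p) \<Rightarrow> ereal" where
  "\<L> \<equiv> aug_lagrangian m blk f H P G A B b \<rho>"

abbreviation \<F> :: "(real^'d) \<times> (real^'q) \<times> (real^'p) \<times> (real^'q) \<Rightarrow> ereal" where
  "\<F> \<equiv> aug_lagrangian_reg m blk f H P G A B b \<rho> c"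

abbreviation R :: "real^'d \<Rightarrow> real^'q \<Rightarrow> real^'p" where
  "R u w \<equiv> A *v u + B *v w - b"

text \<open>All infinite values and all nonsmoothness are confined to \<open>fs\<close>; the
  remainder \<open>S\<close> is real-valued and differentiable.\<close>

definition fs :: "real^'d \<Rightarrow> ereal" where
  "fs u = (\<Sum>i=1..m. f i (block blk i u))"

definition S :: "real^'d \<Rightarrow> real^'q \<Rightarrow> real^'p \<Rightarrow> real" where
  "S u w q = H w + P u - G u + q \<bullet> R u w + \<rho> / 2 * (norm (R u w))\<^sup>2"

lemma aug_lagrangian_eq:
  "\<L> (u, w, q) = fs u + ereal (S u w q)"
  by (simp add: aug_lagrangian_def objective_def fs_def S_def add.assoc)

lemma aug_lagrangian_reg_eq:
  "\<F> (u, w, q, t)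
    = fs u + ereal (S u w q + c * (norm (w - t))\<^sup>2)"
  by (simp add: aug_lagrangian_reg_def aug_lagrangian_eq add.assoc)

lemma f_not_MInfty: "i \<in> {1..m} \<Longrightarrow> f i (block blk i u) \<noteq> -\<infinity>"
  using f[of i] block_in_block_space[of blk i u] by (auto simp: proper_on_def)

lemma fs_not_MInfty: "fs u \<noteq> -\<infinity>"
  unfolding fs_def by (rule sum_ereal_not_MInfty) (rule f_not_MInfty)

lemma fs_finite_somewhere: "\<exists>u. fs u \<noteq> \<infinity>"
proof -
  have "\<forall>i\<in>{1..m}. \<exists>v\<in>block_space blk i. f i v \<noteq> \<infinity>" using f by (auto simp: proper_on_def)
  then obtain w where w: "\<And>i. i \<in> {1..m} \<Longrightarrow> w i \<in> block_space blk i \<and> f i (w i) \<noteq> \<infinity>"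
    by metis
  have "f i (block blk i (\<Sum>k=1..m. w k)) \<noteq> \<infinity>" if "i \<in> {1..m}" for i
    using block_sum_block_space[OF blocks, of w i] w that by simp
  then show ?thesis by (intro exI[of _ "\<Sum>k=1..m. w k"]) (auto simp: fs_def sum_Pinfty)
qed

lemma fs_lsc:
  assumes "X \<longlonglongrightarrow> u" shows "fs u \<le> liminf (\<lambda>n. fs (X n))"
  unfolding fs_def
proof (rule liminf_sum_ge)
  fix i assume i: "i \<in> {1..m}"
  show "f i (block blk i u) \<le> liminf (\<lambda>n. f i (block blk i (X n)))"
    using f[OF i] bounded_linear.tendsto[OF bounded_linear_block assms]
    by (intro lsc_on_sequentially) (auto simp: block_in_block_space)
qed (auto simp: f_not_MInfty)

section \<open>The \<open>x\<close>-update\<close>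

lemma g_eq: "g n = grad G (x n)"
  using limiting_subdiff_C1[OF grad_G lipschitz_on_continuous_on[OF G(4)]] alg
  by (auto simp: BPL_ADMM_def)

lemma z_Suc: "z (Suc n) = z n + \<rho> *\<^sub>R R (x (Suc n)) (y (Suc n))"
  using alg by (simp add: BPL_ADMM_def)

text \<open>The finite part of the \<open>i\<close>-th subproblem, precomposed with the projection
  onto block \<open>i\<close>, so that all subproblems become functions of one vector of the full
  space and can be added.\<close>

definition s :: "nat \<Rightarrow> nat \<Rightarrow> real^'d \<Rightarrow> real" where
  "s n i v = (grad P (x n) - g n) \<bullet> block blk i v + z n \<bullet> (A *v block blk i v) +
     \<rho> / 2 * (norm (R (gs_point blk i (x (Suc n)) v (x n)) (y n)))\<^sup>2 +
     \<mu>s n * bregman (block_space blk i) (\<phi> i) (block blk i v) (block blk i (x n))"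

definition T :: "nat \<Rightarrow> real^'d \<Rightarrow> real" where
  "T n v = (\<Sum>i=1..m. s n i v)"

text \<open>
  The block minimality conditions add up to minimality of \<open>x (Suc n)\<close> over the whole product
  space; from here on the blocks only enter through \<open>T\<close>.
\<close>

lemma x_minimizes: "fs (x (Suc n)) + ereal (T n (x (Suc n))) \<le> fs v + ereal (T n v)"
proof -
  have "f i (block blk i (x (Suc n))) + ereal (s n i (x (Suc n)))
      \<le> f i (block blk i v) + ereal (s n i v)" if i: "i \<in> {1..m}" for i
  proof -
    define obj where "obj v = f i v + ereal
        (block blk i (grad P (x n) - g n) \<bullet> v + z n \<bullet> (block_columns blk i A *v v) +
         \<rho> / 2 * (norm (A *v gs_point blk i (x (Suc n)) v (x n) + B *v y n - b))\<^sup>2 +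
         \<mu>s n * bregman (block_space blk i) (\<phi> i) v (block blk i (x n)))" for v
    have inner: "block blk i (grad P (x n) - g n) \<bullet> block blk i u = (grad P (x n) - g n) \<bullet> block blk i u" for u
      by (simp add: block_inner block_of_block_space[OF block_in_block_space])
    have obj: "obj (block blk i u) = f i (block blk i u) + ereal (s n i u)" for u
      by (simp add: obj_def s_def inner block_columns_mult gs_point_block
          block_of_block_space[OF block_in_block_space])
    have "is_arg_min obj (\<lambda>v. v \<in> block_space blk i) (block blk i (x (Suc n)))"
      using alg i unfolding BPL_ADMM_def obj_def by blast
    then have "obj (block blk i (x (Suc n))) \<le> obj (block blk i v)"
      using block_in_block_space[of blk i v] by (auto simp: is_arg_min_def not_less)
    then show ?thesis by (simp only: obj)
  qed
  then have "(\<Sum>i=1..m. f i (block blk i (x (Suc n))) + ereal (s n i (x (Suc n))))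
      \<le> (\<Sum>i=1..m. f i (block blk i v) + ereal (s n i v))"
    by (rule sum_mono)
  then show ?thesis by (simp add: sum.distrib fs_def T_def)
qed

text \<open>A faithful value from index 1 on, where minimality makes \<open>fs\<close> finite. At
  index 0 the value may be infinite, and \<open>real_of_ereal\<close> then returns 0.\<close>

definition fv :: "nat \<Rightarrow> real" where "fv n = real_of_ereal (fs (x n))"

lemma fs_x: "fs (x (Suc n)) = ereal (fv (Suc n))"
proof -
  obtain v where "fs v \<noteq> \<infinity>" using fs_finite_somewhere by blast
  then have "fs (x (Suc n)) \<noteq> \<infinity>" using x_minimizes[of n v] fs_not_MInfty[of v] by auto
  then show ?thesis using fs_not_MInfty[of "x (Suc n)"] by (cases "fs (x (Suc n))") (auto simp: fv_def)
qed

lemma \<mu>s_pos: "0 < \<mu>s n"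
proof -
  have "0 \<le> (lP + \<beta>) / \<alpha>" using constants_nonneg G(1) \<alpha> by simp
  then show ?thesis using \<mu>(1) \<mu>(2)[of n] by simp
qed

text \<open>The linear terms add up over the blocks, the penalties telescope through the
  Gauss-Seidel points, and strong convexity of \<open>\<phi> i\<close> bounds the Bregman terms at
  the new point below; at the old point they vanish.\<close>

lemma T_diff_ge:
  fixes n defines "d \<equiv> x (Suc n) - x n"
  shows "(grad P (x n) - grad G (x n)) \<bullet> d + z n \<bullet> (A *v d)
    + \<rho> / 2 * (norm (R (x (Suc n)) (y n)))\<^sup>2 - \<rho> / 2 * (norm (R (x n) (y n)))\<^sup>2
    + \<mu> * \<alpha> / 2 * (norm d)\<^sup>2 \<le> T n (x (Suc n)) - T n (x n)"
proof -
  let ?gs = "\<lambda>i v. gs_point blk i (x (Suc n)) v (x n)"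
  let ?q = "\<lambda>u. \<rho> / 2 * (norm (R u (y n)))\<^sup>2"
  have breg: "\<mu> * \<alpha> / 2 * (norm (block blk i d))\<^sup>2 \<le> \<mu>s n *
      bregman (block_space blk i) (\<phi> i) (block blk i (x (Suc n))) (block blk i (x n))" if i: "i \<in> {1..m}" for i
  proof -
    have "\<phi> i (block blk i (x n)) + gr\<phi> i (x n) \<bullet> (block blk i (x (Suc n)) - block blk i (x n))
        - (- \<alpha> / 2) * (norm (block blk i (x (Suc n)) - block blk i (x n)))\<^sup>2 \<le> \<phi> i (block blk i (x (Suc n)))"
      by (rule convex_quadratic_perturbation_above_tangent[OF subspace_block_space block_in_block_space block_in_block_space])
        (use \<phi>[OF i] gr\<phi>_derivative[OF i block_in_block_space] in \<open>auto simp: strongly_convex_on_def\<close>)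
    then have "\<alpha> / 2 * (norm (block blk i d))\<^sup>2 \<le>
        bregman (block_space blk i) (\<phi> i) (block blk i (x (Suc n))) (block blk i (x n))"
      by (simp add: bregman_def d_def block_diff)
    then have "\<mu>s n * (\<alpha> / 2 * (norm (block blk i d))\<^sup>2) \<le> \<mu>s n *
        bregman (block_space blk i) (\<phi> i) (block blk i (x (Suc n))) (block blk i (x n))"
      using \<mu>s_pos[of n] by (intro mult_left_mono) auto
    moreover have "\<mu> * (\<alpha> / 2 * (norm (block blk i d))\<^sup>2) \<le> \<mu>s n * (\<alpha> / 2 * (norm (block blk i d))\<^sup>2)"
      using \<mu>(2) \<alpha> by (intro mult_right_mono) auto
    ultimately show ?thesis by simp
  qed
  have "(\<Sum>i=1..m. (grad P (x n) - g n) \<bullet> block blk i d + z n \<bullet> (A *v block blk i d)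
      + (?q (?gs i (x (Suc n))) - ?q (?gs i (x n))) + \<mu> * \<alpha> / 2 * (norm (block blk i d))\<^sup>2)
      \<le> (\<Sum>i=1..m. s n i (x (Suc n)) - s n i (x n))"
  proof (rule sum_mono)
    fix i assume i: "i \<in> {1..m}"
    have "bregman (block_space blk i) (\<phi> i) (block blk i (x n)) (block blk i (x n)) = 0"
      by (simp add: bregman_def)
    then show "(grad P (x n) - g n) \<bullet> block blk i d + z n \<bullet> (A *v block blk i d)
      + (?q (?gs i (x (Suc n))) - ?q (?gs i (x n))) + \<mu> * \<alpha> / 2 * (norm (block blk i d))\<^sup>2
      \<le> s n i (x (Suc n)) - s n i (x n)"
      using breg[OF i]
      by (simp add: s_def d_def block_diff inner_diff_right matrix_vector_mult_diff_distrib)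
  qed
  moreover have "(\<Sum>i=1..m. (grad P (x n) - g n) \<bullet> block blk i d) = (grad P (x n) - g n) \<bullet> d"
    by (simp only: inner_sum_right[symmetric] sum_block[OF blocks])
  moreover have "(\<Sum>i=1..m. z n \<bullet> (A *v block blk i d)) = z n \<bullet> (A *v d)"
    unfolding inner_matrix_transpose by (simp only: inner_sum_right[symmetric] sum_block[OF blocks])
  moreover have "(\<Sum>i=1..m. ?q (?gs i (x (Suc n))) - ?q (?gs i (x n))) = ?q (x (Suc n)) - ?q (x n)"
    by (rule sum_gs_point_telescope[OF blocks])
  moreover have "(\<Sum>i=1..m. \<mu> * \<alpha> / 2 * (norm (block blk i d))\<^sup>2) = \<mu> * \<alpha> / 2 * (norm d)\<^sup>2"
    by (simp only: sum_distrib_left[symmetric] sum_norm_block[OF blocks])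
  ultimately show ?thesis by (simp only: sum.distrib sum_subtractf T_def g_eq)
qed

text \<open>\<open>T\<close> carries \<open>P\<close> and \<open>G\<close> only through their
  linearizations. Replacing these by the functions costs \<open>lP / 2\<close> by the descent lemma
  and \<open>\<beta> / 2\<close> by weak convexity. The indices start at \<open>Suc n\<close> so
  that both values of \<open>fs\<close> are finite.\<close>

lemma x_descent:
  "fv (Suc (Suc n)) + S (x (Suc (Suc n))) (y (Suc n)) (z (Suc n)) + \<delta>x * (norm (x (Suc (Suc n)) - x (Suc n)))\<^sup>2
    \<le> fv (Suc n) + S (x (Suc n)) (y (Suc n)) (z (Suc n))"
proof -
  define n' where "n' = Suc n"
  define d where "d = x (Suc n') - x n'"
  have "ereal (fv (Suc n')) + ereal (T n' (x (Suc n'))) \<le> ereal (fv n') + ereal (T n' (x n'))"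
    using x_minimizes[of n' "x n'"] fs_x by (simp add: n'_def)
  then have 1: "fv (Suc n') + T n' (x (Suc n')) \<le> fv n' + T n' (x n')" by simp
  have 2: "P (x (Suc n')) \<le> P (x n') + grad P (x n') \<bullet> d + lP / 2 * (norm d)\<^sup>2"
    unfolding d_def by (rule lipschitz_gradient_upper_bound[OF subspace_UNIV])
      (use grad_P P in auto)
  have 3: "G (x n') + grad G (x n') \<bullet> d - \<beta> / 2 * (norm d)\<^sup>2 \<le> G (x (Suc n'))"
    unfolding d_def by (rule convex_quadratic_perturbation_above_tangent[OF subspace_UNIV])
      (use grad_G G in \<open>auto simp: weakly_convex_on_def\<close>)
  have 4: "z n' \<bullet> R (x (Suc n')) (y n') = z n' \<bullet> R (x n') (y n') + z n' \<bullet> (A *v d)"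
    by (simp add: d_def matrix_vector_mult_diff_distrib inner_diff_right inner_add_right)
  have "\<delta>x * (norm d)\<^sup>2 = \<mu> * \<alpha> / 2 * (norm d)\<^sup>2 - lP / 2 * (norm d)\<^sup>2 - \<beta> / 2 * (norm d)\<^sup>2"
    by (simp add: \<delta>x_def diff_divide_distrib left_diff_distrib)
  then show ?thesis
    using 1 2 3 4 T_diff_ge[of n', folded d_def]
    unfolding n'_def[symmetric] d_def[symmetric] S_def inner_diff_left by linarith
qed

section \<open>The \<open>y\<close>-update\<close>

lemma y_minimizes: "H (y (Suc n)) + z n \<bullet> (B *v y (Suc n)) + \<rho> / 2 * (norm (R (x (Suc n)) (y (Suc n))))\<^sup>2
    + \<nu>s n * bregman UNIV \<psi> (y (Suc n)) (y n)
  \<le> H w + z n \<bullet> (B *v w) + \<rho> / 2 * (norm (R (x (Suc n)) w))\<^sup>2 + \<nu>s n * bregman UNIV \<psi> w (y n)"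
  using alg by (auto simp: BPL_ADMM_def is_arg_min_def not_less)

text \<open>The stationarity condition of the \<open>y\<close>-subproblem, where the old multiplier
  and the penalty gradient merge into the new multiplier by the update of \<open>z\<close>.\<close>

lemma transpose_B_z: "transpose B *v z (Suc n)
  = - grad H (y (Suc n)) - \<nu>s n *\<^sub>R (grad \<psi> (y (Suc n)) - grad \<psi> (y n))"
proof -
  define y' where "y' = y (Suc n)"
  define r where "r = R (x (Suc n)) y'"
  define v where "v = grad H y' + transpose B *v z n + \<rho> *\<^sub>R (transpose B *v r)
    + \<nu>s n *\<^sub>R (grad \<psi> y' - grad \<psi> (y n))"
  have dB: "((\<lambda>w. B *v w) has_derivative (\<lambda>h. B *v h)) (at y')"
    by (rule bounded_linear_imp_has_derivative[OF matrix_vector_mul_bounded_linear])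
  have "((\<lambda>w. H w + z n \<bullet> (B *v w) + \<rho> / 2 * (R (x (Suc n)) w \<bullet> R (x (Suc n)) w)
      + \<nu>s n * (\<psi> w - \<psi> (y n) - grad \<psi> (y n) \<bullet> (w - y n))) has_derivative
     (\<lambda>h. grad H y' \<bullet> h + z n \<bullet> (B *v h) + \<rho> / 2 * (R (x (Suc n)) y' \<bullet> (0 + B *v h - 0) + (0 + B *v h - 0) \<bullet> R (x (Suc n)) y')
      + \<nu>s n * (grad \<psi> y' \<bullet> h - 0 - grad \<psi> (y n) \<bullet> (h - 0)))) (at y')"
    by (intro has_derivative_add has_derivative_diff has_derivative_mult_right has_derivative_inner
        has_derivative_inner_right has_derivative_const has_derivative_ident dB grad_H grad_\<psi>)
  moreover have "grad H y' \<bullet> h + z n \<bullet> (B *v h) + \<rho> / 2 * (R (x (Suc n)) y' \<bullet> (0 + B *v h - 0) + (0 + B *v h - 0) \<bullet> R (x (Suc n)) y')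
      + \<nu>s n * (grad \<psi> y' \<bullet> h - 0 - grad \<psi> (y n) \<bullet> (h - 0)) = v \<bullet> h" for h
    by (simp add: v_def r_def[symmetric] inner_commute[of "B *v h"] inner_add_left inner_diff_left inner_matrix_transpose)
  ultimately have "((\<lambda>w. H w + z n \<bullet> (B *v w) + \<rho> / 2 * (norm (R (x (Suc n)) w))\<^sup>2
      + \<nu>s n * bregman UNIV \<psi> w (y n)) has_derivative (\<lambda>h. v \<bullet> h)) (at y')"
    by (simp add: bregman_def power2_norm_eq_inner)
  then have "v = 0"
    by (rule gradient_eq_0_at_minimum) (use y_minimizes in \<open>simp add: y'_def\<close>)
  moreover have "transpose B *v z (Suc n) = transpose B *v z n + \<rho> *\<^sub>R (transpose B *v r)"
    by (simp add: z_Suc r_def y'_def matrix_vector_right_distrib matrix_vector_mult_scaleR)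
  ultimately show ?thesis
    unfolding v_def y'_def[symmetric] by (simp add: algebra_simps eq_neg_iff_add_eq_0)
qed

text \<open>Expand about the new point: the penalty gains at least \<open>\<rho> * lam / 2\<close>
  times the squared step and \<open>H\<close> loses at most \<open>lH / 2\<close> times it. By
  stationarity the first-order terms reduce to a pairing of gradients of \<open>\<psi>\<close>,
  whose sign is given by monotonicity.\<close>

lemma y_descent:
  "S (x (Suc n)) (y (Suc n)) (z n) + (\<rho> * lam - lH) / 2 * (norm (y (Suc n) - y n))\<^sup>2
    \<le> S (x (Suc n)) (y n) (z n)"
proof -
  define x' y' d where "x' = x (Suc n)" and "y' = y (Suc n)" and "d = y n - y (Suc n)"
  have H': "H y' + grad H y' \<bullet> d - lH / 2 * (norm d)\<^sup>2 \<le> H (y n)"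
    unfolding d_def y'_def by (rule lipschitz_gradient_lower_bound[OF subspace_UNIV])
      (use grad_H H in auto)
  have R': "R x' (y n) = R x' y' + B *v d"
    by (simp add: d_def y'_def matrix_vector_mult_diff_distrib)
  have "(norm (R x' (y n)))\<^sup>2 = (norm (R x' y'))\<^sup>2 + 2 * (R x' y' \<bullet> (B *v d)) + (norm (B *v d))\<^sup>2"
    unfolding R' by (rule power2_norm_add)
  moreover have "lam * (norm d)\<^sup>2 \<le> (norm (B *v d))\<^sup>2"
    using lambda_min_gram_le lam by simp
  ultimately have "(norm (R x' y'))\<^sup>2 + 2 * (R x' y' \<bullet> (B *v d)) + lam * (norm d)\<^sup>2 \<le> (norm (R x' (y n)))\<^sup>2"
    by simp
  then have "\<rho> / 2 * ((norm (R x' y'))\<^sup>2 + 2 * (R x' y' \<bullet> (B *v d)) + lam * (norm d)\<^sup>2) \<le> \<rho> / 2 * (norm (R x' (y n)))\<^sup>2"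
    using \<rho>_pos by (intro mult_left_mono) auto
  then have q: "\<rho> / 2 * (norm (R x' y'))\<^sup>2 + \<rho> * (R x' y' \<bullet> (B *v d)) + \<rho> * lam / 2 * (norm d)\<^sup>2
      \<le> \<rho> / 2 * (norm (R x' (y n)))\<^sup>2"
    by (simp add: distrib_left)
  have mono: "(grad \<psi> y' - grad \<psi> (y n)) \<bullet> d \<le> 0"
  proof -
    have conv: "convex_on UNIV (\<lambda>u. \<psi> u + 0 * (norm u)\<^sup>2)" using \<psi> by simp
    have "\<psi> y' + grad \<psi> y' \<bullet> (y n - y') - 0 * (norm (y n - y'))\<^sup>2 \<le> \<psi> (y n)"
      by (rule convex_quadratic_perturbation_above_tangent[OF subspace_UNIV _ _ conv]) (use grad_\<psi> in auto)
    moreover have "\<psi> (y n) + grad \<psi> (y n) \<bullet> (y' - y n) - 0 * (norm (y' - y n))\<^sup>2 \<le> \<psi> y'"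
      by (rule convex_quadratic_perturbation_above_tangent[OF subspace_UNIV _ _ conv]) (use grad_\<psi> in auto)
    ultimately show ?thesis by (simp add: d_def y'_def inner_diff_left inner_diff_right)
  qed
  have "grad H y' \<bullet> d + z n \<bullet> (B *v d) + \<rho> * (R x' y' \<bullet> (B *v d)) = grad H y' \<bullet> d + z (Suc n) \<bullet> (B *v d)"
    by (simp add: z_Suc x'_def y'_def inner_add_left)
  also have "\<dots> = - \<nu>s n * ((grad \<psi> y' - grad \<psi> (y n)) \<bullet> d)"
    by (simp add: inner_matrix_transpose transpose_B_z y'_def inner_diff_left)
  also have "\<dots> \<ge> 0" using mono \<nu>(2)[of n] by (simp add: mult_nonneg_nonpos)
  finally have lin: "0 \<le> grad H y' \<bullet> d + z n \<bullet> (B *v d) + \<rho> * (R x' y' \<bullet> (B *v d))" .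
  have "z n \<bullet> R x' (y n) = z n \<bullet> R x' y' + z n \<bullet> (B *v d)" unfolding R' by (rule inner_add_right)
  moreover have "(\<rho> * lam - lH) / 2 * (norm d)\<^sup>2 = \<rho> * lam / 2 * (norm d)\<^sup>2 - lH / 2 * (norm d)\<^sup>2"
    by (simp add: diff_divide_distrib left_diff_distrib)
  moreover have nd: "norm (y' - y n) = norm d" by (simp add: d_def y'_def norm_minus_commute)
  ultimately show ?thesis
    using H' q lin unfolding S_def x'_def[symmetric] y'_def[symmetric] nd by linarith
qed

section \<open>The multiplier stays in the range of \<open>B\<close>\<close>

lemma range_B_A: "A *v u \<in> range (\<lambda>w. B *v w)" and range_B_b: "b \<in> range (\<lambda>w. B *v w)"
  using image by auto

lemma subspace_range_B: "subspace (range (\<lambda>w. B *v w))"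
  using linear_subspace_image[OF matrix_vector_mul_linear subspace_UNIV, of B] by simp

lemma R_in_range: "R u w \<in> range (\<lambda>w. B *v w)"
  using subspace_range_B range_B_A range_B_b by (intro subspace_diff subspace_add) auto

lemma z_in_range: "z n \<in> range (\<lambda>w. B *v w)"
proof (induction n)
  case (Suc n)
  then show ?case unfolding z_Suc
    using subspace_range_B R_in_range by (intro subspace_add subspace_scale)
qed (rule z0)

lemma norm_le_B: "sqrt lam * norm w \<le> norm (B *v w)"
proof (rule power2_le_imp_le)
  show "(sqrt lam * norm w)\<^sup>2 \<le> (norm (B *v w))\<^sup>2"
    using lambda_min_gram_le[of B w] lam by (simp add: power_mult_distrib)
qed simp

text \<open>For \<open>q = B *v w\<close> the squared norm of \<open>q\<close> is
  \<open>(transpose B *v q) \<bullet> w\<close>, and \<open>w\<close> is bounded by \<open>q\<close>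
  because \<open>B\<close> is bounded below. Off the range of \<open>B\<close> the transpose may
  have a kernel, hence the range conditions on \<open>A\<close>, \<open>b\<close> and
  \<open>z 0\<close>.\<close>

lemma norm_le_transpose_B:
  assumes "q \<in> range (\<lambda>w. B *v w)"
  shows "sqrt lam * norm q \<le> norm (transpose B *v q)"
proof (cases "q = 0")
  case False
  obtain w where w: "q = B *v w" using assms by auto
  have "norm q * (sqrt lam * norm q) = sqrt lam * (q \<bullet> (B *v w))"
    by (simp add: w dot_square_norm power2_eq_square)
  also have "q \<bullet> (B *v w) = (transpose B *v q) \<bullet> w" by (rule inner_matrix_transpose)
  also have "sqrt lam * ((transpose B *v q) \<bullet> w) \<le> sqrt lam * (norm (transpose B *v q) * norm w)"
    using lam by (intro mult_left_mono norm_cauchy_schwarz) auto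
  also have "\<dots> = norm (transpose B *v q) * (sqrt lam * norm w)" by simp
  also have "\<dots> \<le> norm (transpose B *v q) * norm q"
    using norm_le_B[of w] by (intro mult_left_mono) (auto simp: w)
  finally have "norm q * (sqrt lam * norm q) \<le> norm q * norm (transpose B *v q)" by (simp add: mult.commute)
  then show ?thesis using False by simp
qed simp

lemma \<psi>_term_bound: "norm (\<nu>s n *\<^sub>R (grad \<psi> (y (Suc n)) - grad \<psi> (y n))) \<le> \<nu> * l\<psi> * norm (y (Suc n) - y n)"
proof -
  have "norm (\<nu>s n *\<^sub>R (grad \<psi> (y (Suc n)) - grad \<psi> (y n))) = \<nu>s n * norm (grad \<psi> (y (Suc n)) - grad \<psi> (y n))"
    using \<nu>(2)[of n] by simp
  also have "\<dots> \<le> \<nu> * (l\<psi> * norm (y (Suc n) - y n))"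
    using \<nu>(2)[of n] \<nu>(1) lipschitz_on_normD[OF \<psi>(3)] by (intro mult_mono) auto
  finally show ?thesis by simp
qed

text \<open>Subtract two consecutive instances of \<open>transpose_B_z\<close>. The older one brings
  in its own proximal term, and with it the preceding \<open>y\<close>-step.\<close>

lemma z_step:
  "sqrt lam * norm (z (Suc (Suc n)) - z (Suc n))
    \<le> (lH + \<nu> * l\<psi>) * norm (y (Suc (Suc n)) - y (Suc n)) + \<nu> * l\<psi> * norm (y (Suc n) - y n)"
proof -
  let ?p = "\<lambda>n. \<nu>s n *\<^sub>R (grad \<psi> (y (Suc n)) - grad \<psi> (y n))"
  have "sqrt lam * norm (z (Suc (Suc n)) - z (Suc n)) \<le> norm (transpose B *v (z (Suc (Suc n)) - z (Suc n)))"
    using z_in_range subspace_range_B by (intro norm_le_transpose_B subspace_diff)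
  also have "transpose B *v (z (Suc (Suc n)) - z (Suc n))
      = (grad H (y (Suc n)) - grad H (y (Suc (Suc n)))) + (?p n - ?p (Suc n))"
    by (simp add: matrix_vector_mult_diff_distrib transpose_B_z)
  also have "norm \<dots> \<le> norm (grad H (y (Suc n)) - grad H (y (Suc (Suc n)))) + (norm (?p n) + norm (?p (Suc n)))"
    by (intro norm_triangle_le add_left_mono norm_triangle_ineq4)
  also have "\<dots> \<le> lH * norm (y (Suc (Suc n)) - y (Suc n)) + (\<nu> * l\<psi> * norm (y (Suc n) - y n)
      + \<nu> * l\<psi> * norm (y (Suc (Suc n)) - y (Suc n)))"
    using lipschitz_on_normD[OF H(2), of "y (Suc n)" "y (Suc (Suc n))"] \<psi>_term_bound
    by (intro add_mono) (auto simp: norm_minus_commute)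
  finally show ?thesis by (simp add: algebra_simps)
qed

text \<open>The inequality \<open>(a * u + p * v)\<^sup>2 \<le> (a + p) * (a * u\<^sup>2 + p *
  v\<^sup>2)\<close> charges \<open>K * p / (lam * \<rho>)\<close> to the preceding step: this is
  the origin of \<open>c\<close>. The current step pays the rest, since
  \<open>a = K - p\<close>.\<close>

lemma z_step_square:
  "1 / \<rho> * (norm (z (Suc (Suc n)) - z (Suc n)))\<^sup>2
    \<le> (K\<^sup>2 / (lam * \<rho>) - c) * (norm (y (Suc (Suc n)) - y (Suc n)))\<^sup>2 + c * (norm (y (Suc n) - y n))\<^sup>2"
proof -
  define u v where "u = norm (y (Suc (Suc n)) - y (Suc n))" and "v = norm (y (Suc n) - y n)"
  define a p where "a = lH + \<nu> * l\<psi>" and "p = \<nu> * l\<psi>"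
  have ap: "0 \<le> a" "0 \<le> p" "a + p = K" using constants_nonneg \<nu>(1) by (auto simp: a_def p_def K_def)
  have "(sqrt lam * norm (z (Suc (Suc n)) - z (Suc n)))\<^sup>2 \<le> (a * u + p * v)\<^sup>2"
    using z_step[of n] lam by (intro power_mono) (auto simp: a_def p_def u_def v_def)
  then have "lam * (norm (z (Suc (Suc n)) - z (Suc n)))\<^sup>2 \<le> (a * u + p * v)\<^sup>2"
    using lam by (simp add: power_mult_distrib)
  also have "\<dots> \<le> (a + p) * (a * u\<^sup>2 + p * v\<^sup>2)"
  proof -
    have "0 \<le> a * p * (u - v)\<^sup>2" using ap by simp
    then show ?thesis by (simp add: power2_eq_square algebra_simps)
  qed
  finally have "lam * (norm (z (Suc (Suc n)) - z (Suc n)))\<^sup>2 \<le> K * (a * u\<^sup>2 + p * v\<^sup>2)"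
    using ap by simp
  then have "(norm (z (Suc (Suc n)) - z (Suc n)))\<^sup>2 / \<rho> \<le> K * (a * u\<^sup>2 + p * v\<^sup>2) / (lam * \<rho>)"
    using lam \<rho>_pos by (simp add: field_simps)
  also have "\<dots> = (K\<^sup>2 / (lam * \<rho>) - c) * u\<^sup>2 + c * v\<^sup>2"
  proof -
    have c': "c = K * p / (lam * \<rho>)" by (simp add: c K_def p_def mult.assoc)
    have a': "a = K - p" using ap by simp
    show ?thesis unfolding c' a'
      by (simp add: add_divide_distrib diff_divide_distrib algebra_simps power2_eq_square)
  qed
  finally show ?thesis by (simp add: u_def v_def)
qed

section \<open>The energy and its decrease\<close>

definition en :: "nat \<Rightarrow> real" where
  "en n = fv (Suc n) + S (x (Suc n)) (y (Suc n)) (z (Suc n)) + c * (norm (y (Suc n) - y n))\<^sup>2"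

lemma reg_at_iterate:
  "\<F> (x (Suc n), y (Suc n), z (Suc n), y n) = ereal (en n)"
  by (simp add: aug_lagrangian_reg_eq fs_x en_def add.assoc)

text \<open>Only the primal step is measured, since multiplier increments are bounded by two
  consecutive values of \<open>D\<close>.\<close>

definition D :: "nat \<Rightarrow> real" where "D n = norm (x (Suc n) - x n, y (Suc n) - y n)"

definition \<delta> :: real where "\<delta> = min \<delta>x \<delta>y"

lemma \<delta>_pos: "0 < \<delta>" using \<delta>x_pos \<delta>y_pos by (simp add: \<delta>_def)

text \<open>Add the estimates for the three updates. The \<open>c\<close>-term of the new energy
  cancels the \<open>- c\<close> in \<open>z_step_square\<close>, and the \<open>c\<close>-term of
  the old energy pays for the preceding step.\<close>

lemma energy_descent: "en (Suc n) + \<delta> * (D (Suc n))\<^sup>2 \<le> en n"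
proof -
  define n' where "n' = Suc n"
  define u v w where "u = (norm (x (Suc n') - x n'))\<^sup>2" and "v = (norm (y (Suc n') - y n'))\<^sup>2"
    and "w = (norm (y n' - y n))\<^sup>2"
  \<comment> \<open>\<open>S\<close> is affine in the multiplier with slope \<open>R\<close>, and
    \<open>R\<close> is the increment divided by \<open>\<rho>\<close>; so the
    \<open>z\<close>-update raises \<open>S\<close> by this square.\<close>
  have z: "S (x (Suc n')) (y (Suc n')) (z (Suc n')) = S (x (Suc n')) (y (Suc n')) (z n') + 1 / \<rho> * (norm (z (Suc n') - z n'))\<^sup>2"
    using \<rho>_pos by (simp add: S_def z_Suc[of n'] inner_add_left power_mult_distrib dot_square_norm power2_eq_square)
  have D: "(D (Suc n))\<^sup>2 = u + v" by (simp add: D_def norm_Pair u_def v_def n'_def)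
  have "\<delta> * (u + v) \<le> \<delta>x * u + \<delta>y * v"
    by (simp add: distrib_left \<delta>_def add_mono mult_right_mono u_def v_def)
  moreover have "\<delta>y * v = (\<rho> * lam - lH) / 2 * v - K\<^sup>2 / (lam * \<rho>) * v" by (simp add: \<delta>y_def left_diff_distrib)
  moreover have "(K\<^sup>2 / (lam * \<rho>) - c) * v = K\<^sup>2 / (lam * \<rho>) * v - c * v" by (simp add: left_diff_distrib)
  ultimately show ?thesis
    using x_descent[of n] y_descent[of n'] z z_step_square[of n] unfolding D en_def
    unfolding n'_def[symmetric] u_def[symmetric] v_def[symmetric] w_def[symmetric] by linarith
qed

section \<open>Boundedness of the iterates\<close>

lemma continuous_PG: "continuous_on UNIV P" "continuous_on UNIV G"
  using P(1) G(3) by (auto intro: differentiable_imp_continuous_on)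

text \<open>Points with values below \<open>- n\<close> would be bounded by coercivity; at the limit
  of a subsequence, lower semicontinuity would make \<open>fs\<close> equal to minus
  infinity.\<close>

lemma \<Phi>_bounded_below: "\<exists>M. \<forall>u. ereal M \<le> fs u + ereal (P u - G u)"
proof (rule ccontr)
  let ?\<Phi> = "\<lambda>u. fs u + ereal (P u - G u)"
  assume "\<not> ?thesis"
  then have "\<forall>n::nat. \<exists>u. ?\<Phi> u < ereal (- real n)" by (metis not_le)
  then obtain U where U: "\<And>n. ?\<Phi> (U n) < ereal (- real n)" by metis
  have "(?\<Phi> \<longlongrightarrow> \<infinity>) at_infinity" using coercive by (simp add: coercive_def fs_def)
  then have "\<forall>\<^sub>F u in at_infinity. ereal 0 < ?\<Phi> u" by (rule order_tendstoD(1)) simp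
  then obtain r0 where r0: "\<And>u. r0 \<le> norm u \<Longrightarrow> 0 < ?\<Phi> u"
    by (auto simp: eventually_at_infinity zero_ereal_def)
  have "norm (U n) < r0" for n
  proof (rule ccontr)
    assume "\<not> norm (U n) < r0"
    then have "0 < ?\<Phi> (U n)" using r0 by simp
    also have "\<dots> < ereal (- real n)" by (rule U)
    finally show False by (simp add: zero_ereal_def)
  qed
  then have "bounded (range U)" by (auto simp: bounded_iff intro!: exI[of _ r0] less_imp_le)
  then obtain l r where r: "strict_mono (r :: nat \<Rightarrow> nat)" and l: "(U \<circ> r) \<longlonglongrightarrow> l"
    using bounded_imp_convergent_subsequence by blast
  have PG: "(\<lambda>k. P (U (r k)) - G (U (r k))) \<longlonglongrightarrow> P l - G l"
  proof -
    have "isCont P l" "isCont G l" using continuous_PG by (auto simp: continuous_on_eq_continuous_at)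
    then show ?thesis
      using l by (intro tendsto_diff isCont_tendsto_compose[of l P] isCont_tendsto_compose[of l G]) (auto simp: o_def)
  qed
  have "fs l \<le> liminf (\<lambda>k. fs (U (r k)))" using fs_lsc[OF l] by (simp add: o_def)
  also have "\<dots> = -\<infinity>"
  proof -
    have "(\<lambda>k. fs (U (r k))) \<longlonglongrightarrow> -\<infinity>"
      unfolding tendsto_MInfty
    proof
      fix a :: real
      obtain M where M: "\<And>k. norm (P (U (r k)) - G (U (r k))) \<le> M"
        using convergent_imp_bounded[OF PG] by (auto simp: bounded_iff)
      obtain N :: nat where N: "M - a < real N" using reals_Archimedean2 by blast
      have "fs (U (r k)) < ereal a" if "N \<le> k" for k
      proof -
        have "real N \<le> real (r k)" using seq_suble[OF r, of k] that by simp
        then have *: "- real (r k) < a - M" using N by simp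
        show ?thesis
          using U[of "r k"] M[of k] fs_not_MInfty[of "U (r k)"] *
          by (cases "fs (U (r k))") (auto simp: abs_le_iff)
      qed
      then show "\<forall>\<^sub>F k in sequentially. fs (U (r k)) < ereal a" by (auto simp: eventually_sequentially)
    qed
    then show ?thesis by (intro lim_imp_Liminf) auto
  qed
  finally show False using fs_not_MInfty by simp
qed

text \<open>Compare with \<open>w\<close>, for which \<open>(x (Suc n), w)\<close> is feasible. The
  residual is then \<open>B *v (y (Suc n) - w)\<close>, and \<open>transpose_B_z\<close> turns the
  multiplier term into the first-order term of \<open>H\<close>, so the descent lemma recovers
  \<open>H w\<close>. The penalty and the \<open>c\<close>-term absorb the errors and leave a
  quarter of the gap \<open>\<rho> * lam - lH\<close>.\<close>

lemma energy_lower_bound: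
  assumes "B *v w = b - A *v x (Suc n)"
  shows "fv (Suc n) + P (x (Suc n)) - G (x (Suc n)) + H w + (\<rho> * lam - lH) / 4 * (norm (y (Suc n) - w))\<^sup>2 \<le> en n"
proof -
  define y' d t where "y' = y (Suc n)" and "d = norm (y (Suc n) - w)" and "t = norm (y (Suc n) - y n)"
  define p where "p = \<nu> * l\<psi>"
  define r where "r = R (x (Suc n)) y'"
  have r: "r = B *v (y' - w)"
    using assms by (simp add: r_def matrix_vector_mult_diff_distrib)
  have 1: "H w \<le> H y' + grad H y' \<bullet> (w - y') + lH / 2 * d\<^sup>2"
    using lipschitz_gradient_upper_bound[OF subspace_UNIV, of y' w H "grad H" lH] grad_H H
    by (simp add: d_def y'_def norm_minus_commute)
  have "z (Suc n) \<bullet> r = (- grad H y' - \<nu>s n *\<^sub>R (grad \<psi> y' - grad \<psi> (y n))) \<bullet> (y' - w)"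
    by (simp add: r inner_matrix_transpose transpose_B_z y'_def)
  also have "\<dots> = grad H y' \<bullet> (w - y') - (\<nu>s n *\<^sub>R (grad \<psi> y' - grad \<psi> (y n))) \<bullet> (y' - w)"
    by (simp add: inner_diff_left inner_diff_right)
  also have "\<dots> \<ge> grad H y' \<bullet> (w - y') - p * t * d"
  proof -
    have "(\<nu>s n *\<^sub>R (grad \<psi> y' - grad \<psi> (y n))) \<bullet> (y' - w) \<le> norm (\<nu>s n *\<^sub>R (grad \<psi> y' - grad \<psi> (y n))) * norm (y' - w)"
      by (rule norm_cauchy_schwarz)
    also have "\<dots> \<le> p * t * d"
      using \<psi>_term_bound[of n] by (simp only: p_def t_def d_def y'_def) (intro mult_right_mono, auto)
    finally show ?thesis by simp
  qed
  finally have 2: "grad H y' \<bullet> (w - y') - p * t * d \<le> z (Suc n) \<bullet> r" .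
  have "lam * d\<^sup>2 \<le> (norm r)\<^sup>2"
    using lambda_min_gram_le[of B "y' - w"] lam(1) by (simp add: r d_def y'_def)
  then have 3: "\<rho> * lam / 2 * d\<^sup>2 \<le> \<rho> / 2 * (norm r)\<^sup>2" using \<rho>_pos by simp
  have 4: "p * t * d \<le> (\<rho> * lam - lH) / 4 * d\<^sup>2 + c * t\<^sup>2"
  proof -
    define s where "s = \<rho> * lam"
    have s: "0 < s" "2 * lH < s" using \<rho>lam_gt \<rho>_pos lam by (auto simp: s_def)
    have p: "0 \<le> p" "2 * p \<le> K" using K_ge constants_nonneg \<nu>(1) by (auto simp: p_def)
    have cs: "c * s = K * p" using \<rho>_pos lam(2) by (simp add: c K_def s_def p_def)
    \<comment> \<open>AM-GM with \<open>s - lH \<ge> s/2\<close> and \<open>c s = K p \<ge> 2 p\<^sup>2\<close>\<close>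
    have "0 \<le> (s * d - 4 * p * t)\<^sup>2 / (8 * s) + (s / 8 - lH / 4) * d\<^sup>2 + (c - 2 * p\<^sup>2 / s) * t\<^sup>2"
    proof -
      have "2 * p\<^sup>2 \<le> K * p" using mult_right_mono[OF p(2,1)] by (simp add: power2_eq_square)
      then have "0 \<le> c - 2 * p\<^sup>2 / s" using s cs by (simp add: field_simps)
      then show ?thesis using s by (intro add_nonneg_nonneg mult_nonneg_nonneg) auto
    qed
    also have "\<dots> = (s - lH) / 4 * d\<^sup>2 + c * t\<^sup>2 - p * t * d"
      using s by (simp add: field_simps power2_eq_square)
    finally show ?thesis by (simp add: s_def)
  qed
  have "en n = fv (Suc n) + (H y' + P (x (Suc n)) - G (x (Suc n)) + z (Suc n) \<bullet> r + \<rho> / 2 * (norm r)\<^sup>2) + c * t\<^sup>2"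
    by (simp add: en_def S_def r_def y'_def t_def)
  moreover have "(\<rho> * lam - lH) / 4 * d\<^sup>2 = \<rho> * lam / 2 * d\<^sup>2 - lH / 2 * d\<^sup>2 - (\<rho> * lam - lH) / 4 * d\<^sup>2"
    by (simp add: field_simps)
  ultimately show ?thesis using 1 2 3 4 unfolding d_def[symmetric] by linarith
qed

lemma decseq_en: "decseq en"
proof (rule decseq_SucI)
  fix n show "en (Suc n) \<le> en n" using energy_descent[of n] \<delta>_pos by (smt (verit) mult_nonneg_nonneg zero_le_power2)
qed

lemma obtain_preimage: obtains w where "B *v w = b - A *v u"
proof -
  have "b - A *v u \<in> range (\<lambda>w. B *v w)"
    using subspace_range_B range_B_A range_B_b by (intro subspace_diff)
  then show thesis using that by force
qed

lemma energy_converges: "\<exists>es. en \<longlonglongrightarrow> es"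
proof -
  obtain M where M: "\<And>u. ereal M \<le> fs u + ereal (P u - G u)" using \<Phi>_bounded_below by blast
  obtain h where h: "\<And>w. h \<le> H w" using H(3) by (auto simp: bdd_below_def)
  have "M + h \<le> en n" for n
  proof -
    obtain w where w: "B *v w = b - A *v x (Suc n)" by (rule obtain_preimage)
    have "0 \<le> (\<rho> * lam - lH) / 4 * (norm (y (Suc n) - w))\<^sup>2" using \<rho>lam_gt constants_nonneg by simp
    moreover have "M \<le> fv (Suc n) + (P (x (Suc n)) - G (x (Suc n)))"
      using M[of "x (Suc n)"] by (simp add: fs_x)
    ultimately show ?thesis using energy_lower_bound[OF w] h[of w] by linarith
  qed
  then show ?thesis using decseq_convergent[OF decseq_en] by metis
qed

text \<open>Coercivity bounds \<open>x\<close>. The surplus in \<open>energy_lower_bound\<close>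
  then bounds the distance from \<open>y\<close> to a preimage \<open>w\<close> of
  \<open>b - A *v x\<close>, itself bounded as \<open>B\<close> is bounded below; finally
  \<open>transpose_B_z\<close> bounds \<open>z\<close>.\<close>

lemma bounded_iterates: "bounded (range (\<lambda>n. (x (Suc n), y (Suc n), z (Suc n))))"
proof -
  obtain h where h: "\<And>w. h \<le> H w" using H(3) by (auto simp: bdd_below_def)
  have en0: "en n \<le> en 0" for n using decseq_en by (simp add: decseq_def)
  let ?\<Phi> = "\<lambda>u. fs u + ereal (P u - G u)"
  have gap: "0 < \<rho> * lam - lH" using \<rho>lam_gt constants_nonneg by linarith
  obtain M where M: "\<And>u. ereal M \<le> fs u + ereal (P u - G u)" using \<Phi>_bounded_below by blast
  have up: "fv (Suc n) + (P (x (Suc n)) - G (x (Suc n))) + (\<rho> * lam - lH) / 4 * (norm (y (Suc n) - w))\<^sup>2 \<le> en 0 - h"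
    if "B *v w = b - A *v x (Suc n)" for n w
    using energy_lower_bound[OF that] h[of w] en0[of n] by linarith
  have "(?\<Phi> \<longlongrightarrow> \<infinity>) at_infinity" using coercive by (simp add: coercive_def fs_def)
  then have "\<forall>\<^sub>F u in at_infinity. ereal (en 0 - h) < ?\<Phi> u" by (rule order_tendstoD(1)) simp
  then obtain r0 where r0: "\<And>u. r0 \<le> norm u \<Longrightarrow> ereal (en 0 - h) < ?\<Phi> u"
    by (auto simp: eventually_at_infinity)
  have bx: "norm (x (Suc n)) \<le> r0" for n
  proof (rule ccontr)
    assume "\<not> ?thesis"
    then have "ereal (en 0 - h) < ?\<Phi> (x (Suc n))" using r0 by simp
    then have 1: "en 0 - h < fv (Suc n) + (P (x (Suc n)) - G (x (Suc n)))" by (simp add: fs_x)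
    obtain w where w: "B *v w = b - A *v x (Suc n)" by (rule obtain_preimage)
    have "0 \<le> (\<rho> * lam - lH) / 4 * (norm (y (Suc n) - w))\<^sup>2" using gap by simp
    then show False using 1 up[OF w] by linarith
  qed
  obtain KA where KA: "0 < KA" "\<And>v. norm (A *v v) \<le> KA * norm v" by (rule matrix_norm_bound[of A]) blast
  define ry where "ry = (norm b + KA * r0) / sqrt lam + sqrt ((en 0 - h - M) / ((\<rho> * lam - lH) / 4))"
  have by': "norm (y (Suc n)) \<le> ry" for n
  proof -
    obtain w where w: "B *v w = b - A *v x (Suc n)" by (rule obtain_preimage)
    have "sqrt lam * norm w \<le> norm b + norm (A *v x (Suc n))"
      using norm_le_B[of w] norm_triangle_ineq4[of b "A *v x (Suc n)"] by (simp add: w)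
    also have "\<dots> \<le> norm b + KA * r0"
      using order_trans[OF KA(2) mult_left_mono[OF bx[of n], of KA]] KA(1) by simp
    finally have 1: "norm w \<le> (norm b + KA * r0) / sqrt lam" using lam(2) by (simp add: field_simps)
    have "M \<le> fv (Suc n) + (P (x (Suc n)) - G (x (Suc n)))"
      using M[of "x (Suc n)"] by (simp add: fs_x)
    then have "(\<rho> * lam - lH) / 4 * (norm (y (Suc n) - w))\<^sup>2 \<le> en 0 - h - M" using up[OF w] by linarith
    then have "(norm (y (Suc n) - w))\<^sup>2 \<le> (en 0 - h - M) / ((\<rho> * lam - lH) / 4)"
      using gap by (simp add: field_simps)
    then have "norm (y (Suc n) - w) \<le> sqrt ((en 0 - h - M) / ((\<rho> * lam - lH) / 4))" by (rule real_le_rsqrt)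
    then show ?thesis using 1 norm_triangle_ineq[of "y (Suc n) - w" w] by (simp add: ry_def)
  qed
  \<comment> \<open>The identity for \<open>z (Suc n)\<close> involves \<open>y n\<close>, so
    \<open>y 0\<close> has to be covered too.\<close>
  define rY where "rY = max ry (norm (y 0))"
  have bY: "norm (y n) \<le> rY" for n
    using by' by (cases n) (auto simp: rY_def le_max_iff_disj)
  define rz where "rz = (lH * rY + norm (grad H 0) + \<nu> * l\<psi> * (2 * rY)) / sqrt lam"
  have bz: "norm (z (Suc n)) \<le> rz" for n
  proof -
    have "sqrt lam * norm (z (Suc n)) \<le> norm (transpose B *v z (Suc n))"
      by (rule norm_le_transpose_B[OF z_in_range])
    also have "\<dots> \<le> norm (grad H (y (Suc n))) + norm (\<nu>s n *\<^sub>R (grad \<psi> (y (Suc n)) - grad \<psi> (y n)))"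
      unfolding transpose_B_z using norm_triangle_ineq4[of "- grad H (y (Suc n))"] by (simp only: norm_minus_cancel)
    also have "\<dots> \<le> (lH * rY + norm (grad H 0)) + \<nu> * l\<psi> * (2 * rY)"
    proof (rule add_mono)
      have "norm (grad H (y (Suc n))) \<le> norm (grad H (y (Suc n)) - grad H 0) + norm (grad H 0)"
        using norm_triangle_ineq[of "grad H (y (Suc n)) - grad H 0" "grad H 0"] by simp
      also have "norm (grad H (y (Suc n)) - grad H 0) \<le> lH * norm (y (Suc n))"
        using lipschitz_on_normD[OF H(2), of "y (Suc n)" 0] by simp
      also have "\<dots> \<le> lH * rY" using bY constants_nonneg by (intro mult_left_mono)
      finally show "norm (grad H (y (Suc n))) \<le> lH * rY + norm (grad H 0)" by simp
      have "norm (y (Suc n) - y n) \<le> 2 * rY"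
        using norm_triangle_ineq4[of "y (Suc n)" "y n"] bY[of n] bY[of "Suc n"] by simp
      then have "\<nu> * l\<psi> * norm (y (Suc n) - y n) \<le> \<nu> * l\<psi> * (2 * rY)"
        using \<nu>(1) constants_nonneg by (intro mult_left_mono) auto
      then show "norm (\<nu>s n *\<^sub>R (grad \<psi> (y (Suc n)) - grad \<psi> (y n))) \<le> \<nu> * l\<psi> * (2 * rY)"
        using \<psi>_term_bound[of n] by linarith
    qed
    finally show ?thesis using lam(2) by (simp add: rz_def field_simps)
  qed
  have "norm (x (Suc n), y (Suc n), z (Suc n)) \<le> r0 + (rY + rz)" for n
  proof -
    have "norm (x (Suc n), y (Suc n), z (Suc n)) \<le> norm (x (Suc n)) + (norm (y (Suc n)) + norm (z (Suc n)))"
      by (intro order_trans[OF norm_Pair_le] add_left_mono norm_Pair_le)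
    then show ?thesis using bx[of n] bY[of "Suc n"] bz[of n] by linarith
  qed
  then show ?thesis by (auto simp: bounded_iff)
qed

section \<open>Subgradients along the iterates\<close>

text \<open>\<open>\<tau> n\<close> is the gradient of \<open>T n\<close> at \<open>x (Suc n)\<close>.\<close>

definition \<tau> :: "nat \<Rightarrow> real^'d" where
  "\<tau> n = grad P (x n) - grad G (x n) + transpose A *v z n
     + (\<Sum>i=1..m. \<rho> *\<^sub>R block blk i (transpose A *v R (gs_point blk i (x (Suc n)) (x (Suc n)) (x n)) (y n)))
     + (\<Sum>i=1..m. \<mu>s n *\<^sub>R (gr\<phi> i (x (Suc n)) - gr\<phi> i (x n)))"

lemma \<mu>s_bounded: "\<exists>M>0. \<forall>n. \<mu>s n \<le> M"
proof -
  have "Limsup sequentially (\<lambda>n. ereal (\<mu>s n)) < ereal (\<mu>bar + 1)" using \<mu>(3) by simp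
  then have "\<forall>\<^sub>F n in sequentially. ereal (\<mu>s n) < ereal (\<mu>bar + 1)" by (rule Limsup_lessD)
  then obtain N where N: "\<And>n. N \<le> n \<Longrightarrow> \<mu>s n < \<mu>bar + 1" by (auto simp: eventually_sequentially)
  have "\<mu>s n \<le> Max (insert (\<mu>bar + 1) (\<mu>s ` {..<N}))" for n
    using N[of n] by (cases "n < N") (auto simp: Max_ge_iff intro: less_imp_le)
  then show ?thesis using \<mu>s_pos by (meson less_le_trans)
qed

text \<open>The penalty is quadratic and each \<open>\<phi> i\<close> has a Lipschitz gradient. As
  the \<open>\<mu>s n\<close> are bounded, one modulus serves all \<open>n\<close>, which later
  permits passing to the limit.\<close>

lemma T_quadratic_upper_bound:
  "\<exists>\<Lambda>>0. \<forall>n v. T n v - T n (x (Suc n)) \<le> \<tau> n \<bullet> (v - x (Suc n)) + \<Lambda> / 2 * (norm (v - x (Suc n)))\<^sup>2"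
proof -
  obtain M where M: "0 < M" "\<And>n. \<mu>s n \<le> M" using \<mu>s_bounded by blast
  obtain KA where KA: "0 < KA" "\<And>v. norm (A *v v) \<le> KA * norm v" by (rule matrix_norm_bound[of A]) blast
  define \<Lambda> where "\<Lambda> = \<rho> * KA\<^sup>2 + M * l\<phi>"
  have \<Lambda>: "0 < \<Lambda>" using \<rho>_pos KA M l\<phi>_nonneg by (simp add: \<Lambda>_def add_pos_nonneg)
  have "T n v - T n (x (Suc n)) \<le> \<tau> n \<bullet> (v - x (Suc n)) + \<Lambda> / 2 * (norm (v - x (Suc n)))\<^sup>2" for n v
  proof -
    define d where "d = v - x (Suc n)"
    let ?r = "\<lambda>i. R (gs_point blk i (x (Suc n)) (x (Suc n)) (x n)) (y n)"
    have "s n i v - s n i (x (Suc n)) \<le> (grad P (x n) - grad G (x n) + transpose A *v z n) \<bullet> block blk i d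
        + (\<rho> *\<^sub>R block blk i (transpose A *v ?r i)) \<bullet> d + (\<mu>s n *\<^sub>R (gr\<phi> i (x (Suc n)) - gr\<phi> i (x n))) \<bullet> d
        + \<Lambda> / 2 * (norm (block blk i d))\<^sup>2" if i: "i \<in> {1..m}" for i
    proof -
      let ?d = "block blk i d"
      have dd: "block blk i v - block blk i (x (Suc n)) = ?d" by (simp add: d_def block_diff)
      have "R (gs_point blk i (x (Suc n)) v (x n)) (y n) = ?r i + A *v ?d"
        using gs_point_diff[of blk i "x (Suc n)" v "x n" "x (Suc n)"]
        by (simp add: d_def matrix_vector_right_distrib)
      then have "(norm (R (gs_point blk i (x (Suc n)) v (x n)) (y n)))\<^sup>2 =
          (norm (?r i))\<^sup>2 + 2 * (?r i \<bullet> (A *v ?d)) + (norm (A *v ?d))\<^sup>2"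
        by (simp only: power2_norm_add)
      moreover have "(norm (A *v ?d))\<^sup>2 \<le> KA\<^sup>2 * (norm ?d)\<^sup>2"
        using power_mono[OF KA(2)[of ?d], of 2] by (simp add: power_mult_distrib)
      ultimately have "\<rho> / 2 * (norm (R (gs_point blk i (x (Suc n)) v (x n)) (y n)))\<^sup>2 \<le>
          \<rho> / 2 * ((norm (?r i))\<^sup>2 + 2 * (?r i \<bullet> (A *v ?d)) + KA\<^sup>2 * (norm ?d)\<^sup>2)"
        using \<rho>_pos by simp
      also have "\<dots> = \<rho> / 2 * (norm (?r i))\<^sup>2 + (\<rho> *\<^sub>R block blk i (transpose A *v ?r i)) \<bullet> d
          + \<rho> * KA\<^sup>2 / 2 * (norm ?d)\<^sup>2"
        by (simp add: distrib_left inner_matrix_transpose block_inner)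
      finally have q: "\<rho> / 2 * (norm (R (gs_point blk i (x (Suc n)) v (x n)) (y n)))\<^sup>2 \<le>
          \<rho> / 2 * (norm (?r i))\<^sup>2 + (\<rho> *\<^sub>R block blk i (transpose A *v ?r i)) \<bullet> d + \<rho> * KA\<^sup>2 / 2 * (norm ?d)\<^sup>2" .
      let ?D = "\<lambda>u. bregman (block_space blk i) (\<phi> i) (block blk i u) (block blk i (x n))"
      have "\<phi> i (block blk i v) \<le> \<phi> i (block blk i (x (Suc n))) + gr\<phi> i (x (Suc n)) \<bullet> ?d + l\<phi> / 2 * (norm ?d)\<^sup>2"
        unfolding dd[symmetric]
        by (rule lipschitz_gradient_upper_bound[OF subspace_block_space block_in_block_space block_in_block_space])
          (use \<phi>[OF i] gr\<phi>_derivative[OF i] in auto)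
      then have "?D v - ?D (x (Suc n)) \<le> (gr\<phi> i (x (Suc n)) - gr\<phi> i (x n)) \<bullet> ?d + l\<phi> / 2 * (norm ?d)\<^sup>2"
        by (simp add: bregman_def dd[symmetric] inner_diff_left inner_diff_right)
      also have "(gr\<phi> i (x (Suc n)) - gr\<phi> i (x n)) \<bullet> ?d = (gr\<phi> i (x (Suc n)) - gr\<phi> i (x n)) \<bullet> d"
        using gr\<phi>_in[OF i] by (intro inner_block_space subspace_diff subspace_block_space)
      finally have "\<mu>s n * (?D v - ?D (x (Suc n))) \<le> \<mu>s n * ((gr\<phi> i (x (Suc n)) - gr\<phi> i (x n)) \<bullet> d + l\<phi> / 2 * (norm ?d)\<^sup>2)"
        using \<mu>s_pos[of n] by (intro mult_left_mono) auto
      also have "\<dots> \<le> (\<mu>s n *\<^sub>R (gr\<phi> i (x (Suc n)) - gr\<phi> i (x n))) \<bullet> d + M * l\<phi> / 2 * (norm ?d)\<^sup>2"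
      proof -
        have "\<mu>s n * (l\<phi> / 2 * (norm ?d)\<^sup>2) \<le> M * (l\<phi> / 2 * (norm ?d)\<^sup>2)"
          using M(2)[of n] l\<phi>_nonneg by (intro mult_right_mono) auto
        then show ?thesis by (simp add: distrib_left)
      qed
      finally have p: "\<mu>s n * ?D v - \<mu>s n * ?D (x (Suc n)) \<le>
          (\<mu>s n *\<^sub>R (gr\<phi> i (x (Suc n)) - gr\<phi> i (x n))) \<bullet> d + M * l\<phi> / 2 * (norm ?d)\<^sup>2"
        by (simp add: right_diff_distrib)
      have lin: "(grad P (x n) - g n) \<bullet> block blk i v + z n \<bullet> (A *v block blk i v)
          - ((grad P (x n) - g n) \<bullet> block blk i (x (Suc n)) + z n \<bullet> (A *v block blk i (x (Suc n))))
          = (grad P (x n) - grad G (x n) + transpose A *v z n) \<bullet> ?d"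
        by (simp add: g_eq dd[symmetric] inner_matrix_transpose inner_add_left inner_diff_right algebra_simps)
      have "\<Lambda> / 2 * (norm ?d)\<^sup>2 = \<rho> * KA\<^sup>2 / 2 * (norm ?d)\<^sup>2 + M * l\<phi> / 2 * (norm ?d)\<^sup>2"
        by (simp add: \<Lambda>_def add_divide_distrib distrib_right)
      then show ?thesis using q p lin unfolding s_def by linarith
    qed
    then have "(\<Sum>i=1..m. s n i v - s n i (x (Suc n))) \<le> (\<Sum>i=1..m.
        (grad P (x n) - grad G (x n) + transpose A *v z n) \<bullet> block blk i d
        + (\<rho> *\<^sub>R block blk i (transpose A *v ?r i)) \<bullet> d + (\<mu>s n *\<^sub>R (gr\<phi> i (x (Suc n)) - gr\<phi> i (x n))) \<bullet> d
        + \<Lambda> / 2 * (norm (block blk i d))\<^sup>2)"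
      by (rule sum_mono)
    also have "\<dots> = \<tau> n \<bullet> d + \<Lambda> / 2 * (norm d)\<^sup>2"
      by (simp only: sum.distrib inner_sum_right[symmetric] inner_sum_left[symmetric] sum_block[OF blocks]
          sum_distrib_left[symmetric] sum_norm_block[OF blocks] \<tau>_def inner_add_left)
    finally show ?thesis by (simp only: sum_subtractf T_def d_def)
  qed
  then show ?thesis using \<Lambda> by blast
qed

text \<open>\<open>- \<tau> n\<close> is a proximal subgradient of the separable part at \<open>x (Suc n)\<close>, with uniform modulus.\<close>

lemma fs_proximal:
  "\<exists>\<Lambda>>0. \<forall>n v. ereal (fv (Suc n) - \<tau> n \<bullet> (v - x (Suc n)) - \<Lambda> / 2 * (norm (v - x (Suc n)))\<^sup>2) \<le> fs v"
proof -
  obtain \<Lambda> where \<Lambda>: "0 < \<Lambda>" "\<And>n v. T n v - T n (x (Suc n)) \<le> \<tau> n \<bullet> (v - x (Suc n)) + \<Lambda> / 2 * (norm (v - x (Suc n)))\<^sup>2"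
    using T_quadratic_upper_bound by blast
  have "ereal (fv (Suc n) - \<tau> n \<bullet> (v - x (Suc n)) - \<Lambda> / 2 * (norm (v - x (Suc n)))\<^sup>2) \<le> fs v" for n v
    using x_minimizes[of n v] \<Lambda>(2)[of n v] fs_not_MInfty[of v] by (cases "fs v") (auto simp: fs_x)
  then show ?thesis using \<Lambda>(1) by blast
qed

text \<open>The \<open>x\<close>-gradient of \<open>S\<close> at the new iterate plus the proximal
  subgradient \<open>- \<tau> n\<close> of \<open>fs\<close>.\<close>

definition \<xi> :: "nat \<Rightarrow> real^'d" where
  "\<xi> n = grad P (x (Suc n)) - grad G (x (Suc n)) + transpose A *v z (Suc n)
     + \<rho> *\<^sub>R (transpose A *v R (x (Suc n)) (y (Suc n))) - \<tau> n"

definition \<omega> :: "nat \<Rightarrow> real^'q" where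
  "\<omega> n = grad H (y (Suc n)) + transpose B *v z (Suc n) + \<rho> *\<^sub>R (transpose B *v R (x (Suc n)) (y (Suc n)))"

lemma S_derivative:
  "((\<lambda>(u, w, q). S u w q) has_derivative
    (\<lambda>h. (grad P u - grad G u + transpose A *v q + \<rho> *\<^sub>R (transpose A *v R u w),
          grad H w + transpose B *v q + \<rho> *\<^sub>R (transpose B *v R u w), R u w) \<bullet> h)) (at (u, w, q))"
proof -
  let ?p = "(u, w, q)"
  let ?u = "\<lambda>p::(real^'d) \<times> (real^'q) \<times> (real^'p). fst p" and ?w = "\<lambda>p::(real^'d) \<times> (real^'q) \<times> (real^'p). fst (snd p)"
    and ?q = "\<lambda>p::(real^'d) \<times> (real^'q) \<times> (real^'p). snd (snd p)"
  have du: "(?u has_derivative ?u) (at ?p)" and dw: "(?w has_derivative ?w) (at ?p)"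
    and dq: "(?q has_derivative ?q) (at ?p)"
    by (intro has_derivative_fst has_derivative_snd has_derivative_ident)+
  have dP: "((\<lambda>p. P (?u p)) has_derivative (\<lambda>h. grad P u \<bullet> ?u h)) (at ?p)"
    using has_derivative_compose[OF du, of P "\<lambda>h. grad P u \<bullet> h"] grad_P by simp
  have dG: "((\<lambda>p. G (?u p)) has_derivative (\<lambda>h. grad G u \<bullet> ?u h)) (at ?p)"
    using has_derivative_compose[OF du, of G "\<lambda>h. grad G u \<bullet> h"] grad_G by simp
  have dH: "((\<lambda>p. H (?w p)) has_derivative (\<lambda>h. grad H w \<bullet> ?w h)) (at ?p)"
    using has_derivative_compose[OF dw, of H "\<lambda>h. grad H w \<bullet> h"] grad_H by simp
  have dR: "((\<lambda>p. R (?u p) (?w p)) has_derivative (\<lambda>h. A *v ?u h + B *v ?w h - 0)) (at ?p)"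
    by (intro has_derivative_diff has_derivative_add has_derivative_const du dw
        bounded_linear.has_derivative[OF matrix_vector_mul_bounded_linear])
  have "((\<lambda>p. H (?w p) + P (?u p) - G (?u p) + ?q p \<bullet> R (?u p) (?w p)
        + \<rho> / 2 * (R (?u p) (?w p) \<bullet> R (?u p) (?w p))) has_derivative
      (\<lambda>h. grad H w \<bullet> ?w h + grad P u \<bullet> ?u h - grad G u \<bullet> ?u h
        + (?q ?p \<bullet> (A *v ?u h + B *v ?w h - 0) + ?q h \<bullet> R (?u ?p) (?w ?p))
        + \<rho> / 2 * (R (?u ?p) (?w ?p) \<bullet> (A *v ?u h + B *v ?w h - 0) + (A *v ?u h + B *v ?w h - 0) \<bullet> R (?u ?p) (?w ?p)))) (at ?p)"
    by (intro has_derivative_add has_derivative_diff has_derivative_mult_right has_derivative_inner dP dG dH dR dq)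
  moreover have "grad H w \<bullet> ?w h + grad P u \<bullet> ?u h - grad G u \<bullet> ?u h
        + (?q ?p \<bullet> (A *v ?u h + B *v ?w h - 0) + ?q h \<bullet> R (?u ?p) (?w ?p))
        + \<rho> / 2 * (R (?u ?p) (?w ?p) \<bullet> (A *v ?u h + B *v ?w h - 0) + (A *v ?u h + B *v ?w h - 0) \<bullet> R (?u ?p) (?w ?p))
      = (grad P u - grad G u + transpose A *v q + \<rho> *\<^sub>R (transpose A *v R u w),
          grad H w + transpose B *v q + \<rho> *\<^sub>R (transpose B *v R u w), R u w) \<bullet> h" for h
  proof -
    obtain h1 h2 h3 where h: "h = (h1, h2, h3)" by (cases h)
    define r where "r = R u w"
    have "(A *v h1 + B *v h2) \<bullet> r = r \<bullet> (A *v h1 + B *v h2)" "h3 \<bullet> r = r \<bullet> h3" by (auto simp: inner_commute)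
    then show ?thesis
      by (simp add: h r_def[symmetric] inner_add_right inner_add_left inner_diff_left inner_matrix_transpose algebra_simps)
  qed
  ultimately show ?thesis by (simp add: S_def case_prod_unfold power2_norm_eq_inner)
qed

text \<open>The quadratic correction has zero gradient at the base point, so only
  \<open>- \<tau> n\<close> and the gradient of \<open>S\<close> survive.\<close>

lemma minorant_derivative:
  "((\<lambda>(u, w, q). fv (Suc n) - \<tau> n \<bullet> (u - x (Suc n)) - \<Lambda> / 2 * (norm (u - x (Suc n)))\<^sup>2 + S u w q)
    has_derivative (\<lambda>h. (\<xi> n, \<omega> n, R (x (Suc n)) (y (Suc n))) \<bullet> h)) (at (x (Suc n), y (Suc n), z (Suc n)))"
proof -
  let ?p = "(x (Suc n), y (Suc n), z (Suc n))"
  let ?u = "\<lambda>p::(real^'d) \<times> (real^'q) \<times> (real^'p). fst p - x (Suc n)"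
  have du: "(?u has_derivative (\<lambda>h. fst h - 0)) (at ?p)"
    by (intro has_derivative_diff has_derivative_fst has_derivative_ident has_derivative_const)
  have "((\<lambda>p. fv (Suc n) - \<tau> n \<bullet> ?u p - \<Lambda> / 2 * (?u p \<bullet> ?u p) + (case p of (u, w, q) \<Rightarrow> S u w q)) has_derivative
      (\<lambda>h. 0 - \<tau> n \<bullet> (fst h - 0) - \<Lambda> / 2 * (?u ?p \<bullet> (fst h - 0) + (fst h - 0) \<bullet> ?u ?p)
        + (grad P (x (Suc n)) - grad G (x (Suc n)) + transpose A *v z (Suc n) + \<rho> *\<^sub>R (transpose A *v R (x (Suc n)) (y (Suc n))),
          \<omega> n, R (x (Suc n)) (y (Suc n))) \<bullet> h)) (at ?p)"
    unfolding \<omega>_def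
    by (intro has_derivative_add has_derivative_diff has_derivative_const has_derivative_mult_right
        has_derivative_inner has_derivative_inner_right du S_derivative)
  moreover have "0 - \<tau> n \<bullet> (fst h - 0) - \<Lambda> / 2 * (?u ?p \<bullet> (fst h - 0) + (fst h - 0) \<bullet> ?u ?p)
        + (grad P (x (Suc n)) - grad G (x (Suc n)) + transpose A *v z (Suc n) + \<rho> *\<^sub>R (transpose A *v R (x (Suc n)) (y (Suc n))),
          \<omega> n, R (x (Suc n)) (y (Suc n))) \<bullet> h = (\<xi> n, \<omega> n, R (x (Suc n)) (y (Suc n))) \<bullet> h" for h
    by (cases h) (simp add: \<xi>_def inner_diff_left)
  ultimately show ?thesis by (simp add: case_prod_unfold power2_norm_eq_inner)
qed

lemma subgradient_lagrangian:
  "(\<xi> n, \<omega> n, R (x (Suc n)) (y (Suc n)))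
    \<in> regular_subdiff \<L> (x (Suc n), y (Suc n), z (Suc n))"
proof -
  obtain \<Lambda> where \<Lambda>: "\<And>n v. ereal (fv (Suc n) - \<tau> n \<bullet> (v - x (Suc n)) - \<Lambda> / 2 * (norm (v - x (Suc n)))\<^sup>2) \<le> fs v"
    using fs_proximal by blast
  show ?thesis
  proof (rule regular_subdiffI_smooth_minorant[OF minorant_derivative[of n \<Lambda>]])
    fix p :: "(real^'d) \<times> (real^'q) \<times> (real^'p)"
    obtain u w q where p: "p = (u, w, q)" by (cases p)
    show "ereal (case p of (u, w, q) \<Rightarrow> fv (Suc n) - \<tau> n \<bullet> (u - x (Suc n)) - \<Lambda> / 2 * (norm (u - x (Suc n)))\<^sup>2 + S u w q)
        \<le> \<L> p"
      using add_right_mono[OF \<Lambda>[of n u], of "ereal (S u w q)"] by (simp add: p aug_lagrangian_eq)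
  qed (simp add: aug_lagrangian_eq fs_x)
qed

text \<open>Compared with the subgradient of the Lagrangian, the term
  \<open>c * (norm (y - t))\<^sup>2\<close> contributes opposite vectors to the second and fourth
  components.\<close>

definition W :: "nat \<Rightarrow> (real^'d) \<times> (real^'q) \<times> (real^'p) \<times> (real^'q)" where
  "W n = (\<xi> n, \<omega> n + (2 * c) *\<^sub>R (y (Suc n) - y n), R (x (Suc n)) (y (Suc n)), - ((2 * c) *\<^sub>R (y (Suc n) - y n)))"

lemma subgradient_reg:
  "W n \<in> regular_subdiff \<F> (x (Suc n), y (Suc n), z (Suc n), y n)"
proof -
  obtain \<Lambda> where \<Lambda>: "\<And>n v. ereal (fv (Suc n) - \<tau> n \<bullet> (v - x (Suc n)) - \<Lambda> / 2 * (norm (v - x (Suc n)))\<^sup>2) \<le> fs v"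
    using fs_proximal by blast
  let ?s = "\<lambda>(u, w, q). fv (Suc n) - \<tau> n \<bullet> (u - x (Suc n)) - \<Lambda> / 2 * (norm (u - x (Suc n)))\<^sup>2 + S u w q"
  let ?pr = "\<lambda>p::(real^'d) \<times> (real^'q) \<times> (real^'p) \<times> (real^'q). (fst p, fst (snd p), fst (snd (snd p)))"
  let ?d = "\<lambda>p::(real^'d) \<times> (real^'q) \<times> (real^'p) \<times> (real^'q). fst (snd p) - snd (snd (snd p))"
  let ?p = "(x (Suc n), y (Suc n), z (Suc n), y n)"
  have dpr: "(?pr has_derivative ?pr) (at ?p)" and dd: "(?d has_derivative ?d) (at ?p)"
    by (intro has_derivative_Pair has_derivative_diff has_derivative_fst has_derivative_snd has_derivative_ident)+
  have "((\<lambda>p. ?s (?pr p)) has_derivative (\<lambda>h. (\<xi> n, \<omega> n, R (x (Suc n)) (y (Suc n))) \<bullet> ?pr h)) (at ?p)"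
    by (rule has_derivative_compose[OF dpr]) (use minorant_derivative[of n \<Lambda>] in simp)
  then have "((\<lambda>p. ?s (?pr p) + c * (?d p \<bullet> ?d p)) has_derivative
      (\<lambda>h. (\<xi> n, \<omega> n, R (x (Suc n)) (y (Suc n))) \<bullet> ?pr h + c * (?d ?p \<bullet> ?d h + ?d h \<bullet> ?d ?p))) (at ?p)"
    by (intro has_derivative_add has_derivative_mult_right has_derivative_inner dd)
  moreover have "(\<xi> n, \<omega> n, R (x (Suc n)) (y (Suc n))) \<bullet> ?pr h + c * (?d ?p \<bullet> ?d h + ?d h \<bullet> ?d ?p) = W n \<bullet> h" for h
  proof -
    obtain h1 h2 h3 h4 where h: "h = (h1, h2, h3, h4)" by (cases h)
    define e where "e = y (Suc n) - y n"
    have "h2 \<bullet> e = e \<bullet> h2" "h4 \<bullet> e = e \<bullet> h4" by (rule inner_commute)+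
    then show ?thesis
      by (simp add: h W_def e_def[symmetric] inner_add_left inner_diff_right inner_diff_left algebra_simps)
  qed
  ultimately have der: "((\<lambda>p. ?s (?pr p) + c * (?d p \<bullet> ?d p)) has_derivative (\<lambda>h. W n \<bullet> h)) (at ?p)" by simp
  show ?thesis
  proof (rule regular_subdiffI_smooth_minorant[OF der])
    fix p :: "(real^'d) \<times> (real^'q) \<times> (real^'p) \<times> (real^'q)"
    obtain u w q t where p: "p = (u, w, q, t)" by (cases p)
    show "ereal (?s (?pr p) + c * (?d p \<bullet> ?d p)) \<le> \<F> p"
      using add_right_mono[OF \<Lambda>[of n u], of "ereal (S u w q + c * (norm (w - t))\<^sup>2)"]
      by (simp add: p aug_lagrangian_reg_eq power2_norm_eq_inner add.assoc)
  qed (simp add: aug_lagrangian_reg_eq fs_x power2_norm_eq_inner)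
qed

lemma D_bounds: "norm (x (Suc n) - x n) \<le> D n" "norm (y (Suc n) - y n) \<le> D n" "0 \<le> D n"
  unfolding D_def by (auto intro: norm_fst_le norm_snd_le)

lemma z_step_bound: "\<exists>C>0. \<forall>n. norm (z (Suc (Suc n)) - z (Suc n)) \<le> C * (D (Suc n) + D n)"
proof (intro exI conjI allI)
  define C where "C = (K + 1) / sqrt lam"
  show "0 < C" using K_ge lam(2) by (simp add: C_def)
  fix n
  have "sqrt lam * norm (z (Suc (Suc n)) - z (Suc n))
      \<le> (lH + \<nu> * l\<psi>) * norm (y (Suc (Suc n)) - y (Suc n)) + \<nu> * l\<psi> * norm (y (Suc n) - y n)"
    by (rule z_step)
  also have "\<dots> \<le> (K + 1) * D (Suc n) + (K + 1) * D n"
    by (rule add_mono; rule mult_mono)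
      (use D_bounds constants_nonneg mult_nonneg_nonneg[OF \<nu>(1) constants_nonneg(4)] in \<open>auto simp: K_def\<close>)
  finally show "norm (z (Suc (Suc n)) - z (Suc n)) \<le> C * (D (Suc n) + D n)"
    using lam(2) by (simp add: C_def field_simps)
qed

text \<open>Each summand of \<open>\<xi> n\<close> is a difference of one expression at new and old
  arguments: the gradients of \<open>P\<close> and \<open>G\<close>, the multiplier, the penalty at
  Gauss-Seidel points, and the gradients of the \<open>\<phi> i\<close>. Lipschitz continuity bounds
  all of them.\<close>

lemma \<xi>_bound: "\<exists>C>0. \<forall>n. norm (\<xi> n) \<le> C * (D n + norm (z (Suc n) - z n))"
proof -
  obtain M where M: "0 < M" "\<And>n. \<mu>s n \<le> M" using \<mu>s_bounded by blast
  obtain KA where KA: "0 < KA" "\<And>v. norm (A *v v) \<le> KA * norm v" by (rule matrix_norm_bound[of A]) blast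
  obtain KB where KB: "0 < KB" "\<And>v. norm (B *v v) \<le> KB * norm v" by (rule matrix_norm_bound[of B]) blast
  obtain KT where KT: "0 < KT" "\<And>v. norm (transpose A *v v) \<le> KT * norm v" by (rule matrix_norm_bound[of "transpose A"]) blast
  define C1 where "C1 = lP + lG + real m * (\<rho> * (KT * (KA + KB))) + real m * (M * l\<phi>)"
  have C1: "0 \<le> C1" using constants_nonneg l\<phi>_nonneg \<rho>_pos KA(1) KB(1) KT(1) M(1) by (simp add: C1_def)
  have "norm (\<xi> n) \<le> (C1 + KT) * (D n + norm (z (Suc n) - z n))" for n
  proof -
    define x' y' where "x' = x (Suc n)" and "y' = y (Suc n)"
    let ?gs = "\<lambda>i. gs_point blk i x' x' (x n)"
    let ?a = "\<lambda>i. \<rho> *\<^sub>R block blk i (transpose A *v (R x' y' - R (?gs i) (y n)))"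
    let ?b = "\<lambda>i. \<mu>s n *\<^sub>R (gr\<phi> i x' - gr\<phi> i (x n))"
    \<comment> \<open>The full penalty gradient is cut into blocks so that it can be paired with the
      blockwise penalty gradients in \<open>\<tau> n\<close>.\<close>
    have "\<rho> *\<^sub>R (transpose A *v R x' y') = (\<Sum>i=1..m. \<rho> *\<^sub>R block blk i (transpose A *v R x' y'))"
      by (simp only: scaleR_sum_right[symmetric] sum_block[OF blocks])
    moreover have "(\<Sum>i=1..m. ?a i) = (\<Sum>i=1..m. \<rho> *\<^sub>R block blk i (transpose A *v R x' y'))
        - (\<Sum>i=1..m. \<rho> *\<^sub>R block blk i (transpose A *v R (?gs i) (y n)))"
      by (simp only: matrix_vector_mult_diff_distrib block_diff scaleR_diff_right sum_subtractf)
    ultimately have "\<xi> n = (grad P x' - grad P (x n)) - (grad G x' - grad G (x n)) + transpose A *v (z (Suc n) - z n)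
        + (\<Sum>i=1..m. ?a i) - (\<Sum>i=1..m. ?b i)"
      unfolding \<xi>_def \<tau>_def x'_def[symmetric] y'_def[symmetric] by (simp add: matrix_vector_mult_diff_distrib)
    then have "norm (\<xi> n) \<le> norm (grad P x' - grad P (x n)) + norm (grad G x' - grad G (x n))
        + norm (transpose A *v (z (Suc n) - z n)) + norm (\<Sum>i=1..m. ?a i) + norm (\<Sum>i=1..m. ?b i)"
      by (simp only:) (intro order_trans[OF norm_triangle_ineq4] add_right_mono
          order_trans[OF norm_triangle_ineq] norm_triangle_ineq4)
    moreover have "norm (grad P x' - grad P (x n)) \<le> lP * D n"
      using lipschitz_on_normD[OF P(2), of x' "x n"] mult_left_mono[OF D_bounds(1)[of n] constants_nonneg(2)]
      by (simp add: x'_def)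
    moreover have "norm (grad G x' - grad G (x n)) \<le> lG * D n"
      using lipschitz_on_normD[OF G(4), of x' "x n"] mult_left_mono[OF D_bounds(1)[of n] constants_nonneg(3)]
      by (simp add: x'_def)
    moreover have "norm (transpose A *v (z (Suc n) - z n)) \<le> KT * norm (z (Suc n) - z n)" by (rule KT(2))
    moreover have "norm (\<Sum>i=1..m. ?a i) \<le> real m * (\<rho> * (KT * (KA + KB)) * D n)"
    proof -
      have "norm (?a i) \<le> \<rho> * (KT * (KA + KB)) * D n" for i
      proof -
        have "norm (R x' y' - R (?gs i) (y n)) = norm (A *v (x' - ?gs i) + B *v (y' - y n))"
          by (simp add: matrix_vector_mult_diff_distrib algebra_simps)
        also have "\<dots> \<le> KA * norm (x' - ?gs i) + KB * norm (y' - y n)"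
          by (intro norm_triangle_le add_mono KA(2) KB(2))
        also have "\<dots> \<le> KA * D n + KB * D n"
          using norm_gs_point_diff_le[of x' blk i "x n"] D_bounds(1,2)[of n] KA(1) KB(1)
          by (intro add_mono mult_left_mono) (auto simp: x'_def y'_def)
        finally have 1: "norm (R x' y' - R (?gs i) (y n)) \<le> (KA + KB) * D n" by (simp add: distrib_right)
        have "norm (?a i) = \<rho> * norm (block blk i (transpose A *v (R x' y' - R (?gs i) (y n))))"
          using \<rho>_pos by simp
        also have "\<dots> \<le> \<rho> * (KT * norm (R x' y' - R (?gs i) (y n)))"
          using \<rho>_pos by (intro mult_left_mono order_trans[OF norm_block_le] KT(2)) auto
        also have "\<dots> \<le> \<rho> * (KT * ((KA + KB) * D n))"
          using \<rho>_pos KT(1) 1 by (intro mult_left_mono) auto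
        finally show ?thesis by (simp add: mult.assoc)
      qed
      then have "norm (\<Sum>i=1..m. ?a i) \<le> (\<Sum>i=1..m. \<rho> * (KT * (KA + KB)) * D n)"
        by (intro sum_norm_le)
      then show ?thesis by simp
    qed
    moreover have "norm (\<Sum>i=1..m. ?b i) \<le> real m * (M * l\<phi> * D n)"
    proof -
      have "norm (?b i) \<le> M * l\<phi> * D n" if i: "i \<in> {1..m}" for i
      proof -
        have "norm (gr\<phi> i x' - gr\<phi> i (x n)) \<le> l\<phi> * norm (block blk i x' - block blk i (x n))"
          using \<phi>[OF i] lipschitz_on_normD block_in_block_space by metis
        also have "\<dots> \<le> l\<phi> * D n"
          using l\<phi>_nonneg norm_block_le[of blk i "x' - x n"] D_bounds(1)[of n]
          by (intro mult_left_mono) (auto simp: x'_def block_diff)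
        finally have "\<mu>s n * norm (gr\<phi> i x' - gr\<phi> i (x n)) \<le> M * (l\<phi> * D n)"
          using M \<mu>s_pos[of n] by (intro mult_mono) auto
        then show ?thesis using \<mu>s_pos[of n] by simp
      qed
      then have "norm (\<Sum>i=1..m. ?b i) \<le> (\<Sum>i=1..m. M * l\<phi> * D n)"
        by (intro sum_norm_le)
      then show ?thesis by simp
    qed
    ultimately have "norm (\<xi> n) \<le> C1 * D n + KT * norm (z (Suc n) - z n)"
      by (simp add: C1_def algebra_simps)
    also have "\<dots> \<le> (C1 + KT) * D n + (C1 + KT) * norm (z (Suc n) - z n)"
      using C1 KT(1) D_bounds(3) by (intro add_mono mult_right_mono) auto
    finally show ?thesis by (simp add: distrib_left)
  qed
  then show ?thesis using C1 KT(1) by (intro exI[of _ "C1 + KT"]) auto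
qed

lemma \<rho>_R: "\<rho> *\<^sub>R R (x (Suc n)) (y (Suc n)) = z (Suc n) - z n"
  by (simp add: z_Suc)

text \<open>Everything is bounded by \<open>D n\<close> and the multiplier increment. Replacing the
  latter by primal steps needs two of them, so the estimate begins with
  \<open>W (Suc n)\<close>.\<close>

lemma W_bound: "\<exists>C>0. \<forall>n. norm (W (Suc n)) \<le> C * (D (Suc n) + D n)"
proof -
  obtain C1 where C1: "0 < C1" "\<And>n. norm (\<xi> n) \<le> C1 * (D n + norm (z (Suc n) - z n))" using \<xi>_bound by blast
  obtain Cz where Cz: "0 < Cz" "\<And>n. norm (z (Suc (Suc n)) - z (Suc n)) \<le> Cz * (D (Suc n) + D n)"
    using z_step_bound by blast
  obtain KT where KT: "0 < KT" "\<And>v. norm (transpose B *v v) \<le> KT * norm v" by (rule matrix_norm_bound[of "transpose B"]) blast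
  define C2 where "C2 = C1 + \<nu> * l\<psi> + KT + 4 * c + 1 / \<rho>"
  have C2: "0 < C2" using C1(1) KT(1) c_nonneg \<nu>(1) constants_nonneg \<rho>_pos
    by (simp add: C2_def add_pos_nonneg)
  have W: "norm (W n) \<le> C2 * (D n + norm (z (Suc n) - z n))" for n
  proof -
    define e q where "e = y (Suc n) - y n" and "q = norm (z (Suc n) - z n)"
    have e: "norm e \<le> D n" using D_bounds by (simp add: e_def)
    \<comment> \<open>The gradient of \<open>H\<close> cancels by \<open>transpose_B_z\<close>, and
      the penalty term is the multiplier increment.\<close>
    have "\<omega> n = - (\<nu>s n *\<^sub>R (grad \<psi> (y (Suc n)) - grad \<psi> (y n))) + transpose B *v (z (Suc n) - z n)"
      by (simp add: \<omega>_def transpose_B_z \<rho>_R[symmetric] matrix_vector_mult_scaleR)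
    then have "norm (\<omega> n) \<le> norm (\<nu>s n *\<^sub>R (grad \<psi> (y (Suc n)) - grad \<psi> (y n))) + norm (transpose B *v (z (Suc n) - z n))"
      using norm_triangle_ineq[of "- (\<nu>s n *\<^sub>R (grad \<psi> (y (Suc n)) - grad \<psi> (y n)))"] by (simp only: norm_minus_cancel)
    also have "\<dots> \<le> \<nu> * l\<psi> * D n + KT * q"
      using \<psi>_term_bound[of n] mult_left_mono[OF D_bounds(2)[of n], of "\<nu> * l\<psi>"] \<nu>(1) constants_nonneg KT(2)
      by (intro add_mono) (auto simp: q_def)
    finally have 1: "norm (\<omega> n) \<le> \<nu> * l\<psi> * D n + KT * q" .
    have "R (x (Suc n)) (y (Suc n)) = (1 / \<rho>) *\<^sub>R (z (Suc n) - z n)"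
      using \<rho>_pos by (simp add: \<rho>_R[symmetric])
    then have 2: "norm (R (x (Suc n)) (y (Suc n))) = 1 / \<rho> * q" using \<rho>_pos by (simp add: q_def)
    have 3: "norm ((2 * c) *\<^sub>R e) \<le> 2 * c * D n" using e c_nonneg by (simp add: mult_left_mono)
    have "norm (W n) \<le> norm (\<xi> n) + (norm (\<omega> n + (2 * c) *\<^sub>R e) + (norm (R (x (Suc n)) (y (Suc n))) + norm (- ((2 * c) *\<^sub>R e))))"
      unfolding W_def e_def by (intro order_trans[OF norm_Pair_le] add_left_mono norm_Pair_le)
    also have "norm (\<omega> n + (2 * c) *\<^sub>R e) \<le> norm (\<omega> n) + norm ((2 * c) *\<^sub>R e)" by (rule norm_triangle_ineq)
    finally have "norm (W n) \<le> norm (\<xi> n) + norm (\<omega> n) + 2 * norm ((2 * c) *\<^sub>R e) + 1 / \<rho> * q"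
      unfolding 2 norm_minus_cancel by linarith
    also have "\<dots> \<le> C1 * (D n + q) + (\<nu> * l\<psi> * D n + KT * q) + 2 * (2 * c * D n) + 1 / \<rho> * q"
      using C1(2)[of n] 1 3 by (simp add: q_def)
    also have "\<dots> = (C1 + \<nu> * l\<psi> + 4 * c) * D n + (C1 + KT + 1 / \<rho>) * q" by (simp add: algebra_simps)
    also have "\<dots> \<le> C2 * D n + C2 * q"
      using KT(1) \<rho>_pos c_nonneg \<nu>(1) constants_nonneg D_bounds(3)[of n]
      by (intro add_mono mult_right_mono) (auto simp: C2_def q_def)
    finally show ?thesis by (simp add: q_def distrib_left)
  qed
  have "norm (W (Suc n)) \<le> (C2 * (1 + Cz)) * (D (Suc n) + D n)" for n
  proof -
    have "norm (W (Suc n)) \<le> C2 * (D (Suc n) + norm (z (Suc (Suc n)) - z (Suc n)))" by (rule W)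
    also have "\<dots> \<le> C2 * ((D (Suc n) + D n) + Cz * (D (Suc n) + D n))"
      using C2 Cz(2)[of n] D_bounds(3)[of n] by (intro mult_left_mono add_mono) auto
    finally show ?thesis by (simp add: algebra_simps)
  qed
  then show ?thesis using C2 Cz(1) by (intro exI[of _ "C2 * (1 + Cz)"]) auto
qed

section \<open>Vanishing steps and subgradients\<close>

lemma D_lim:
  assumes "en \<longlonglongrightarrow> es" shows "D \<longlonglongrightarrow> 0"
proof -
  have "(\<lambda>n. sqrt ((en n - en (Suc n)) / \<delta>)) \<longlonglongrightarrow> sqrt ((es - es) / \<delta>)"
    using \<delta>_pos by (intro tendsto_intros assms LIMSEQ_Suc[OF assms]) auto
  then have lim: "(\<lambda>n. sqrt ((en n - en (Suc n)) / \<delta>)) \<longlonglongrightarrow> 0" by simp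
  have "norm (D (Suc n)) \<le> sqrt ((en n - en (Suc n)) / \<delta>)" for n
  proof -
    have "(D (Suc n))\<^sup>2 \<le> (en n - en (Suc n)) / \<delta>"
      using energy_descent[of n] \<delta>_pos by (simp add: field_simps)
    then show ?thesis using D_bounds(3)[of "Suc n"] by (simp add: real_le_rsqrt)
  qed
  then have "(\<lambda>n. D (Suc n)) \<longlonglongrightarrow> 0"
    by (intro Lim_null_comparison[OF always_eventually lim]) auto
  then show ?thesis by (rule LIMSEQ_imp_Suc)
qed

lemma W_lim:
  assumes "en \<longlonglongrightarrow> es" shows "W \<longlonglongrightarrow> 0"
proof -
  obtain C where C: "\<And>n. norm (W (Suc n)) \<le> C * (D (Suc n) + D n)" using W_bound by blast
  have "(\<lambda>n. C * (D (Suc n) + D n)) \<longlonglongrightarrow> C * (0 + 0)"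
    by (intro tendsto_intros D_lim[OF assms] LIMSEQ_Suc[OF D_lim[OF assms]])
  then have lim: "(\<lambda>n. C * (D (Suc n) + D n)) \<longlonglongrightarrow> 0" by simp
  have "(\<lambda>n. W (Suc n)) \<longlonglongrightarrow> 0"
    by (rule Lim_null_comparison[OF always_eventually lim]) (rule allI, rule C)
  then show ?thesis by (rule LIMSEQ_imp_Suc)
qed

lemma W_components_lim:
  assumes "en \<longlonglongrightarrow> es"
  shows "\<xi> \<longlonglongrightarrow> 0" "\<omega> \<longlonglongrightarrow> 0" "(\<lambda>n. R (x (Suc n)) (y (Suc n))) \<longlonglongrightarrow> 0"
proof -
  note lim = W_lim[OF assms]
  show "\<xi> \<longlonglongrightarrow> 0" using tendsto_fst[OF lim] by (simp add: W_def)
  show "(\<lambda>n. R (x (Suc n)) (y (Suc n))) \<longlonglongrightarrow> 0"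
    using tendsto_fst[OF tendsto_snd[OF tendsto_snd[OF lim]]] by (simp add: W_def)
  \<comment> \<open>Adding the second and fourth components of \<open>W\<close> cancels the terms
    with \<open>2 * c\<close>.\<close>
  show "\<omega> \<longlonglongrightarrow> 0"
    using tendsto_add[OF tendsto_fst[OF tendsto_snd[OF lim]] tendsto_snd[OF tendsto_snd[OF tendsto_snd[OF lim]]]]
    by (simp add: W_def)
qed

section \<open>Cluster points\<close>

context
  fixes es r xs ys zs
  assumes en_lim: "en \<longlonglongrightarrow> es" and r: "strict_mono (r :: nat \<Rightarrow> nat)"
    and lim: "(\<lambda>k. (x (Suc (r k)), y (Suc (r k)), z (Suc (r k)))) \<longlonglongrightarrow> (xs, ys, zs)"
begin

lemma subsequence:
  assumes "X \<longlonglongrightarrow> l" shows "(\<lambda>k. X (r k)) \<longlonglongrightarrow> l"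
  using LIMSEQ_subseq_LIMSEQ[OF assms r] by (simp add: o_def)

lemma component_lims: "(\<lambda>k. x (Suc (r k))) \<longlonglongrightarrow> xs" "(\<lambda>k. y (Suc (r k))) \<longlonglongrightarrow> ys"
  "(\<lambda>k. z (Suc (r k))) \<longlonglongrightarrow> zs"
  using tendsto_fst[OF lim] tendsto_fst[OF tendsto_snd[OF lim]] tendsto_snd[OF tendsto_snd[OF lim]] by simp_all

lemma dy_lim: "(\<lambda>k. y (Suc (r k)) - y (r k)) \<longlonglongrightarrow> 0"
  using D_bounds(2) by (intro Lim_null_comparison[OF always_eventually subsequence[OF D_lim[OF en_lim]]]) simp

lemma previous_y_lim: "(\<lambda>k. y (r k)) \<longlonglongrightarrow> ys"
  using tendsto_diff[OF component_lims(2) dy_lim] by simp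

lemma R_lim: "(\<lambda>k. R (x (Suc (r k))) (y (Suc (r k)))) \<longlonglongrightarrow> R xs ys"
  by (intro tendsto_intros bounded_linear.tendsto[OF matrix_vector_mul_bounded_linear] component_lims)

lemma cluster_feasible: "R xs ys = 0"
  using LIMSEQ_unique[OF R_lim subsequence[OF W_components_lim(3)[OF en_lim]]] .

lemma S_lim: "(\<lambda>k. S (x (Suc (r k))) (y (Suc (r k))) (z (Suc (r k)))) \<longlonglongrightarrow> S xs ys zs"
proof -
  have "isCont (\<lambda>(u, w, q). S u w q) (xs, ys, zs)" by (rule has_derivative_continuous[OF S_derivative])
  from isCont_tendsto_compose[OF this lim] show ?thesis by simp
qed

text \<open>\<open>fs\<close> is not continuous, so the limit of its values is read off the energy,
  whose other terms all converge.\<close>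

lemma fv_lim: "(\<lambda>k. fv (Suc (r k))) \<longlonglongrightarrow> es - S xs ys zs"
proof -
  have "(\<lambda>k. en (r k) - S (x (Suc (r k))) (y (Suc (r k))) (z (Suc (r k))) - c * (norm (y (Suc (r k)) - y (r k)))\<^sup>2)
      \<longlonglongrightarrow> es - S xs ys zs - c * (norm (0::real^'q))\<^sup>2"
    by (intro tendsto_intros S_lim dy_lim subsequence[OF en_lim])
  then show ?thesis by (simp add: en_def)
qed

text \<open>\<open>\<tau>\<close> is a continuous expression in the iterates minus
  \<open>\<xi>\<close>, and \<open>\<xi>\<close> vanishes. This avoids its defining formula, where
  \<open>\<mu>s n\<close> need not converge.\<close>

lemma \<tau>_convergent: "\<exists>t. (\<lambda>k. \<tau> (r k)) \<longlonglongrightarrow> t"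
proof -
  have "(\<lambda>k. grad P (x (Suc (r k))) - grad G (x (Suc (r k))) + transpose A *v z (Suc (r k))
      + \<rho> *\<^sub>R (transpose A *v R (x (Suc (r k))) (y (Suc (r k)))) - \<xi> (r k)) \<longlonglongrightarrow>
    grad P xs - grad G xs + transpose A *v zs + \<rho> *\<^sub>R (transpose A *v R xs ys) - 0"
  proof -
    have "isCont (grad P) xs" "isCont (grad G) xs"
      using lipschitz_on_continuous_on[OF P(2)] lipschitz_on_continuous_on[OF G(4)]
      by (auto simp: continuous_on_eq_continuous_at)
    then show ?thesis
      by (intro tendsto_diff[OF _ subsequence[OF W_components_lim(1)[OF en_lim]]] tendsto_add tendsto_diff
          tendsto_scaleR tendsto_const
          bounded_linear.tendsto[OF matrix_vector_mul_bounded_linear] R_lim component_lims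
          isCont_tendsto_compose[of xs "grad P"] isCont_tendsto_compose[of xs "grad G"])
  qed
  then show ?thesis by (simp add: \<xi>_def) blast
qed

text \<open>One inequality is lower semicontinuity. For the other, the proximal minorants are
  evaluated at the cluster point \<open>xs\<close>: their modulus is fixed and \<open>\<tau>\<close>
  converges along the subsequence, so the correction terms vanish.\<close>

lemma fs_cluster: "fs xs = ereal (es - S xs ys zs)"
proof (rule antisym)
  have "fs xs \<le> liminf (\<lambda>k. fs (x (Suc (r k))))" by (rule fs_lsc[OF component_lims(1)])
  also have "\<dots> = ereal (es - S xs ys zs)"
    unfolding fs_x using fv_lim by (intro lim_imp_Liminf) auto
  finally show "fs xs \<le> ereal (es - S xs ys zs)" .
next
  obtain \<Lambda> where \<Lambda>: "\<And>n v. ereal (fv (Suc n) - \<tau> n \<bullet> (v - x (Suc n)) - \<Lambda> / 2 * (norm (v - x (Suc n)))\<^sup>2) \<le> fs v"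
    using fs_proximal by blast
  obtain t where t: "(\<lambda>k. \<tau> (r k)) \<longlonglongrightarrow> t" using \<tau>_convergent by blast
  have "(\<lambda>k. fv (Suc (r k)) - \<tau> (r k) \<bullet> (xs - x (Suc (r k))) - \<Lambda> / 2 * (norm (xs - x (Suc (r k))))\<^sup>2) \<longlonglongrightarrow>
      es - S xs ys zs - t \<bullet> (xs - xs) - \<Lambda> / 2 * (norm (xs - xs))\<^sup>2"
    by (intro tendsto_intros fv_lim t component_lims)
  then have "(\<lambda>k. ereal (fv (Suc (r k)) - \<tau> (r k) \<bullet> (xs - x (Suc (r k))) - \<Lambda> / 2 * (norm (xs - x (Suc (r k))))\<^sup>2))
      \<longlonglongrightarrow> ereal (es - S xs ys zs)" by simp
  then show "ereal (es - S xs ys zs) \<le> fs xs"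
    by (rule tendsto_upperbound) (use \<Lambda> in auto)
qed

lemma lagrangian_cluster: "\<L> (xs, ys, zs) = ereal es"
  by (simp add: aug_lagrangian_eq fs_cluster)

lemma reg_cluster: "\<F> (xs, ys, zs, ys) = ereal es"
  by (simp add: aug_lagrangian_reg_eq fs_cluster)

text \<open>Places the cluster point in the domain of the subdifferential, the only place where the
  KL property is assumed.\<close>

lemma stationary_reg: "0 \<in> limiting_subdiff \<F> (xs, ys, zs, ys)"
  unfolding limiting_subdiff_def
proof (intro CollectI conjI exI allI)
  show "\<bar>\<F> (xs, ys, zs, ys)\<bar> \<noteq> \<infinity>" by (simp add: reg_cluster)
  show "(\<lambda>k. (x (Suc (r k)), y (Suc (r k)), z (Suc (r k)), y (r k))) \<longlonglongrightarrow> (xs, ys, zs, ys)"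
    by (intro tendsto_Pair component_lims previous_y_lim)
  show "(\<lambda>k. \<F> (x (Suc (r k)), y (Suc (r k)), z (Suc (r k)), y (r k)))
      \<longlonglongrightarrow> \<F> (xs, ys, zs, ys)"
    using subsequence[OF en_lim] by (simp add: reg_cluster reg_at_iterate)
  show "W (r k) \<in> regular_subdiff \<F>
      (x (Suc (r k)), y (Suc (r k)), z (Suc (r k)), y (r k))" for k
    by (rule subgradient_reg)
  show "(\<lambda>k. W (r k)) \<longlonglongrightarrow> 0" by (rule subsequence[OF W_lim[OF en_lim]])
qed

lemma stationary_lagrangian: "0 \<in> limiting_subdiff \<L> (xs, ys, zs)"
  unfolding limiting_subdiff_def
proof (intro CollectI conjI exI allI)
  show "\<bar>\<L> (xs, ys, zs)\<bar> \<noteq> \<infinity>" by (simp add: lagrangian_cluster)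
  show "(\<lambda>k. (x (Suc (r k)), y (Suc (r k)), z (Suc (r k)))) \<longlonglongrightarrow> (xs, ys, zs)" by (rule lim)
  show "(\<lambda>k. \<L> (x (Suc (r k)), y (Suc (r k)), z (Suc (r k))))
      \<longlonglongrightarrow> \<L> (xs, ys, zs)"
    unfolding aug_lagrangian_eq fs_x fs_cluster using tendsto_add[OF fv_lim S_lim] by simp
  show "(\<xi> (r k), \<omega> (r k), R (x (Suc (r k))) (y (Suc (r k)))) \<in> regular_subdiff \<L>
      (x (Suc (r k)), y (Suc (r k)), z (Suc (r k)))" for k
    by (rule subgradient_lagrangian)
  have "(\<lambda>k. (\<xi> (r k), \<omega> (r k), R (x (Suc (r k))) (y (Suc (r k))))) \<longlonglongrightarrow> (0, 0, 0)"
    by (intro tendsto_Pair subsequence[OF W_components_lim(1)[OF en_lim]] subsequence[OF W_components_lim(2)[OF en_lim]]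
        subsequence[OF W_components_lim(3)[OF en_lim]])
  then show "(\<lambda>k. (\<xi> (r k), \<omega> (r k), R (x (Suc (r k))) (y (Suc (r k))))) \<longlonglongrightarrow> 0" by (simp add: zero_prod_def)
qed

text \<open>The shift by two makes every quantity in the abstract locale available from index 0 on.\<close>

lemma KL_descent_sequence_iterates:
  "\<exists>C. KL_descent_sequence \<F>
    (\<lambda>k. (x (k + 2), y (k + 2), z (k + 2), y (k + 1))) (\<lambda>k. en (Suc k)) D \<delta> C (xs, ys, zs, ys) es"
proof -
  obtain Cw where Cw: "0 < Cw" "\<And>n. norm (W (Suc n)) \<le> Cw * (D (Suc n) + D n)" using W_bound by blast
  obtain Cz where Cz: "0 < Cz" "\<And>n. norm (z (Suc (Suc n)) - z (Suc n)) \<le> Cz * (D (Suc n) + D n)"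
    using z_step_bound by blast
  define C where "C = Cw + Cz + 2"
  have le: "Cw * (D (Suc n) + D n) \<le> C * (D (Suc n) + D n)" "(Cz + 2) * (D (Suc n) + D n) \<le> C * (D (Suc n) + D n)" for n
    using Cw(1) Cz(1) D_bounds(3) by (intro mult_right_mono add_nonneg_nonneg; simp add: C_def)+
  have "KL_descent_sequence \<F>
    (\<lambda>k. (x (k + 2), y (k + 2), z (k + 2), y (k + 1))) (\<lambda>k. en (Suc k)) D \<delta> C (xs, ys, zs, ys) es"
  proof
    show "0 < \<delta>" by (rule \<delta>_pos)
    show "0 < C" using Cw(1) Cz(1) by (simp add: C_def)
    show "0 \<le> D k" for k by (rule D_bounds)
    show "\<F> (x (k + 2), y (k + 2), z (k + 2), y (k + 1)) = ereal (en (Suc k))" for k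
      using reg_at_iterate[of "Suc k"] by simp
    show "en (Suc (Suc k)) + \<delta> * (D (k + 2))\<^sup>2 \<le> en (Suc k)" for k
      using energy_descent[of "Suc k"] by simp
    show "\<exists>w\<in>limiting_subdiff \<F> (x (k + 2), y (k + 2), z (k + 2), y (k + 1)).
        norm w \<le> C * (D (k + 1) + D k)" for k
      using subgradient_reg[of "Suc k"] regular_subdiff_subset_limiting order_trans[OF Cw(2)[of k] le(1)[of k]]
      by (intro bexI[of _ "W (Suc k)"]) auto
    show "norm ((x (Suc k + 2), y (Suc k + 2), z (Suc k + 2), y (Suc k + 1)) - (x (k + 2), y (k + 2), z (k + 2), y (k + 1)))
        \<le> C * (D (k + 2) + D (k + 1))" for k
    proof -
      define n where "n = Suc k"
      have "norm ((x (Suc (Suc n)), y (Suc (Suc n)), z (Suc (Suc n)), y (Suc n)) - (x (Suc n), y (Suc n), z (Suc n), y n))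
          \<le> norm (x (Suc (Suc n)) - x (Suc n)) + (norm (y (Suc (Suc n)) - y (Suc n)) + (norm (z (Suc (Suc n)) - z (Suc n)) + norm (y (Suc n) - y n)))"
        unfolding diff_Pair by (intro order_trans[OF norm_Pair_le] add_left_mono norm_Pair_le)
      also have "\<dots> \<le> D (Suc n) + (D (Suc n) + (Cz * (D (Suc n) + D n) + D n))"
        using D_bounds[of n] D_bounds[of "Suc n"] Cz(2)[of n] by (intro add_mono) auto
      also have "\<dots> \<le> (Cz + 2) * (D (Suc n) + D n)" using D_bounds(3)[of n] by (simp add: algebra_simps)
      also have "\<dots> \<le> C * (D (Suc n) + D n)" by (rule le)
      finally show ?thesis by (simp add: n_def)
    qed
    show "\<F> (xs, ys, zs, ys) = ereal es" by (rule reg_cluster)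
    show "(\<lambda>k. en (Suc k)) \<longlonglongrightarrow> es" by (rule LIMSEQ_Suc[OF en_lim])
  qed
  then show ?thesis by blast
qed

end

section \<open>Convergence and rates\<close>

lemma convergence:
  assumes KL: "KL_function \<F>"
  shows "(\<exists>xs ys zs. 0 \<in> limiting_subdiff \<L> (xs, ys, zs) \<and>
      (\<lambda>n. (x n, y n, z n)) \<longlonglongrightarrow> (xs, ys, zs)) \<and>
    summable (\<lambda>n. norm ((x (Suc n), y (Suc n), z (Suc n)) - (x n, y n, z n)))"
proof -
  let ?U = "\<lambda>k. (x (k + 2), y (k + 2), z (k + 2), y (k + 1))"
  obtain es where en_lim: "en \<longlonglongrightarrow> es" using energy_converges by blast
  \<comment> \<open>The abstract sequence starts at iterate 2, so the subsequence is taken from the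
    iterates shifted by two; the cluster point facts use a shift by one, whence the index map
    \<open>\<lambda>k. Suc (r k)\<close>.\<close>
  have "bounded (range (\<lambda>n. (x (Suc (Suc n)), y (Suc (Suc n)), z (Suc (Suc n)))))"
    by (rule bounded_subset[OF bounded_iterates]) auto
  then obtain l r where r: "strict_mono (r :: nat \<Rightarrow> nat)"
    and "((\<lambda>n. (x (Suc (Suc n)), y (Suc (Suc n)), z (Suc (Suc n)))) \<circ> r) \<longlonglongrightarrow> l"
    using bounded_imp_convergent_subsequence by blast
  moreover obtain xs ys zs where "l = (xs, ys, zs)" by (cases l)
  ultimately have lim: "(\<lambda>k. (x (Suc (Suc (r k))), y (Suc (Suc (r k))), z (Suc (Suc (r k))))) \<longlonglongrightarrow> (xs, ys, zs)"
    by (simp add: o_def)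
  have r': "strict_mono (\<lambda>k. Suc (r k))" using r by (simp add: strict_mono_def)
  note cluster = en_lim r' lim
  obtain \<eta> V \<phi>' where KLw: "KL_witness \<F> (xs, ys, zs, ys) \<eta> V \<phi>'"
    using KL stationary_reg[OF cluster] unfolding KL_function_def dom_limiting_subdiff_def by blast
  obtain C where "KL_descent_sequence \<F> ?U (\<lambda>k. en (Suc k)) D \<delta> C (xs, ys, zs, ys) es"
    using KL_descent_sequence_iterates[OF cluster] by blast
  then interpret KL: KL_descent_sequence "\<F>" ?U "\<lambda>k. en (Suc k)" D \<delta> C "(xs, ys, zs, ys)" es .
  have "(?U \<circ> r) \<longlonglongrightarrow> (xs, ys, zs, ys)"
    using tendsto_Pair[OF component_lims(1)[OF cluster] tendsto_Pair[OF component_lims(2)[OF cluster]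
        tendsto_Pair[OF component_lims(3)[OF cluster] previous_y_lim[OF cluster]]]]
    by (simp add: o_def)
  then have U: "?U \<longlonglongrightarrow> (xs, ys, zs, ys)" by (rule KL.convergent_of_cluster[OF KLw r])
  have sum_D: "summable D" by (rule KL.summable_d[OF KLw U])
  have "(\<lambda>k. (x (k + 2), y (k + 2), z (k + 2))) \<longlonglongrightarrow> (xs, ys, zs)"
    using tendsto_Pair[OF tendsto_fst[OF U] tendsto_Pair[OF tendsto_fst[OF tendsto_snd[OF U]]
        tendsto_fst[OF tendsto_snd[OF tendsto_snd[OF U]]]]] by simp
  then have "(\<lambda>n. (x n, y n, z n)) \<longlonglongrightarrow> (xs, ys, zs)"
    by (rule LIMSEQ_offset[where f = "\<lambda>n. (x n, y n, z n)"])
  moreover have "summable (\<lambda>n. norm ((x (Suc n), y (Suc n), z (Suc n)) - (x n, y n, z n)))"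
  proof -
    obtain Cz where Cz: "0 < Cz" "\<And>n. norm (z (Suc (Suc n)) - z (Suc n)) \<le> Cz * (D (Suc n) + D n)"
      using z_step_bound by blast
    have "summable (\<lambda>n. D (Suc n))" using sum_D by (simp add: summable_Suc_iff)
    then have sum: "summable (\<lambda>n. 2 * D (Suc n) + Cz * (D (Suc n) + D n))"
      using sum_D by (intro summable_add summable_mult)
    have "norm ((x (Suc (Suc n)), y (Suc (Suc n)), z (Suc (Suc n))) - (x (Suc n), y (Suc n), z (Suc n)))
        \<le> 2 * D (Suc n) + Cz * (D (Suc n) + D n)" for n
    proof -
      have "norm ((x (Suc (Suc n)), y (Suc (Suc n)), z (Suc (Suc n))) - (x (Suc n), y (Suc n), z (Suc n)))
          \<le> norm (x (Suc (Suc n)) - x (Suc n)) + (norm (y (Suc (Suc n)) - y (Suc n)) + norm (z (Suc (Suc n)) - z (Suc n)))"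
        unfolding diff_Pair by (intro order_trans[OF norm_Pair_le] add_left_mono norm_Pair_le)
      then show ?thesis using D_bounds[of "Suc n"] Cz(2)[of n] by linarith
    qed
    then have "summable (\<lambda>n. norm ((x (Suc (Suc n)), y (Suc (Suc n)), z (Suc (Suc n))) - (x (Suc n), y (Suc n), z (Suc n))))"
      by (intro summable_comparison_test'[OF sum, of 0]) (simp only: norm_ge_zero real_norm_def abs_of_nonneg)
    then show ?thesis
      using summable_Suc_iff[of "\<lambda>n. norm ((x (Suc n), y (Suc n), z (Suc n)) - (x n, y n, z n))"] by simp
  qed
  ultimately show ?thesis using stationary_lagrangian[OF cluster] by blast
qed

section \<open>Transfer of the rates to the iterates, the residual and the function values\<close>

definition lr :: "nat \<Rightarrow> real" where "lr n = fv n + S (x n) (y n) (z n)"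
definition ob :: "nat \<Rightarrow> real" where "ob n = fv n + (H (y n) + P (x n) - G (x n))"

lemma objective_eq: "objective m blk f H P G u w = fs u + ereal (H w + P u - G u)"
  by (simp add: objective_def fs_def)

lemma ereal_values:
  assumes "fs (x n) \<noteq> \<infinity>"
  shows "\<L> (x n, y n, z n) = ereal (lr n)"
    "objective m blk f H P G (x n) (y n) = ereal (ob n)"
proof -
  have "fs (x n) = ereal (fv n)"
    using assms fs_not_MInfty[of "x n"] by (cases "fs (x n)") (auto simp: fv_def)
  then show "\<L> (x n, y n, z n) = ereal (lr n)"
    "objective m blk f H P G (x n) (y n) = ereal (ob n)"
    by (auto simp: aug_lagrangian_eq lr_def ob_def objective_eq)
qed

context
  fixes xs ys zs \<kappa>
  assumes V_lim: "(\<lambda>n. (x n, y n, z n)) \<longlonglongrightarrow> (xs, ys, zs)"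
    and \<kappa>: "0 \<le> \<kappa>" "\<kappa> < 1"
    and KL_exp: "KL_function_exponent \<kappa> \<F>"
begin

abbreviation dist_lim :: "nat \<Rightarrow> real" where
  "dist_lim n \<equiv> norm ((x n, y n, z n) - (xs, ys, zs))"

text \<open>The whole sequence converges, so the cluster point facts apply with the identity as
  subsequence. Feasibility removes the multiplier and penalty terms.\<close>

lemma limit_values:
  assumes en_lim: "en \<longlonglongrightarrow> es"
  shows "R xs ys = 0" "\<L> (xs, ys, zs) = ereal es"
    "objective m blk f H P G xs ys = ereal es"
proof -
  have r: "strict_mono (\<lambda>k::nat. k)" by (simp add: strict_mono_def)
  note cluster = en_lim r LIMSEQ_Suc[OF V_lim]
  show R: "R xs ys = 0" by (rule cluster_feasible[OF cluster])
  show "\<L> (xs, ys, zs) = ereal es" by (rule lagrangian_cluster[OF cluster])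
  show "objective m blk f H P G xs ys = ereal es"
    using fs_cluster[OF cluster] R by (simp add: objective_eq S_def)
qed

text \<open>The residual vanishes at the limit and is affine. The objective differs from the
  Lagrangian by the residual times a bounded factor, so its rate is that of the distance rather than
  that of the energy.\<close>

lemma residual_objective_bounds:
  assumes en_lim: "en \<longlonglongrightarrow> es"
  shows "\<exists>C>0. \<forall>n. norm (R (x n) (y n)) \<le> C * dist_lim n \<and> \<bar>ob n - es\<bar> \<le> \<bar>lr n - es\<bar> + C * dist_lim n"
proof -
  obtain KA where KA: "0 < KA" "\<And>v. norm (A *v v) \<le> KA * norm v" by (rule matrix_norm_bound[of A]) blast
  obtain KB where KB: "0 < KB" "\<And>v. norm (B *v v) \<le> KB * norm v" by (rule matrix_norm_bound[of B]) blast
  define C1 where "C1 = KA + KB"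
  have C1: "0 < C1" using KA KB by (simp add: C1_def)
  have R: "norm (R (x n) (y n)) \<le> C1 * dist_lim n" for n
  proof -
    have "R (x n) (y n) = R (x n) (y n) - R xs ys" using limit_values(1)[OF en_lim] by simp
    also have "\<dots> = A *v (x n - xs) + B *v (y n - ys)"
      by (simp add: matrix_vector_mult_diff_distrib algebra_simps)
    finally have "norm (R (x n) (y n)) \<le> KA * norm (x n - xs) + KB * norm (y n - ys)"
      using norm_triangle_le[OF add_mono[OF KA(2) KB(2)]] by simp
    also have "\<dots> \<le> KA * dist_lim n + KB * dist_lim n"
    proof -
      have "norm (x n - xs) \<le> dist_lim n" unfolding diff_Pair by (rule norm_fst_le)
      moreover have "norm (y n - ys) \<le> dist_lim n"
        unfolding diff_Pair by (rule order_trans[OF norm_fst_le norm_snd_le])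
      ultimately show ?thesis using KA(1) KB(1) by (intro add_mono mult_left_mono) auto
    qed
    finally show ?thesis by (simp add: C1_def distrib_right)
  qed
  have "Bseq (\<lambda>n. norm (z n) + \<rho> / 2 * (C1 * dist_lim n))"
  proof (rule convergent_imp_Bseq, rule convergentI)
    show "(\<lambda>n. norm (z n) + \<rho> / 2 * (C1 * dist_lim n)) \<longlonglongrightarrow>
        norm zs + \<rho> / 2 * (C1 * norm ((xs, ys, zs) - (xs, ys, zs)))"
      using tendsto_snd[OF tendsto_snd[OF V_lim]] by (intro tendsto_intros V_lim) simp
  qed
  then obtain M where M: "0 < M" "\<And>n. norm (norm (z n) + \<rho> / 2 * (C1 * dist_lim n)) \<le> M"
    by (auto simp: Bseq_def)
  have O: "\<bar>ob n - es\<bar> \<le> \<bar>lr n - es\<bar> + M * C1 * dist_lim n" for n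
  proof -
    have M': "norm (z n) + \<rho> / 2 * (C1 * dist_lim n) \<le> M" using M(2)[of n] by simp
    have "0 \<le> \<rho> / 2 * (norm (R (x n) (y n)))\<^sup>2" using \<rho>_pos by simp
    then have "\<bar>z n \<bullet> R (x n) (y n) + \<rho> / 2 * (norm (R (x n) (y n)))\<^sup>2\<bar>
        \<le> norm (z n) * norm (R (x n) (y n)) + \<rho> / 2 * (norm (R (x n) (y n)))\<^sup>2"
      using Cauchy_Schwarz_ineq2[of "z n" "R (x n) (y n)"] by linarith
    also have "\<dots> = (norm (z n) + \<rho> / 2 * norm (R (x n) (y n))) * norm (R (x n) (y n))"
      by (simp add: power2_eq_square distrib_right)
    also have "\<dots> \<le> M * (C1 * dist_lim n)"
    proof (rule mult_mono)
      have "\<rho> / 2 * norm (R (x n) (y n)) \<le> \<rho> / 2 * (C1 * dist_lim n)"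
        using R[of n] \<rho>_pos by (intro mult_left_mono) auto
      then show "norm (z n) + \<rho> / 2 * norm (R (x n) (y n)) \<le> M" using M' by linarith
    qed (use R M(1) in auto)
    finally have "\<bar>z n \<bullet> R (x n) (y n) + \<rho> / 2 * (norm (R (x n) (y n)))\<^sup>2\<bar> \<le> M * C1 * dist_lim n" by simp
    moreover have "lr n = ob n + (z n \<bullet> R (x n) (y n) + \<rho> / 2 * (norm (R (x n) (y n)))\<^sup>2)"
      by (simp add: lr_def ob_def S_def)
    ultimately show ?thesis by linarith
  qed
  define C where "C = C1 + M * C1"
  have "C1 * dist_lim n \<le> C * dist_lim n" "M * C1 * dist_lim n \<le> C * dist_lim n" for n
    using C1 M(1) by (auto simp: C_def intro!: mult_right_mono)
  then have "norm (R (x n) (y n)) \<le> C * dist_lim n \<and> \<bar>ob n - es\<bar> \<le> \<bar>lr n - es\<bar> + C * dist_lim n" for n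
    using R[of n] O[of n] by (meson add_left_mono order_trans)
  moreover have "0 < C" using C1 M(1) by (simp add: C_def add_pos_pos)
  ultimately show ?thesis by blast
qed

text \<open>For gaps below 1 the slower of \<open>sqrt (E k)\<close> and
  \<open>E k powr (1 - \<kappa>)\<close> is the power with exponent
  \<open>min (1 / 2) (1 - \<kappa>)\<close>. The shift by 4 combines the offset of the abstract
  sequence with that of \<open>distance_rate\<close>.\<close>

lemma rates:
  assumes en_lim: "en \<longlonglongrightarrow> es"
  obtains E :: "nat \<Rightarrow> real" and N and C where "0 < C" "\<And>k. 0 \<le> E k"
    "\<And>k. N \<le> k \<Longrightarrow> dist_lim (k + 4) \<le> C * E k powr (min (1 / 2) (1 - \<kappa>))"
    "\<And>k. N \<le> k \<Longrightarrow> norm (R (x (k + 4)) (y (k + 4))) \<le> C * E k powr (min (1 / 2) (1 - \<kappa>))"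
    "\<And>k. N \<le> k \<Longrightarrow> \<bar>lr (k + 4) - es\<bar> \<le> C * E k"
    "\<And>k. N \<le> k \<Longrightarrow> \<bar>ob (k + 4) - es\<bar> \<le> C * E k powr (min (1 / 2) (1 - \<kappa>))"
    "\<kappa> = 0 \<Longrightarrow> \<exists>N. \<forall>k\<ge>N. E k = 0"
    "\<kappa> \<le> 1 / 2 \<Longrightarrow> \<exists>M \<zeta>. 0 < M \<and> 0 < \<zeta> \<and> \<zeta> < 1 \<and> (\<forall>k. E k \<le> M * \<zeta> ^ k)"
    "1 / 2 < \<kappa> \<Longrightarrow> \<exists>M>0. \<forall>k\<ge>1. E k \<le> M * real k powr (- (1 / (2 * \<kappa> - 1)))"
proof -
  let ?U = "\<lambda>k. (x (k + 2), y (k + 2), z (k + 2), y (k + 1))"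
  have r: "strict_mono (\<lambda>k::nat. k)" by (simp add: strict_mono_def)
  note cluster = en_lim r LIMSEQ_Suc[OF V_lim]
  obtain \<eta> V \<theta> where \<theta>: "0 < \<theta>"
    and KLw: "KL_witness \<F> (xs, ys, zs, ys) \<eta> V (\<lambda>t. \<theta> * t powr (1 - \<kappa>))"
    using KL_exp stationary_reg[OF cluster] unfolding KL_function_exponent_def dom_limiting_subdiff_def by blast
  obtain C0 where "KL_descent_sequence \<F> ?U (\<lambda>k. en (Suc k)) D \<delta> C0 (xs, ys, zs, ys) es"
    using KL_descent_sequence_iterates[OF cluster] by blast
  then interpret KL: KL_descent_sequence "\<F>" ?U "\<lambda>k. en (Suc k)" D \<delta> C0 "(xs, ys, zs, ys)" es .
  have U: "?U \<longlonglongrightarrow> (xs, ys, zs, ys)"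
  proof -
    note l = LIMSEQ_ignore_initial_segment[OF V_lim, of 2]
    have "(\<lambda>n. y (n + 1)) \<longlonglongrightarrow> ys"
      using LIMSEQ_ignore_initial_segment[OF tendsto_fst[OF tendsto_snd[OF V_lim]], of 1] by simp
    then show ?thesis
      using tendsto_Pair[OF tendsto_fst[OF l] tendsto_Pair[OF tendsto_fst[OF tendsto_snd[OF l]]
        tendsto_Pair[OF tendsto_snd[OF tendsto_snd[OF l]]]]] by simp
  qed
  note KL_facts = KLw \<theta> \<kappa> U
  let ?\<sigma> = "min (1 / 2) (1 - \<kappa>)"
  obtain N1 K1 where K1: "0 < K1" "\<And>k. N1 \<le> k \<Longrightarrow> norm (?U (k + 2) - (xs, ys, zs, ys)) \<le> K1 * (sqrt (KL.E k) + KL.E k powr (1 - \<kappa>))"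
    using KL.distance_rate[OF KL_facts] by blast
  have "\<forall>\<^sub>F k in sequentially. KL.E k < 1" using KL.E_lim by (intro order_tendstoD) auto
  then obtain N2 where N2: "\<And>k. N2 \<le> k \<Longrightarrow> KL.E k < 1" by (auto simp: eventually_sequentially)
  obtain K2 where K2: "0 < K2" "\<And>n. norm (R (x n) (y n)) \<le> K2 * dist_lim n"
    "\<And>n. \<bar>ob n - es\<bar> \<le> \<bar>lr n - es\<bar> + K2 * dist_lim n"
    using residual_objective_bounds[OF en_lim] by blast
  \<comment> \<open>The Lagrangian value is the energy minus \<open>c\<close> times a squared
    \<open>y\<close>-step, and that square is at most the gap over \<open>\<delta>\<close>.\<close>
  define K3 where "K3 = 1 + c / \<delta>"
  have K3: "0 < K3" using c_nonneg \<delta>_pos by (simp add: K3_def add_pos_nonneg)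
  define C where "C = 2 * K1 + K2 * (2 * K1) + K3"
  have C: "0 < C" using K1 K2 K3 by (simp add: C_def add_pos_pos)
  have small: "sqrt (KL.E k) \<le> KL.E k powr ?\<sigma>" "KL.E k powr (1 - \<kappa>) \<le> KL.E k powr ?\<sigma>" "KL.E k \<le> KL.E k powr ?\<sigma>"
    if "N2 \<le> k" for k
  proof -
    have *: "KL.E k powr a \<le> KL.E k powr ?\<sigma>" if "?\<sigma> \<le> a" for a
      using KL.E_nonneg[of k] N2[OF \<open>N2 \<le> k\<close>] that \<kappa> by (cases "KL.E k = 0") (auto intro!: powr_mono')
    show "sqrt (KL.E k) \<le> KL.E k powr ?\<sigma>" using *[OF min.cobounded1] KL.E_nonneg[of k] by (simp add: powr_half_sqrt)
    show "KL.E k powr (1 - \<kappa>) \<le> KL.E k powr ?\<sigma>" by (rule *[OF min.cobounded2])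
    show "KL.E k \<le> KL.E k powr ?\<sigma>" using *[of 1] KL.E_nonneg[of k] by (simp add: min_le_iff_disj)
  qed
  have dist: "dist_lim (k + 4) \<le> 2 * K1 * KL.E k powr ?\<sigma>" if k: "max N1 N2 \<le> k" for k
  proof -
    have "dist_lim (k + 4) \<le> norm (?U (k + 2) - (xs, ys, zs, ys))"
    proof -
      have "(norm (x (k + 4) - xs))\<^sup>2 + ((norm (y (k + 4) - ys))\<^sup>2 + (norm (z (k + 4) - zs))\<^sup>2) \<le>
        (norm (x (k + 4) - xs))\<^sup>2 + ((norm (y (k + 4) - ys))\<^sup>2 + ((norm (z (k + 4) - zs))\<^sup>2 + (norm (y (k + 3) - ys))\<^sup>2))"
        by simp
      then show ?thesis by (simp add: norm_Pair numeral_eq_Suc)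
    qed
    also have "\<dots> \<le> K1 * (sqrt (KL.E k) + KL.E k powr (1 - \<kappa>))" using K1(2) k by simp
    also have "\<dots> \<le> K1 * (KL.E k powr ?\<sigma> + KL.E k powr ?\<sigma>)"
      using small[of k] k K1(1) by (intro mult_left_mono add_mono) auto
    finally show ?thesis by simp
  qed
  have lag: "\<bar>lr (k + 4) - es\<bar> \<le> K3 * KL.E k" for k
  proof -
    have mono: "KL.E (k + 1) \<le> KL.E k" "KL.E (k + 2) \<le> KL.E k" using KL.decseq_E by (auto simp: decseq_def)
    define t where "t = (norm (y (k + 4) - y (k + 3)))\<^sup>2"
    have "lr (k + 4) = en (k + 3) - c * t"
      by (simp add: lr_def en_def t_def numeral_eq_Suc)
    then have 1: "lr (k + 4) - es = KL.E (k + 2) - c * t" by (simp add: KL.E_def numeral_eq_Suc)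
    have "t \<le> (D (k + 3))\<^sup>2"
      using power_mono[OF D_bounds(2)[of "k + 3"], of 2] by (simp add: t_def numeral_eq_Suc)
    moreover have "\<delta> * (D (k + 3))\<^sup>2 \<le> KL.E k"
      using KL.descent_E[of "k + 1"] KL.E_nonneg[of "k + 2"] mono by (simp add: numeral_eq_Suc)
    ultimately have "\<delta> * t \<le> KL.E k" using \<delta>_pos by (meson less_imp_le mult_left_mono order_trans)
    then have "t \<le> KL.E k / \<delta>" using \<delta>_pos by (simp add: field_simps)
    then have "c * t \<le> c * (KL.E k / \<delta>)" using c_nonneg by (rule mult_left_mono)
    moreover have "0 \<le> c * t" using c_nonneg by (simp add: t_def)
    moreover have "K3 * KL.E k = KL.E k + c * (KL.E k / \<delta>)" by (simp add: K3_def distrib_right)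
    ultimately show ?thesis using 1 mono(2) KL.E_nonneg[of "k + 2"] KL.E_nonneg[of k] by linarith
  qed
  have le: "2 * K1 * t \<le> C * t" "K2 * (2 * K1 * t) \<le> C * t" "K3 * t \<le> C * t" "K3 * t + K2 * (2 * K1 * t) \<le> C * t"
    if "0 \<le> t" for t
    using K1(1) K2(1) K3 that by (simp_all add: C_def distrib_right)
  show thesis
  proof (rule that[of C KL.E "max N1 N2"])
    show "0 < C" by (rule C)
    show "0 \<le> KL.E k" for k by (rule KL.E_nonneg)
    fix k assume k: "max N1 N2 \<le> k"
    note d = dist[OF k]
    show "dist_lim (k + 4) \<le> C * KL.E k powr ?\<sigma>"
      using d le(1)[of "KL.E k powr ?\<sigma>"] by simp
    have d': "K2 * dist_lim (k + 4) \<le> K2 * (2 * K1 * KL.E k powr ?\<sigma>)"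
      using d K2(1) by (intro mult_left_mono) auto
    show "norm (R (x (k + 4)) (y (k + 4))) \<le> C * KL.E k powr ?\<sigma>"
      using K2(2)[of "k + 4"] d' le(2)[of "KL.E k powr ?\<sigma>"] by simp
    show "\<bar>lr (k + 4) - es\<bar> \<le> C * KL.E k" using lag[of k] le(3)[of "KL.E k"] KL.E_nonneg[of k] by simp
    have "K3 * KL.E k \<le> K3 * KL.E k powr ?\<sigma>" using small(3)[of k] k K3 by (intro mult_left_mono) auto
    then show "\<bar>ob (k + 4) - es\<bar> \<le> C * KL.E k powr ?\<sigma>"
      using K2(3)[of "k + 4"] lag[of k] d' le(4)[of "KL.E k powr ?\<sigma>"] by simp
  next
    show "\<kappa> = 0 \<Longrightarrow> \<exists>N. \<forall>k\<ge>N. KL.E k = 0" by (rule KL.finite_E[OF KL_facts])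
    show "\<kappa> \<le> 1 / 2 \<Longrightarrow> \<exists>M \<zeta>. 0 < M \<and> 0 < \<zeta> \<and> \<zeta> < 1 \<and> (\<forall>k. KL.E k \<le> M * \<zeta> ^ k)"
      by (rule KL.geometric_E[OF KL_facts])
    show "1 / 2 < \<kappa> \<Longrightarrow> \<exists>M>0. \<forall>k\<ge>1. KL.E k \<le> M * real k powr (- (1 / (2 * \<kappa> - 1)))"
      by (rule KL.sublinear_E[OF KL_facts])
  qed
qed

lemma finite_convergence:
  assumes "\<kappa> = 0"
  shows "\<exists>N. \<forall>n\<ge>N. (x n, y n, z n) = (xs, ys, zs)"
proof -
  obtain es where en_lim: "en \<longlonglongrightarrow> es" using energy_converges by blast
  obtain E N C where E: "\<And>k. N \<le> k \<Longrightarrow> dist_lim (k + 4) \<le> C * E k powr (min (1 / 2) (1 - \<kappa>))"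
    "\<exists>N. \<forall>k\<ge>N. E k = 0"
    using rates[OF en_lim] assms by metis
  then obtain N' where N': "\<And>k. N' \<le> k \<Longrightarrow> E k = 0" by blast
  have "(x n, y n, z n) = (xs, ys, zs)" if "N + N' + 4 \<le> n" for n
  proof -
    have "dist_lim (n - 4 + 4) \<le> 0" using E(1)[of "n - 4"] N'[of "n - 4"] that by simp
    then show ?thesis using that by (simp add: zero_prod_def)
  qed
  then show ?thesis by blast
qed

text \<open>The real-valued gaps satisfy the bounds at every index. Only their transfer to extended
  reals needs the guard at \<open>n = 0\<close>, where the initial objective may be
  infinite.\<close>

lemma linear_rate:
  assumes "\<kappa> \<le> 1 / 2"
  shows "\<exists>\<gamma> \<zeta>. 0 < \<gamma> \<and> 0 < \<zeta> \<and> \<zeta> < 1 \<and>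
     (\<forall>n. dist_lim n \<le> \<gamma> * \<zeta> powr (real n / 2) \<and>
       norm (R (x n) (y n)) \<le> \<gamma> * \<zeta> powr (real n / 2) \<and>
       ((n = 0 \<longrightarrow> objective m blk f H P G (x 0) (y 0) < \<infinity>) \<longrightarrow>
         \<bar>\<L> (x n, y n, z n)
           - \<L> (xs, ys, zs)\<bar> \<le> ereal (\<gamma> * \<zeta> ^ n) \<and>
         \<bar>objective m blk f H P G (x n) (y n) - objective m blk f H P G xs ys\<bar>
           \<le> ereal (\<gamma> * \<zeta> powr (real n / 2))))"
proof -
  obtain es where en_lim: "en \<longlonglongrightarrow> es" using energy_converges by blast
  obtain E N C where C: "0 < C" and E0: "\<And>k. 0 \<le> E k"
    and E: "\<And>k. N \<le> k \<Longrightarrow> dist_lim (k + 4) \<le> C * E k powr (min (1 / 2) (1 - \<kappa>))"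
    "\<And>k. N \<le> k \<Longrightarrow> norm (R (x (k + 4)) (y (k + 4))) \<le> C * E k powr (min (1 / 2) (1 - \<kappa>))"
    "\<And>k. N \<le> k \<Longrightarrow> \<bar>lr (k + 4) - es\<bar> \<le> C * E k"
    "\<And>k. N \<le> k \<Longrightarrow> \<bar>ob (k + 4) - es\<bar> \<le> C * E k powr (min (1 / 2) (1 - \<kappa>))"
    and "\<exists>M \<zeta>. 0 < M \<and> 0 < \<zeta> \<and> \<zeta> < 1 \<and> (\<forall>k. E k \<le> M * \<zeta> ^ k)"
    by (rule rates[OF en_lim]) (use assms in blast)
  then obtain M \<zeta> where M: "0 < M" and \<zeta>: "0 < \<zeta>" "\<zeta> < 1" and EM: "\<And>k. E k \<le> M * \<zeta> ^ k" by blast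
  \<comment> \<open>The divisors compensate the index shift by 4: a factor
    \<open>\<zeta> ^ 4\<close> for the energy gap and its square root for the distances.\<close>
  define C' where "C' = C * (M / \<zeta> ^ 4 + sqrt M / \<zeta>\<^sup>2)"
  have E3: "C * E k \<le> C' * \<zeta> ^ (k + 4)" for k
  proof -
    have "C * E k \<le> C * (M * \<zeta> ^ k)" using EM C by simp
    also have "\<dots> = C * (M / \<zeta> ^ 4) * \<zeta> ^ (k + 4)" using \<zeta> by (simp add: power_add)
    also have "\<dots> \<le> C' * \<zeta> ^ (k + 4)" using C M \<zeta> by (intro mult_right_mono) (auto simp: C'_def distrib_left)
    finally show ?thesis .
  qed
  have E1: "C * E k powr (min (1 / 2) (1 - \<kappa>)) \<le> C' * \<zeta> powr (real (k + 4) / 2)" for k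
  proof -
    have half: "min (1 / 2) (1 - \<kappa>) = 1 / 2" using assms by simp
    have "C * E k powr (min (1 / 2) (1 - \<kappa>)) = C * sqrt (E k)"
      unfolding half by (simp only: powr_half_sqrt[OF E0])
    also have "\<dots> \<le> C * sqrt (M * \<zeta> ^ k)" using EM C by simp
    also have "sqrt (M * \<zeta> ^ k) = sqrt M * \<zeta> powr (real k / 2)"
    proof -
      have "sqrt (\<zeta> ^ k) = (\<zeta> powr real k) powr (1 / 2)"
        using \<zeta> by (simp add: powr_realpow powr_half_sqrt)
      then show ?thesis by (simp add: real_sqrt_mult powr_powr)
    qed
    also have "C * (sqrt M * \<zeta> powr (real k / 2)) = C * (sqrt M / \<zeta>\<^sup>2) * \<zeta> powr (real (k + 4) / 2)"
    proof -
      have "\<zeta> powr (real (k + 4) / 2) = \<zeta> powr (real k / 2) * \<zeta> powr 2"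
        unfolding powr_add[symmetric] by (simp add: add_divide_distrib)
      moreover have "\<zeta> powr 2 = \<zeta>\<^sup>2" using \<zeta> by simp
      ultimately show ?thesis using \<zeta> by simp
    qed
    also have "\<dots> \<le> C' * \<zeta> powr (real (k + 4) / 2)"
      using C M \<zeta> by (intro mult_right_mono) (auto simp: C'_def distrib_left)
    finally show ?thesis .
  qed
  have shift: "\<exists>k. n = k + 4 \<and> N \<le> k" if "N + 4 \<le> n" for n
    using that by (intro exI[of _ "n - 4"]) simp
  have "\<exists>\<gamma>>0. \<forall>n\<ge>0. dist_lim n \<le> \<gamma> * \<zeta> powr (real n / 2) \<and> norm (R (x n) (y n)) \<le> \<gamma> * \<zeta> powr (real n / 2) \<and>
      \<bar>lr n - es\<bar> \<le> \<gamma> * \<zeta> ^ n \<and> \<bar>ob n - es\<bar> \<le> \<gamma> * \<zeta> powr (real n / 2)"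
  proof (rule common_bound_from_eventual_bounds[where N = "N + 4" and C = C'])
    fix n assume "N + 4 \<le> n"
    then obtain k where k: "n = k + 4" "N \<le> k" using shift by blast
    show "dist_lim n \<le> C' * \<zeta> powr (real n / 2)"
      unfolding k(1) by (rule order_trans[OF E(1)[OF k(2)] E1])
    show "norm (R (x n) (y n)) \<le> C' * \<zeta> powr (real n / 2)"
      unfolding k(1) by (rule order_trans[OF E(2)[OF k(2)] E1])
    show "\<bar>lr n - es\<bar> \<le> C' * \<zeta> ^ n"
      unfolding k(1) by (rule order_trans[OF E(3)[OF k(2)] E3])
    show "\<bar>ob n - es\<bar> \<le> C' * \<zeta> powr (real n / 2)"
      unfolding k(1) by (rule order_trans[OF E(4)[OF k(2)] E1])
  qed (use \<zeta> in auto)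
  then obtain \<gamma> where \<gamma>: "0 < \<gamma>" and bd: "\<And>n. dist_lim n \<le> \<gamma> * \<zeta> powr (real n / 2)"
    "\<And>n. norm (R (x n) (y n)) \<le> \<gamma> * \<zeta> powr (real n / 2)"
    "\<And>n. \<bar>lr n - es\<bar> \<le> \<gamma> * \<zeta> ^ n" "\<And>n. \<bar>ob n - es\<bar> \<le> \<gamma> * \<zeta> powr (real n / 2)" by blast
  have fin: "fs (x n) \<noteq> \<infinity>" if "n = 0 \<longrightarrow> objective m blk f H P G (x 0) (y 0) < \<infinity>" for n :: nat
  proof (cases n)
    case 0
    then show ?thesis using that by (auto simp: objective_def fs_def)
  qed (simp add: fs_x)
  show ?thesis
  proof (rule exI[of _ \<gamma>], rule exI[of _ \<zeta>], intro conjI allI impI \<gamma> \<zeta> bd(1,2))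
    fix n :: nat assume "n = 0 \<longrightarrow> objective m blk f H P G (x 0) (y 0) < \<infinity>"
    note vals = ereal_values[OF fin[OF this]] limit_values(2,3)[OF en_lim]
    show "\<bar>\<L> (x n, y n, z n)
           - \<L> (xs, ys, zs)\<bar> \<le> ereal (\<gamma> * \<zeta> ^ n)"
      unfolding vals using bd(3)[of n] by simp
    show "\<bar>objective m blk f H P G (x n) (y n) - objective m blk f H P G xs ys\<bar>
           \<le> ereal (\<gamma> * \<zeta> powr (real n / 2))"
      unfolding vals using bd(4)[of n] by simp
  qed
qed

lemma sublinear_rate:
  assumes "1 / 2 < \<kappa>"
  shows "\<exists>\<gamma>. 0 < \<gamma> \<and> (\<forall>n\<ge>1.
     dist_lim n \<le> \<gamma> * real n powr (- ((1 - \<kappa>) / (2 * \<kappa> - 1))) \<and>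
     norm (R (x n) (y n)) \<le> \<gamma> * real n powr (- ((1 - \<kappa>) / (2 * \<kappa> - 1))) \<and>
     \<bar>\<L> (x n, y n, z n)
       - \<L> (xs, ys, zs)\<bar>
       \<le> ereal (\<gamma> * real n powr (- ((2 - 2 * \<kappa>) / (2 * \<kappa> - 1)))) \<and>
     \<bar>objective m blk f H P G (x n) (y n) - objective m blk f H P G xs ys\<bar>
       \<le> ereal (\<gamma> * real n powr (- ((1 - \<kappa>) / (2 * \<kappa> - 1)))))"
proof -
  obtain es where en_lim: "en \<longlonglongrightarrow> es" using energy_converges by blast
  obtain E N C where C: "0 < C" and E0: "\<And>k. 0 \<le> E k"
    and E: "\<And>k. N \<le> k \<Longrightarrow> dist_lim (k + 4) \<le> C * E k powr (min (1 / 2) (1 - \<kappa>))"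
    "\<And>k. N \<le> k \<Longrightarrow> norm (R (x (k + 4)) (y (k + 4))) \<le> C * E k powr (min (1 / 2) (1 - \<kappa>))"
    "\<And>k. N \<le> k \<Longrightarrow> \<bar>lr (k + 4) - es\<bar> \<le> C * E k"
    "\<And>k. N \<le> k \<Longrightarrow> \<bar>ob (k + 4) - es\<bar> \<le> C * E k powr (min (1 / 2) (1 - \<kappa>))"
    and "\<exists>M>0. \<forall>k\<ge>1. E k \<le> M * real k powr (- (1 / (2 * \<kappa> - 1)))"
    by (rule rates[OF en_lim]) (use assms in blast)
  then obtain M where M: "0 < M" and EM: "\<And>k. 1 \<le> k \<Longrightarrow> E k \<le> M * real k powr (- (1 / (2 * \<kappa> - 1)))" by blast
  define p where "p = 1 / (2 * \<kappa> - 1)"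
  have p: "0 < p" using assms by (simp add: p_def)
  \<comment> \<open>The index shift costs a constant factor: \<open>k + 4 \<le> 5 * k\<close> for
    \<open>k \<ge> 1\<close>.\<close>
  define M' where "M' = M * 5 powr p"
  have M': "0 < M'" using M by (simp add: M'_def)
  have EM': "E k \<le> M' * real (k + 4) powr (- p)" if "1 \<le> k" for k
  proof -
    have "real k powr (- p) \<le> (real (k + 4) / 5) powr (- p)"
      using that p by (intro powr_mono2') auto
    also have "\<dots> = 5 powr p * real (k + 4) powr (- p)"
      by (simp add: powr_divide powr_minus field_simps)
    finally have "M * real k powr (- p) \<le> M * (5 powr p * real (k + 4) powr (- p))" using M by simp
    then show ?thesis using EM[OF that] by (simp add: p_def M'_def mult.assoc)
  qed
  define C' where "C' = C * (M' + M' powr (1 - \<kappa>))"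
  let ?t1 = "\<lambda>n. real n powr (- ((1 - \<kappa>) / (2 * \<kappa> - 1)))"
  let ?t3 = "\<lambda>n. real n powr (- ((2 - 2 * \<kappa>) / (2 * \<kappa> - 1)))"
  have E3: "C * E k \<le> C' * ?t3 (k + 4)" if "1 \<le> k" for k
  proof -
    \<comment> \<open>The energy decays with exponent \<open>1 / (2 * \<kappa> - 1)\<close>, which
      is stronger than the stated rate because \<open>2 - 2 * \<kappa> < 1\<close>.\<close>
    have "real (k + 4) powr (- p) \<le> ?t3 (k + 4)"
      using assms \<kappa> by (intro powr_mono) (auto simp: p_def divide_right_mono)
    then have "M' * real (k + 4) powr (- p) \<le> M' * ?t3 (k + 4)" using M' by simp
    then have "C * E k \<le> C * (M' * ?t3 (k + 4))" using EM'[OF that] C by simp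
    also have "\<dots> \<le> C' * ?t3 (k + 4)" using C by (simp add: C'_def distrib_left distrib_right)
    finally show ?thesis .
  qed
  have E1: "C * E k powr (min (1 / 2) (1 - \<kappa>)) \<le> C' * ?t1 (k + 4)" if "1 \<le> k" for k
  proof -
    have "min (1 / 2) (1 - \<kappa>) = 1 - \<kappa>" using assms by simp
    then have "E k powr (min (1 / 2) (1 - \<kappa>)) \<le> (M' * real (k + 4) powr (- p)) powr (1 - \<kappa>)"
      using EM'[OF that] E0 \<kappa> by (simp only:) (intro powr_mono2, auto)
    also have "\<dots> = M' powr (1 - \<kappa>) * ?t1 (k + 4)"
      using M' by (simp add: powr_mult powr_powr p_def)
    finally have "C * E k powr (min (1 / 2) (1 - \<kappa>)) \<le> C * (M' powr (1 - \<kappa>) * ?t1 (k + 4))" using C by simp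
    also have "\<dots> \<le> C' * ?t1 (k + 4)" using C M' by (simp add: C'_def distrib_left distrib_right)
    finally show ?thesis .
  qed
  have shift: "\<exists>k. n = k + 4 \<and> N \<le> k \<and> 1 \<le> k" if "N + 5 \<le> n" for n
    using that by (intro exI[of _ "n - 4"]) arith
  have "\<exists>\<gamma>>0. \<forall>n\<ge>1. dist_lim n \<le> \<gamma> * ?t1 n \<and> norm (R (x n) (y n)) \<le> \<gamma> * ?t1 n \<and>
      \<bar>lr n - es\<bar> \<le> \<gamma> * ?t3 n \<and> \<bar>ob n - es\<bar> \<le> \<gamma> * ?t1 n"
  proof (rule common_bound_from_eventual_bounds[where N = "N + 5" and C = C'])
    fix n assume "N + 5 \<le> n"
    then obtain k where k: "n = k + 4" "N \<le> k" "1 \<le> k" using shift by blast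
    show "dist_lim n \<le> C' * ?t1 n"
      unfolding k(1) by (rule order_trans[OF E(1)[OF k(2)] E1[OF k(3)]])
    show "norm (R (x n) (y n)) \<le> C' * ?t1 n"
      unfolding k(1) by (rule order_trans[OF E(2)[OF k(2)] E1[OF k(3)]])
    show "\<bar>lr n - es\<bar> \<le> C' * ?t3 n"
      unfolding k(1) by (rule order_trans[OF E(3)[OF k(2)] E3[OF k(3)]])
    show "\<bar>ob n - es\<bar> \<le> C' * ?t1 n"
      unfolding k(1) by (rule order_trans[OF E(4)[OF k(2)] E1[OF k(3)]])
  qed auto
  then obtain \<gamma> where \<gamma>: "0 < \<gamma>" and bd: "\<And>n. 1 \<le> n \<Longrightarrow> dist_lim n \<le> \<gamma> * ?t1 n"
    "\<And>n. 1 \<le> n \<Longrightarrow> norm (R (x n) (y n)) \<le> \<gamma> * ?t1 n"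
    "\<And>n. 1 \<le> n \<Longrightarrow> \<bar>lr n - es\<bar> \<le> \<gamma> * ?t3 n" "\<And>n. 1 \<le> n \<Longrightarrow> \<bar>ob n - es\<bar> \<le> \<gamma> * ?t1 n" by blast
  show ?thesis
  proof (intro exI[of _ \<gamma>] conjI allI impI \<gamma>)
    fix n :: nat assume n: "1 \<le> n"
    then have "fs (x n) \<noteq> \<infinity>" using fs_x[of "n - 1"] by simp
    note vals = ereal_values[OF this] limit_values(2,3)[OF en_lim]
    show "dist_lim n \<le> \<gamma> * ?t1 n" "norm (R (x n) (y n)) \<le> \<gamma> * ?t1 n" using bd n by blast+
    show "\<bar>\<L> (x n, y n, z n)
           - \<L> (xs, ys, zs)\<bar> \<le> ereal (\<gamma> * ?t3 n)"
      unfolding vals using bd(3)[OF n] by simp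
    show "\<bar>objective m blk f H P G (x n) (y n) - objective m blk f H P G xs ys\<bar> \<le> ereal (\<gamma> * ?t1 n)"
      unfolding vals using bd(4)[OF n] by simp
  qed
qed

end

end

theorem theorem3p2:
  fixes m :: nat and blk :: "'d::finite \<Rightarrow> nat"
    and f :: "nat \<Rightarrow> real^'d \<Rightarrow> ereal"
    and H :: "real^'q \<Rightarrow> real" and P G :: "real^'d \<Rightarrow> real"
    and A :: "real^'d^'p" and B :: "real^'q^'p" and b :: "real^'p"
    and \<phi> :: "nat \<Rightarrow> real^'d \<Rightarrow> real" and \<psi> :: "real^'q \<Rightarrow> real"
    and x g :: "nat \<Rightarrow> real^'d" and y :: "nat \<Rightarrow> real^'q" and z :: "nat \<Rightarrow> real^'p"
    and lH lP lG l\<phi> l\<psi> \<alpha> \<beta> lam \<mu> \<mu>bar \<nu> \<rho> c :: real and \<mu>s \<nu>s :: "nat \<Rightarrow> real"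
  assumes blocks: "blk ` UNIV = {1..m}"
    and f: "\<And>i. i \<in> {1..m} \<Longrightarrow> proper_on (block_space blk i) (f i) \<and> lsc_on (block_space blk i) (f i)"
    and H: "H differentiable_on UNIV" "lH-lipschitz_on UNIV (grad H)" "bdd_below (range H)"
    and P: "P differentiable_on UNIV" "lP-lipschitz_on UNIV (grad P)"
    and G: "continuous_on UNIV G" "0 \<le> \<beta>" "weakly_convex_on \<beta> UNIV G"
      "G differentiable_on UNIV" "lG-lipschitz_on UNIV (grad G)"
    and image: "range (\<lambda>u. A *v u) \<union> {b} \<subseteq> range (\<lambda>w. B *v w)"
    and lam: "lam = lambda_min (transpose B ** B)" "0 < lam"
    and coercive: "coercive (\<lambda>u. (\<Sum>i=1..m. f i (block blk i u)) + ereal (P u - G u))"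
    and \<alpha>: "0 < \<alpha>"
    and \<phi>: "\<And>i. i \<in> {1..m} \<Longrightarrow> \<phi> i differentiable_on block_space blk i \<and>
        strongly_convex_on \<alpha> (block_space blk i) (\<phi> i) \<and>
        l\<phi>-lipschitz_on (block_space blk i) (grad_within (block_space blk i) (\<phi> i))"
    and \<psi>: "\<psi> differentiable_on UNIV" "convex_on UNIV \<psi>" "l\<psi>-lipschitz_on UNIV (grad \<psi>)"
    and \<mu>: "(lP + \<beta>) / \<alpha> < \<mu>" "\<And>n. \<mu> \<le> \<mu>s n" "limsup (\<lambda>n. ereal (\<mu>s n)) = ereal \<mu>bar"
    and \<nu>: "0 \<le> \<nu>" "\<And>n. 0 \<le> \<nu>s n \<and> \<nu>s n \<le> \<nu>"
    and \<rho>: "(lH + sqrt (lH\<^sup>2 + 8 * (lH + 2 * \<nu> * l\<psi>)\<^sup>2)) / (2 * lam) < \<rho>"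
    and z0: "z 0 \<in> range (\<lambda>w. B *v w)"
    and alg: "BPL_ADMM m blk f H P G A B b \<phi> \<psi> \<rho> \<mu>s \<nu>s g x y z"
    and c: "c = (lH + 2 * \<nu> * l\<psi>) * \<nu> * l\<psi> / (lam * \<rho>)"
  shows
    "(KL_function (aug_lagrangian_reg m blk f H P G A B b \<rho> c) \<longrightarrow>
       (\<exists>xs ys zs.
          0 \<in> limiting_subdiff (aug_lagrangian m blk f H P G A B b \<rho>) (xs, ys, zs) \<and>
          (\<lambda>n. (x n, y n, z n)) \<longlonglongrightarrow> (xs, ys, zs)) \<and>
       summable (\<lambda>n. norm ((x (Suc n), y (Suc n), z (Suc n)) - (x n, y n, z n))))
     \<and>
     (\<forall>\<kappa> xs ys zs.
       0 \<le> \<kappa> \<and> \<kappa> < 1 \<and>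
       KL_function_exponent \<kappa> (aug_lagrangian_reg m blk f H P G A B b \<rho> c) \<and>
       (\<lambda>n. (x n, y n, z n)) \<longlonglongrightarrow> (xs, ys, zs) \<longrightarrow>
       (\<kappa> = 0 \<longrightarrow> (\<exists>N. \<forall>n\<ge>N. (x n, y n, z n) = (xs, ys, zs))) \<and>
       (0 < \<kappa> \<and> \<kappa> \<le> 1 / 2 \<longrightarrow>
         (\<exists>\<gamma> \<zeta>. 0 < \<gamma> \<and> 0 < \<zeta> \<and> \<zeta> < 1 \<and>
           (\<forall>n.
             norm ((x n, y n, z n) - (xs, ys, zs)) \<le> \<gamma> * \<zeta> powr (real n / 2) \<and>
             norm (A *v x n + B *v y n - b) \<le> \<gamma> * \<zeta> powr (real n / 2) \<and>
             ((n = 0 \<longrightarrow> objective m blk f H P G (x 0) (y 0) < \<infinity>) \<longrightarrow>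
               \<bar>aug_lagrangian m blk f H P G A B b \<rho> (x n, y n, z n)
                 - aug_lagrangian m blk f H P G A B b \<rho> (xs, ys, zs)\<bar> \<le> ereal (\<gamma> * \<zeta> ^ n) \<and>
               \<bar>objective m blk f H P G (x n) (y n) - objective m blk f H P G xs ys\<bar>
                 \<le> ereal (\<gamma> * \<zeta> powr (real n / 2)))))) \<and>
       (1 / 2 < \<kappa> \<longrightarrow>
         (\<exists>\<gamma>. 0 < \<gamma> \<and>
           (\<forall>n\<ge>1.
             norm ((x n, y n, z n) - (xs, ys, zs))
               \<le> \<gamma> * real n powr (- ((1 - \<kappa>) / (2 * \<kappa> - 1))) \<and>
             norm (A *v x n + B *v y n - b)
               \<le> \<gamma> * real n powr (- ((1 - \<kappa>) / (2 * \<kappa> - 1))) \<and>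
             \<bar>aug_lagrangian m blk f H P G A B b \<rho> (x n, y n, z n)
               - aug_lagrangian m blk f H P G A B b \<rho> (xs, ys, zs)\<bar>
               \<le> ereal (\<gamma> * real n powr (- ((2 - 2 * \<kappa>) / (2 * \<kappa> - 1)))) \<and>
             \<bar>objective m blk f H P G (x n) (y n) - objective m blk f H P G xs ys\<bar>
               \<le> ereal (\<gamma> * real n powr (- ((1 - \<kappa>) / (2 * \<kappa> - 1))))))))"
proof -
  interpret bpl_admm m blk f H P G A B b \<phi> \<psi> x g y z lH lP lG l\<phi> l\<psi> \<alpha> \<beta> lam \<mu> \<mu>bar \<nu> \<rho> c \<mu>s \<nu>s
    by (unfold_locales) (fact assms)+
  show ?thesis
  proof (rule conjI)
    show "KL_function (aug_lagrangian_reg m blk f H P G A B b \<rho> c) \<longrightarrow>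
       (\<exists>xs ys zs.
          0 \<in> limiting_subdiff (aug_lagrangian m blk f H P G A B b \<rho>) (xs, ys, zs) \<and>
          (\<lambda>n. (x n, y n, z n)) \<longlonglongrightarrow> (xs, ys, zs)) \<and>
       summable (\<lambda>n. norm ((x (Suc n), y (Suc n), z (Suc n)) - (x n, y n, z n)))"
      by (rule impI) (rule convergence)
  qed (intro allI impI; elim conjE; intro conjI impI; (elim conjE)?;
      rule finite_convergence linear_rate sublinear_rate; assumption)
qed

end
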